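(* The family $\{NW_n\}$ ($n$ ranging over prime powers) is a family of polynomials in $\mathsf{VNP}$ such that $NW_n$ has degree $\Theta(n)$ and $\Theta(n^2)$ variables, and the following holds. There are absolute constants $\epsilon>0$ and $n_0$ such that for every prime power $n\ge n_0$: if $C$ is a homogeneous $\Sigma\Pi\Sigma\Pi^{\ast}$ circuit of size $s$ (with arbitrary top fan-in) that computes $NW_n$, then $$s\;\ge\;\exp\left(n^{\epsilon}\right).$$
   Context: Circuits are over a fixed field $\mathbb{F}$. A depth 4 ($\Sigma\Pi\Sigma\Pi$) circuit is an expression $P=\sum_{i=1}^{r}\prod_{j=1}^{d_i}Q_{i,j}$, where each $Q_{i,j}$ is computed by a depth 2 $\Sigma\Pi$ circuit, i.e. is written as a sum of monomials. The number $r$ of summands is its top fan-in; its size is its number of gates (nodes), so each $Q_{i,j}$ has at most (size) many monomials. The circuit is homogeneous if the polynomial computed at every gate is homogeneous; then all $Q_{i,j}$ are homogeneous and for each $i$, $\sum_j \deg Q_{i,j}=\deg P$. A homogeneous $\Sigma\Pi\Sigma\Pi^{\ast}$ circuit is a homogeneous depth 4 circuit in which the multiset of degrees $\{\deg Q_{i,j}: 1\le j\le d_i\}$ is the same for every product gate $i\in[r]$ (there is no restriction on $r$ or on what this common multiset is). Nisan–Wigderson polynomials: for a prime power $n$ let $\mathbb{F}_n$ be the field with $n$ elements, its elements identified with $[n]=\{1,\dots,n\}$. For $t\in[n]$ define, in the $n^2$ variables $\{x_{i,j}:i,j\in[n]\}$, $$NW_{t,n}=\sum_{f(z)\in\mathbb{F}_n[z],\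 \deg f<\lfloor n/(2t)\rfloor}\ \prod_{i\in[n]}x_{i,f(i)},$$ and in the $n^2+n$ variables $\{x_{i,j}\}\cup\{y_i:i\in[n]\}$ define $NW_n=\sum_{i=1}^n y_i\cdot NW_{i,n}$, which is homogeneous of degree $n+1$. *)

theory Defs
  imports
    Complex_Main
    "HOL-Library.Poly_Mapping"
    "HOL-Library.Landau_Symbols"
    "HOL-Number_Theory.Prime_Powers"
    "HOL-Algebra.Polynomials"
begin

section \<open>Multivariate polynomials\<close>

text \<open>
  A monomial is a finitely supported exponent function on the variables, a polynomial a finitely
  supported coefficient function on the monomials; multiplication is the convolution product
  of \<^theory>\<open>HOL-Library.Poly_Mapping\<close>.
\<close>

type_synonym 'v monomial = "'v \<Rightarrow>\<^sub>0 nat"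
type_synonym ('v, 'a) mpoly = "'v monomial \<Rightarrow>\<^sub>0 'a"

definition Var :: "'v \<Rightarrow> ('v, 'a::field) mpoly"
  where "Var v = Poly_Mapping.single (Poly_Mapping.single v 1) 1"

definition Const :: "'a \<Rightarrow> ('v, 'a::field) mpoly"
  where "Const c = Poly_Mapping.single 0 c"

definition monomial_degree :: "'v monomial \<Rightarrow> nat"
  where "monomial_degree m = (\<Sum>v\<in>Poly_Mapping.keys m. Poly_Mapping.lookup m v)"

text \<open>The zero polynomial gets total degree 0; it counts as homogeneous.\<close>

definition total_degree :: "('v, 'a::field) mpoly \<Rightarrow> nat"
  where "total_degree p = Max (insert 0 (monomial_degree ` Poly_Mapping.keys p))"

definition homogeneous :: "('v, 'a::field) mpoly \<Rightarrow> bool"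
  where "homogeneous p \<longleftrightarrow> (\<exists>d. \<forall>m\<in>Poly_Mapping.keys p. monomial_degree m = d)"

definition vars :: "('v, 'a::field) mpoly \<Rightarrow> 'v set"
  where "vars p = (\<Union>m\<in>Poly_Mapping.keys p. Poly_Mapping.keys m)"

definition subst :: "('v \<Rightarrow> ('w, 'a) mpoly) \<Rightarrow> ('v, 'a::field) mpoly \<Rightarrow> ('w, 'a) mpoly"
  where "subst \<sigma> p =
    (\<Sum>m\<in>Poly_Mapping.keys p. Const (Poly_Mapping.lookup p m) *
       (\<Prod>v\<in>Poly_Mapping.keys m. \<sigma> v ^ Poly_Mapping.lookup m v))"

section \<open>Arithmetic circuits\<close>

text \<open>
  A circuit is a directed acyclic graph with gates of unbounded fan-in and fan-out, given by the
  list of its gates in topological order: the numbers in a sum or product gate are the positions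
  of its children (a child may be listed repeatedly), and the last gate is the output.
  The leaves are variables and field constants.
\<close>

datatype ('v, 'a) gate =
    InVar 'v
  | InConst 'a
  | SumGate "nat list"
  | ProdGate "nat list"

type_synonym ('v, 'a) circuit = "('v, 'a) gate list"

primrec gate_children :: "('v, 'a) gate \<Rightarrow> nat list" where
  "gate_children (InVar v) = []"
| "gate_children (InConst c) = []"
| "gate_children (SumGate ks) = ks"
| "gate_children (ProdGate ks) = ks"

definition wf_circuit :: "('v, 'a) circuit \<Rightarrow> bool"
  where "wf_circuit C \<longleftrightarrow>
    C \<noteq> [] \<and> (\<forall>i<length C. \<forall>k\<in>set (gate_children (C ! i)). k < i)"

definition circuit_size :: "('v, 'a) circuit \<Rightarrow> nat"
  where "circuit_size C = length C"

primrec gate_poly :: "('v, 'a::field) mpoly list \<Rightarrow> ('v, 'a) gate \<Rightarrow> ('v, 'a) mpoly" where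
  "gate_poly ps (InVar v) = Var v"
| "gate_poly ps (InConst c) = Const c"
| "gate_poly ps (SumGate ks) = (\<Sum>k\<leftarrow>ks. ps ! k)"
| "gate_poly ps (ProdGate ks) = (\<Prod>k\<leftarrow>ks. ps ! k)"

definition gate_polys :: "('v, 'a::field) circuit \<Rightarrow> ('v, 'a) mpoly list"
  where "gate_polys C = foldl (\<lambda>ps g. ps @ [gate_poly ps g]) [] C"

definition computes :: "('v, 'a::field) circuit \<Rightarrow> ('v, 'a) mpoly \<Rightarrow> bool"
  where "computes C p \<longleftrightarrow> wf_circuit C \<and> last (gate_polys C) = p"

definition homogeneous_circuit :: "('v, 'a::field) circuit \<Rightarrow> bool"
  where "homogeneous_circuit C \<longleftrightarrow> (\<forall>p\<in>set (gate_polys C). homogeneous p)"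

subsection \<open>Depth 4 circuits\<close>

primrec is_input :: "('v, 'a) gate \<Rightarrow> bool" where
  "is_input (InVar v) = True"
| "is_input (InConst c) = True"
| "is_input (SumGate ks) = False"
| "is_input (ProdGate ks) = False"

definition is_monomial_gate :: "('v, 'a) circuit \<Rightarrow> nat \<Rightarrow> bool"
  where "is_monomial_gate C k \<longleftrightarrow> (\<exists>ls. C ! k = ProdGate ls \<and> (\<forall>l\<in>set ls. is_input (C ! l)))"

definition is_SP_gate :: "('v, 'a) circuit \<Rightarrow> nat \<Rightarrow> bool"
  where "is_SP_gate C j \<longleftrightarrow> (\<exists>ks. C ! j = SumGate ks \<and> (\<forall>k\<in>set ks. is_monomial_gate C k))"

definition is_PSP_gate :: "('v, 'a) circuit \<Rightarrow> nat \<Rightarrow> bool"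
  where "is_PSP_gate C i \<longleftrightarrow> (\<exists>js. C ! i = ProdGate js \<and> (\<forall>j\<in>set js. is_SP_gate C j))"

definition is_SPSP_circuit :: "('v, 'a) circuit \<Rightarrow> bool"
  where "is_SPSP_circuit C \<longleftrightarrow> wf_circuit C \<and>
    (\<exists>is. last C = SumGate is \<and> (\<forall>i\<in>set is. is_PSP_gate C i))"

definition homogeneous_SPSP_star :: "('v, 'a::field) circuit \<Rightarrow> bool"
  where "homogeneous_SPSP_star C \<longleftrightarrow>
    is_SPSP_circuit C \<and> homogeneous_circuit C \<and>
    (\<exists>D. \<forall>i\<in>set (gate_children (last C)).
       image_mset (\<lambda>j. total_degree (gate_polys C ! j)) (mset (gate_children (C ! i))) = D)"

section \<open>The classes VP and VNP\<close>

text \<open>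
  Families are indexed by a set \<open>I\<close> of natural numbers; only the members with index in \<open>I\<close> matter.
\<close>

definition poly_bounded :: "nat set \<Rightarrow> (nat \<Rightarrow> nat) \<Rightarrow> bool"
  where "poly_bounded I h \<longleftrightarrow> (\<exists>c. \<forall>n\<in>I. h n \<le> n ^ c + c)"

definition in_VP :: "nat set \<Rightarrow> (nat \<Rightarrow> ('v, 'a::field) mpoly) \<Rightarrow> bool"
  where "in_VP I f \<longleftrightarrow>
    poly_bounded I (\<lambda>n. card (vars (f n))) \<and>
    poly_bounded I (\<lambda>n. total_degree (f n)) \<and>
    (\<exists>C. (\<forall>n\<in>I. computes (C n) (f n)) \<and> poly_bounded I (\<lambda>n. circuit_size (C n)))"

text \<open>
  The sum over all 0/1 vectors of length \<open>m n\<close> is a sum over the sets \<open>e\<close> of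
  positions carrying a 1. The variables \<open>Inl v\<close> are those of \<open>f n\<close>, the \<open>Inr k\<close> are summed out.
\<close>

definition in_VNP :: "nat set \<Rightarrow> (nat \<Rightarrow> ('v, 'a::field) mpoly) \<Rightarrow> bool"
  where "in_VNP I f \<longleftrightarrow>
    (\<exists>(m :: nat \<Rightarrow> nat) (g :: nat \<Rightarrow> ('v + nat, 'a) mpoly).
       in_VP I g \<and> poly_bounded I m \<and>
       (\<forall>n\<in>I. vars (g n) \<subseteq> range Inl \<union> Inr ` {..<m n} \<and>
         f n = (\<Sum>e\<in>Pow {..<m n}.
                  subst (case_sum Var (\<lambda>k. if k \<in> e then 1 else 0)) (g n))))"

section \<open>Nisan--Wigderson polynomials\<close>

datatype nw_var = XVar nat nat | YVar nat

text \<open>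
  An identification of the field with \<open>n\<close> elements with \<open>{1..n}\<close> is a field structure on
  the carrier \<open>{1..n}\<close>.
\<close>

definition field_on :: "nat \<Rightarrow> nat ring \<Rightarrow> bool"
  where "field_on n K \<longleftrightarrow> field K \<and> carrier K = {1..n}"

text \<open>
  Univariate polynomials over \<open>K\<close> are coefficient lists with nonzero head, and \<open>[]\<close> is the
  zero polynomial. Its degree is taken to be minus infinity, so it satisfies every degree bound,
  even \<open>degree f < 0\<close>.
\<close>

definition low_degree_polys :: "nat ring \<Rightarrow> nat \<Rightarrow> nat list set"
  where "low_degree_polys K d =
    {f. polynomial\<^bsub>K\<^esub> (carrier K) f \<and> (f = [] \<or> degree f < d)}"

definition NW_t :: "nat ring \<Rightarrow> nat \<Rightarrow> nat \<Rightarrow> (nw_var, 'a::field) mpoly"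
  where "NW_t K t n =
    (\<Sum>f\<in>low_degree_polys K (n div (2 * t)). \<Prod>i\<in>{1..n}. Var (XVar i (ring.eval K f i)))"

definition NW :: "nat ring \<Rightarrow> nat \<Rightarrow> (nw_var, 'a::field) mpoly"
  where "NW K n = (\<Sum>i\<in>{1..n}. Var (YVar i) * NW_t K i n)"

end

theory Submission
  imports Defs "HOL-Algebra.Polynomial_Divisibility" "HOL-Real_Asymp.Real_Asymp"
begin

text \<open>
  All product gates have the same multiset of degrees, of sum \<open>n + 1\<close>. With \<open>B\<close> about \<open>n\<close> to the
  power \<open>1/20\<close>, one of the scales from \<open>b = B ^ i\<close> to \<open>B * b\<close>, \<open>1 \<le> i \<le> 17\<close>, carries at most
  \<open>1/17\<close> of this sum; the star condition makes this scale the same for all gates. Setting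
  \<open>y\<^sub>t = 1\<close> for \<open>t = 16 * b\<close> and the other \<open>y\<^sub>j\<close> to 0 leaves the polynomial \<open>NW\<^sub>t\<close>. In each product gate,
  the at most \<open>(n + 1) / (B * b)\<close> factors of degree above \<open>B * b\<close> are expanded into their at most \<open>s\<close>
  monomials; these and the factors of degree at most \<open>b\<close> are regrouped into \<open>O(n / b)\<close> factors of
  degree at most \<open>2 * b\<close>; the factors on the light scale are treated as one polynomial. Hence the
  shifted partial derivatives of order \<open>k = n div (2 * t)\<close> span a space of small dimension. On the other
  hand, a polynomial of degree less than \<open>k\<close> is determined by \<open>k\<close> of its values, so each of \<open>n ^ k\<close>
  such derivatives of \<open>NW\<^sub>t\<close> is a single monomial, and these monomials are pairwise far apart.
  Comparing the dimensions gives \<open>ln s \<ge> B * ln n / 768\<close>.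
\<close>

text \<open>One budget fixes the parameters. A unit of degree added to the shift costs a factor of
  about exp (4 k ln n / n), so n / 8 units cost n ^ (k / 2), the square root of the number of
  derivatives. The light factors use at most (n + 1) / 17 units; k derivatives of grouped factors
  use 2 k b, at most n / 16 if t = 16 b. The other n ^ (k / 2) must be paid by the expansions, at
  most s ^ ((n + 1) / (B b) + 1), and by the choice of the factors left undifferentiated, 2 ^ O(k).
  As k is about n / (32 b), taking logarithms gains B, the ratio between the two ends of a scale.
  Factors inside a scale suit neither treatment: they may be too many to expand, and their degree is
  too high to be paid once per derivative. The light scale depends on the circuit, hence so does the
  right order of derivatives; this is why the polynomial has one summand for each t, with y as a
  switch. Derivatives are formal, but only multilinear monomials are differentiated on the lower
  bound side, so coefficients stay 1 and the argument works in every characteristic.\<close>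

abbreviation "keys \<equiv> Poly_Mapping.keys"
abbreviation "lookup \<equiv> Poly_Mapping.lookup"
abbreviation "single \<equiv> Poly_Mapping.single"

section \<open>Multivariate polynomials\<close>

lemma monomial_degree_superset:
  assumes "finite A" "keys m \<subseteq> A"
  shows "monomial_degree m = (\<Sum>v\<in>A. lookup m v)"
  unfolding monomial_degree_def using assms
  by (intro sum.mono_neutral_left) (auto simp: in_keys_iff)

lemma monomial_degree_add: "monomial_degree (a + b) = monomial_degree a + monomial_degree b"
proof -
  have k: "keys (a + b) \<subseteq> keys a \<union> keys b"
    by (rule Poly_Mapping.keys_add)
  show ?thesis
    by (simp add: monomial_degree_superset[of "keys a \<union> keys b" "a + b"]
        monomial_degree_superset[of "keys a \<union> keys b" a]
        monomial_degree_superset[of "keys a \<union> keys b" b] k lookup_add sum.distrib)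
qed

lemma monomial_degree_zero [simp]: "monomial_degree 0 = 0"
  by (simp add: monomial_degree_def)

lemma monomial_degree_single [simp]: "monomial_degree (single v k) = k"
  by (simp add: monomial_degree_def)

lemma monomial_degree_sum: "monomial_degree (sum f A) = (\<Sum>a\<in>A. monomial_degree (f a))"
  by (induction A rule: infinite_finite_induct) (auto simp: monomial_degree_add)

lemma keys_add_monomial: "keys (a + b :: 'v monomial) = keys a \<union> keys b"
  by (auto simp: in_keys_iff lookup_add)

lemma monomial_diff_add:
  assumes "\<And>v. lookup a v \<le> lookup b v"
  shows "a + (b - a) = (b :: 'v monomial)"
  by (rule poly_mapping_eqI) (simp add: lookup_add lookup_minus assms)

lemma mpoly_sum_singles: "p = (\<Sum>m\<in>keys p. single m (lookup p m))"
  by (rule poly_mapping_eqI)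
    (simp add: lookup_sum lookup_single when_def in_keys_iff)

text \<open>Reduces bilinear identities, such as the product rule and the multiplicativity of
  \<open>subst\<close>, to pairs of single terms.\<close>

lemma mpoly_add_induct [case_names zero single add]:
  assumes "P 0" "\<And>m c. P (single m c)" "\<And>p q. P p \<Longrightarrow> P q \<Longrightarrow> P (p + q)"
  shows "P (p :: 'k \<Rightarrow>\<^sub>0 'b::comm_monoid_add)"
proof -
  have "P (\<Sum>m\<in>A. single m (lookup p m))" for A
    by (induction A rule: infinite_finite_induct) (auto intro: assms)
  then show ?thesis
    using mpoly_sum_singles[of p] by metis
qed

lemma Const_mult_single: "Const c * single m a = single m (c * a)"
  by (simp add: Const_def mult_single)

lemma Const_simps [simp]: "Const 0 = 0" "Const 1 = 1"
  by (simp_all add: Const_def)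

lemma Const_add: "Const (a + b) = Const a + Const b"
  by (simp add: Const_def single_add)

lemma Const_mult: "Const (a * b) = Const a * Const b"
  by (simp add: Const_def mult_single)

lemma lookup_Const_mult: "lookup (Const c * p) m = c * lookup p m"
  by (induction p rule: mpoly_add_induct)
    (simp_all add: Const_mult_single lookup_single when_def lookup_add distrib_left)

lemma prod_single: "(\<Prod>a\<in>A. single (f a) 1) = (single (\<Sum>a\<in>A. f a) 1 :: 'k::comm_monoid_add \<Rightarrow>\<^sub>0 'a::field)"
  by (induction A rule: infinite_finite_induct) (auto simp: mult_single)

subsection \<open>Bounded degree in a given set of variables\<close>

definition mons :: "'v set \<Rightarrow> nat \<Rightarrow> 'v monomial set"
  where "mons V d = {m. keys m \<subseteq> V \<and> monomial_degree m \<le> d}"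

text \<open>An upper bound instead of an exact degree: these sets contain 0 and are closed under
  addition, and for finite \<open>V\<close> the dimension of \<open>polys V d\<close> is
  \<open>card (mons V d)\<close>.\<close>

definition polys :: "'v set \<Rightarrow> nat \<Rightarrow> ('v, 'a::field) mpoly set"
  where "polys V d = {p. keys p \<subseteq> mons V d}"

lemma mons_mono: "d \<le> e \<Longrightarrow> mons V d \<subseteq> mons V e"
  by (auto simp: mons_def)

lemma mons_add: "a \<in> mons V d \<Longrightarrow> b \<in> mons V e \<Longrightarrow> a + b \<in> mons V (d + e)"
  by (auto simp: mons_def keys_add_monomial monomial_degree_add)

lemma polys_mono: "d \<le> e \<Longrightarrow> p \<in> polys V d \<Longrightarrow> p \<in> polys V e"
  using mons_mono[of d e V] by (auto simp: polys_def)

lemma polys_zero [simp]: "0 \<in> polys V d"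
  by (simp add: polys_def)

lemma polys_single: "m \<in> mons V d \<Longrightarrow> single m c \<in> polys V d"
  by (auto simp: polys_def)

lemma polys_Const [simp]: "Const c \<in> polys V d"
  by (auto simp: polys_def Const_def mons_def)

lemma polys_one [simp]: "1 \<in> polys V d"
  using polys_Const[of 1 V d] by simp

lemma polys_Var: "v \<in> V \<Longrightarrow> Var v \<in> polys V 1"
  unfolding Var_def by (rule polys_single) (auto simp: mons_def)

lemma polys_add: "p \<in> polys V d \<Longrightarrow> q \<in> polys V d \<Longrightarrow> p + q \<in> polys V d"
  using Poly_Mapping.keys_add[of p q] unfolding polys_def by blast

lemma polys_sum: "(\<And>a. a \<in> A \<Longrightarrow> f a \<in> polys V d) \<Longrightarrow> sum f A \<in> polys V d"
  by (induction A rule: infinite_finite_induct) (auto intro: polys_add)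

lemma polys_mult: "p \<in> polys V d \<Longrightarrow> q \<in> polys V e \<Longrightarrow> p * q \<in> polys V (d + e)"
proof -
  assume *: "p \<in> polys V d" "q \<in> polys V e"
  have "keys (p * q) \<subseteq> {a + b | a b. a \<in> keys p \<and> b \<in> keys q}"
    by (rule Poly_Mapping.keys_mult)
  with * show ?thesis
    unfolding polys_def using mons_add by blast
qed

lemma polys_power: "p \<in> polys V d \<Longrightarrow> p ^ k \<in> polys V (k * d)"
  by (induction k) (auto intro: polys_mult)

lemma polys_prod: "(\<And>a. a \<in> A \<Longrightarrow> f a \<in> polys V (d a)) \<Longrightarrow> prod f A \<in> polys V (sum d A)"
  by (induction A rule: infinite_finite_induct) (auto intro: polys_mult)

lemma total_degree_le: "p \<in> polys V d \<Longrightarrow> total_degree p \<le> d"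
  by (auto simp: polys_def mons_def total_degree_def)

subsection \<open>Substitution\<close>

definition subst_monomial :: "('v \<Rightarrow> ('w, 'a::field) mpoly) \<Rightarrow> 'v monomial \<Rightarrow> ('w, 'a) mpoly"
  where "subst_monomial \<sigma> m = (\<Prod>v\<in>keys m. \<sigma> v ^ lookup m v)"

lemma subst_monomial_superset:
  assumes "finite A" "keys m \<subseteq> A"
  shows "subst_monomial \<sigma> m = (\<Prod>v\<in>A. \<sigma> v ^ lookup m v)"
  unfolding subst_monomial_def using assms
  by (intro prod.mono_neutral_left) (auto simp: in_keys_iff)

lemma subst_monomial_add: "subst_monomial \<sigma> (a + b) = subst_monomial \<sigma> a * subst_monomial \<sigma> b"
  by (simp add: subst_monomial_superset[of "keys a \<union> keys b"] keys_add_monomial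
      lookup_add power_add prod.distrib)

lemma subst_add: "subst \<sigma> (p + q) = subst \<sigma> p + subst \<sigma> q"
  unfolding subst_def
  by (rule setsum_keys_plus_distrib) (auto simp: Const_add distrib_right)

lemma subst_single: "subst \<sigma> (single m c) = Const c * subst_monomial \<sigma> m"
  by (auto simp: subst_def subst_monomial_def)

lemma subst_zero [simp]: "subst \<sigma> 0 = 0"
  by (simp add: subst_def)

lemma subst_Const [simp]: "subst \<sigma> (Const c) = Const c"
  unfolding Const_def subst_single by (simp add: subst_monomial_def Const_def)

lemma subst_one [simp]: "subst \<sigma> 1 = 1"
  using subst_Const[of \<sigma> 1] by (simp del: subst_Const)

lemma subst_Var [simp]: "subst \<sigma> (Var v) = \<sigma> v"
  unfolding Var_def subst_single by (simp add: subst_monomial_def)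

lemma subst_mult: "subst \<sigma> (p * q) = subst \<sigma> p * subst \<sigma> q"
proof (induction p rule: mpoly_add_induct)
  case (single m c)
  show ?case
    by (induction q rule: mpoly_add_induct)
      (simp_all add: mult_single subst_single subst_monomial_add Const_mult subst_add distrib_left)
qed (simp_all add: subst_add distrib_right)

lemma subst_sum: "subst \<sigma> (sum f A) = (\<Sum>a\<in>A. subst \<sigma> (f a))"
  by (induction A rule: infinite_finite_induct) (auto simp: subst_add)

lemma subst_prod: "subst \<sigma> (prod f A) = (\<Prod>a\<in>A. subst \<sigma> (f a))"
  by (induction A rule: infinite_finite_induct) (auto simp: subst_mult)

lemma subst_sum_list: "subst \<sigma> (sum_list ps) = sum_list (map (subst \<sigma>) ps)"
  by (induction ps) (auto simp: subst_add)

lemma subst_monomial_in_polys: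
  assumes "\<And>v. \<sigma> v \<in> polys V 1"
  shows "subst_monomial \<sigma> m \<in> polys V (monomial_degree m)"
  unfolding subst_monomial_def monomial_degree_def
  by (rule polys_prod) (metis assms mult.right_neutral polys_power)

lemma subst_in_polys:
  assumes "\<And>v. \<sigma> v \<in> polys V 1"
  shows "subst \<sigma> p \<in> polys V (total_degree p)"
proof -
  have "Const (lookup p m) * subst_monomial \<sigma> m \<in> polys V (total_degree p)" if "m \<in> keys p" for m
  proof -
    have "monomial_degree m \<le> total_degree p"
      using that by (auto simp: total_degree_def)
    then show ?thesis
      using polys_mult[OF polys_Const[of "lookup p m" V 0] subst_monomial_in_polys[where \<sigma>=\<sigma>]] assms
      by (metis add_0 polys_mono)
  qed
  then show ?thesis
    unfolding subst_def subst_monomial_def[symmetric] by (rule polys_sum)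
qed

subsection \<open>Partial derivatives\<close>

text \<open>If \<open>v\<close> does not occur in \<open>m\<close>, the truncated difference returns
  \<open>m\<close> itself, but then the coefficient is 0.\<close>

definition pderiv_mp :: "'v \<Rightarrow> ('v, 'a::field) mpoly \<Rightarrow> ('v, 'a) mpoly"
  where "pderiv_mp v p =
    (\<Sum>m\<in>keys p. single (m - single v 1) (of_nat (lookup m v) * lookup p m))"

lemma pderiv_mp_add: "pderiv_mp v (p + q) = pderiv_mp v p + pderiv_mp v q"
  unfolding pderiv_mp_def
  by (rule setsum_keys_plus_distrib) (auto simp: distrib_left single_add)

lemma pderiv_mp_zero [simp]: "pderiv_mp v 0 = 0"
  by (simp add: pderiv_mp_def)

lemma pderiv_mp_single:
  "pderiv_mp v (single m c) = single (m - single v 1) (of_nat (lookup m v) * c)"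
  by (auto simp: pderiv_mp_def)

lemma pderiv_mp_mult:
  "pderiv_mp v (p * q) = pderiv_mp v p * q + p * pderiv_mp v q"
proof (induction p rule: mpoly_add_induct)
  case (single m c)
  show ?case
  proof (induction q rule: mpoly_add_induct)
    case (single m' c')
    \<comment> \<open>Truncated subtraction commutes with adding \<open>m'\<close> only where the
      exponent of \<open>v\<close> is positive; otherwise the coefficient of the term
      vanishes.\<close>
    have *: "m + m' - single v 1 = (m - single v 1) + m'" if "lookup m v > 0" for m m' :: "'a monomial"
      by (rule poly_mapping_eqI)
        (use that in \<open>auto simp: lookup_add lookup_minus lookup_single when_def\<close>)
    show ?case
      using *[of m m'] *[of m' m]
      by (cases "lookup m v > 0"; cases "lookup m' v > 0")
        (simp_all add: mult_single pderiv_mp_single lookup_add single_add[symmetric] algebra_simps)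
  qed (simp_all add: pderiv_mp_add algebra_simps)
qed (simp_all add: pderiv_mp_add algebra_simps)

lemma pderiv_mp_Const [simp]: "pderiv_mp v (Const c) = 0"
  by (simp add: Const_def pderiv_mp_single)

lemma pderiv_mp_one [simp]: "pderiv_mp v 1 = 0"
  using pderiv_mp_Const[of v 1] by (simp del: pderiv_mp_Const)

lemma pderiv_mp_Const_mult: "pderiv_mp v (Const c * p) = Const c * pderiv_mp v p"
  by (simp add: pderiv_mp_mult)

lemma pderiv_mp_sum: "pderiv_mp v (sum f A) = (\<Sum>a\<in>A. pderiv_mp v (f a))"
  by (induction A rule: infinite_finite_induct) (auto simp: pderiv_mp_add)

lemma pderiv_mp_prod:
  assumes "finite A"
  shows "pderiv_mp v (prod f A) = (\<Sum>a\<in>A. pderiv_mp v (f a) * prod f (A - {a}))"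
  using assms
proof (induction A rule: finite_induct)
  case (insert x A)
  have "pderiv_mp v (f a) * prod f (insert x A - {a}) = f x * (pderiv_mp v (f a) * prod f (A - {a}))"
    if "a \<in> A" for a
  proof -
    have "insert x A - {a} = insert x (A - {a})" "x \<notin> A - {a}"
      using insert that by auto
    then show ?thesis
      using insert by (simp add: algebra_simps)
  qed
  then show ?case
    using insert by (simp add: pderiv_mp_mult sum_distrib_left)
qed simp

lemma pderiv_mp_in_polys: "p \<in> polys V d \<Longrightarrow> pderiv_mp v p \<in> polys V d"
  unfolding pderiv_mp_def
proof (rule polys_sum, rule polys_single)
  fix m assume "p \<in> polys V d" "m \<in> keys p"
  then have m: "keys m \<subseteq> V" "monomial_degree m \<le> d"
    by (auto simp: polys_def mons_def)
  have k: "keys (m - single v 1) \<subseteq> keys m"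
    by (auto simp: in_keys_iff lookup_minus)
  have "monomial_degree (m - single v 1) = (\<Sum>w\<in>keys m. lookup (m - single v 1) w)"
    using k by (simp add: monomial_degree_superset)
  also have "\<dots> \<le> monomial_degree m"
    unfolding monomial_degree_def by (rule sum_mono) (simp add: lookup_minus)
  finally show "m - single v 1 \<in> mons V d"
    using m k by (auto simp: mons_def)
qed

subsection \<open>Linear algebra\<close>

interpretation mv: vector_space "\<lambda>c p. Const c * (p :: ('v, 'a::field) mpoly)"
  by unfold_locales (simp_all add: Const_add Const_mult algebra_simps)

lemma single_one_eq_iff: "single m (1 :: 'a::zero_neq_one) = single m' 1 \<longleftrightarrow> m = m'"
  by (metis keys_single one_neq_zero singleton_inject)

text \<open>Reading off the coefficient of \<open>m\<close> in a linear relation isolates the scalar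
  at \<open>single m 1\<close>.\<close>

lemma independent_monomials:
  "mv.independent ((\<lambda>m. single m 1) ` S :: ('v, 'a::field) mpoly set)"
proof
  assume "mv.dependent ((\<lambda>m. single m 1) ` S :: ('v, 'a) mpoly set)"
  then obtain t and u :: "('v, 'a) mpoly \<Rightarrow> 'a" where t: "finite t" "t \<subseteq> (\<lambda>m. single m 1) ` S"
    "(\<Sum>v\<in>t. Const (u v) * v) = 0" "\<exists>v\<in>t. u v \<noteq> 0"
    unfolding mv.dependent_explicit by blast
  then obtain m where m: "single m 1 \<in> t" "u (single m 1) \<noteq> 0"
    by blast
  have "0 = lookup (\<Sum>v\<in>t. Const (u v) * v) m"
    using t by simp
  also have "\<dots> = (\<Sum>v\<in>t. if v = single m 1 then u v else 0)"
    unfolding lookup_sum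
  proof (rule sum.cong)
    fix v assume "v \<in> t"
    then obtain m' where v: "v = single m' 1"
      using t by blast
    show "lookup (Const (u v) * v) m = (if v = single m 1 then u v else 0)"
      by (auto simp: v lookup_Const_mult lookup_single when_def single_one_eq_iff)
  qed simp
  also have "\<dots> = u (single m 1)"
    using t m by simp
  finally show False
    using m by simp
qed

text \<open>The only form in which dimension enters the lower bound: counting monomials inside a
  span replaces computing a rank.\<close>

lemma card_monomials_le_spanning:
  assumes "finite (B :: ('v, 'a::field) mpoly set)" "(\<lambda>m. single m 1) ` S \<subseteq> mv.span B"
  shows "finite S" "card S \<le> card B"
proof -
  have inj: "inj_on (\<lambda>m. single m 1 :: ('v, 'a) mpoly) S"
    by (rule inj_onI) (simp add: single_one_eq_iff)
  have *: "finite ((\<lambda>m. single m 1 :: ('v, 'a) mpoly) ` S) \<and>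
      card ((\<lambda>m. single m 1 :: ('v, 'a) mpoly) ` S) \<le> card B"
    using mv.independent_span_bound[OF assms(1) independent_monomials assms(2)] .
  then show "finite S" "card S \<le> card B"
    using inj finite_imageD[of _ S] by (auto simp: card_image)
qed


section \<open>Shifted partial derivatives\<close>

definition pderivs_mp :: "'v list \<Rightarrow> ('v, 'a::field) mpoly \<Rightarrow> ('v, 'a) mpoly"
  where "pderivs_mp vs p = foldr pderiv_mp vs p"

lemma pderivs_mp_simps [simp]:
  "pderivs_mp [] p = p" "pderivs_mp (v # vs) p = pderiv_mp v (pderivs_mp vs p)"
  by (simp_all add: pderivs_mp_def)

lemma pderivs_mp_sum: "pderivs_mp vs (sum f A) = (\<Sum>a\<in>A. pderivs_mp vs (f a))"
  by (induction vs) (auto simp: pderiv_mp_sum)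

definition shifted_products ::
    "'v set \<Rightarrow> (nat \<Rightarrow> ('v, 'a::field) mpoly) set \<Rightarrow> nat \<Rightarrow> nat \<Rightarrow> ('v, 'a) mpoly set"
  where "shifted_products V \<G> m h =
    (\<lambda>(G, a, J). single a 1 * prod G J) ` (\<G> \<times> mons V h \<times> Pow {..<m})"

lemma span_shifted_products_memI:
  assumes "G \<in> \<G>" "A \<in> polys V h" "J \<subseteq> {..<m}"
  shows "A * prod G J \<in> mv.span (shifted_products V \<G> m h)"
proof -
  have "A * prod G J = (\<Sum>a\<in>keys A. Const (lookup A a) * (single a 1 * prod G J))"
    by (subst mpoly_sum_singles[of A]) (simp add: sum_distrib_right Const_mult_single flip: mult.assoc)
  also have "\<dots> \<in> mv.span (shifted_products V \<G> m h)"
  proof (intro mv.span_sum mv.span_scale mv.span_base)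
    fix a assume "a \<in> keys A"
    then have "a \<in> mons V h"
      using assms by (auto simp: polys_def)
    then show "single a 1 * prod G J \<in> shifted_products V \<G> m h"
      using assms unfolding shifted_products_def by (intro image_eqI[of _ _ "(G, a, J)"]) auto
  qed
  finally show ?thesis .
qed

text \<open>A derivative hits either the multiplier or one factor \<open>G j\<close>; in the second
  case \<open>j\<close> leaves \<open>J\<close> and the differentiated factor joins the multiplier,
  whose degree bound grows by \<open>g\<close>. The family \<G> never changes.\<close>

lemma pderiv_mp_span_shifted_products:
  assumes G: "\<forall>G\<in>\<G>. \<forall>j. G j \<in> polys V g"
    and p: "p \<in> mv.span (shifted_products V \<G> m h)"
  shows "pderiv_mp v p \<in> mv.span (shifted_products V \<G> m (h + g))"
  using p
proof (induction rule: mv.span_induct_alt)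
  case (step c x y)
  then obtain G a J where x: "x = single a 1 * prod G J" "G \<in> \<G>" "a \<in> mons V h" "J \<subseteq> {..<m}"
    by (auto simp: shifted_products_def)
  have a: "single a 1 \<in> polys V h"
    using x by (simp add: polys_single)
  have J: "finite J"
    using x finite_subset by blast
  have "pderiv_mp v x = pderiv_mp v (single a 1) * prod G J
      + (\<Sum>j\<in>J. (single a 1 * pderiv_mp v (G j)) * prod G (J - {j}))"
    unfolding x pderiv_mp_mult pderiv_mp_prod[OF J] by (simp add: sum_distrib_left mult.assoc)
  also have "\<dots> \<in> mv.span (shifted_products V \<G> m (h + g))"
    using x a G polys_mono[of h "h + g", OF _ a]
    by (intro mv.span_add mv.span_sum span_shifted_products_memI polys_mult pderiv_mp_in_polys)
      auto
  finally show ?case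
    using step by (simp add: pderiv_mp_add pderiv_mp_Const_mult mv.span_add mv.span_scale)
qed (simp add: mv.span_zero)

lemma pderivs_mp_span_shifted_products:
  assumes G: "\<forall>G\<in>\<G>. \<forall>j. G j \<in> polys V g"
    and p: "p \<in> mv.span (shifted_products V \<G> m h)"
  shows "pderivs_mp vs p \<in> mv.span (shifted_products V \<G> m (h + length vs * g))"
proof (induction vs)
  case (Cons v vs)
  from pderiv_mp_span_shifted_products[OF G Cons, of v] show ?case
    by (simp add: algebra_simps)
qed (use p in simp)

lemma shift_span_shifted_products:
  assumes p: "p \<in> mv.span (shifted_products V \<G> m h)" and c: "c \<in> mons V l"
  shows "single c 1 * p \<in> mv.span (shifted_products V \<G> m (l + h))"
  using p
proof (induction rule: mv.span_induct_alt)
  case (step r x y)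
  then obtain G a J where x: "x = single a 1 * prod G J" "G \<in> \<G>" "a \<in> mons V h" "J \<subseteq> {..<m}"
    by (auto simp: shifted_products_def)
  have "single c 1 * x = single (c + a) 1 * prod G J"
    by (simp add: x mult_single flip: mult.assoc)
  also have "\<dots> \<in> mv.span (shifted_products V \<G> m (l + h))"
    using x c by (intro span_shifted_products_memI polys_single mons_add)
  finally have "single c 1 * x \<in> mv.span (shifted_products V \<G> m (l + h))" .
  moreover have "single c 1 * (Const r * x + y) = Const r * (single c 1 * x) + single c 1 * y"
    by (simp add: algebra_simps)
  ultimately show ?case
    using step by (simp add: mv.span_add mv.span_scale)
qed (simp add: mv.span_zero)

subsection \<open>Counting monomials\<close>

lemma mons_insert:
  assumes "x \<notin> V"
  shows "mons (insert x V) l = (\<Union>j\<in>{..l}. (\<lambda>m. m + single x j) ` mons V (l - j))"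
proof (intro equalityI subsetI)
  fix m assume m: "m \<in> mons (insert x V) l"
  define j where "j = lookup m x"
  define m' where "m' = m - single x j"
  have eq: "m = m' + single x j"
    unfolding m'_def
    by (rule poly_mapping_eqI) (auto simp: lookup_add lookup_minus lookup_single when_def j_def)
  have "keys m' \<subseteq> V"
  proof
    fix y assume "y \<in> keys m'"
    then have "y \<noteq> x" "y \<in> keys m"
      by (auto simp: m'_def in_keys_iff lookup_minus lookup_single when_def j_def)
    then show "y \<in> V"
      using m by (auto simp: mons_def)
  qed
  moreover have "monomial_degree m = monomial_degree m' + j"
    by (subst eq) (simp add: monomial_degree_add)
  ultimately show "m \<in> (\<Union>j\<in>{..l}. (\<lambda>m. m + single x j) ` mons V (l - j))"
    using m eq by (intro UN_I[of j] image_eqI[of _ _ m']) (auto simp: mons_def)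
next
  fix m assume "m \<in> (\<Union>j\<in>{..l}. (\<lambda>m. m + single x j) ` mons V (l - j))"
  then show "m \<in> mons (insert x V) l"
    by (auto simp: mons_def keys_add_monomial monomial_degree_add split: if_splits)
qed

text \<open>Stars and bars: sorting by the exponent of the new variable gives a hockey-stick sum of
  binomial coefficients.\<close>

lemma mons_finite_card:
  assumes "finite V"
  shows "finite (mons V l) \<and> card (mons V l) = (card V + l) choose l"
  using assms
proof (induction V arbitrary: l rule: finite_induct)
  case empty
  have "mons {} l = {0 :: 'a monomial}"
    by (auto simp: mons_def)
  then show ?case
    by simp
next
  case (insert x V)
  have disj: "\<forall>i\<in>{..l}. \<forall>j\<in>{..l}. i \<noteq> j \<longrightarrow>
      ((\<lambda>m. m + single x i) ` mons V (l - i)) \<inter> ((\<lambda>m. m + single x j) ` mons V (l - j)) = {}"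
  proof (intro ballI impI, rule ccontr)
    fix i j :: nat
    assume "i \<noteq> j" "((\<lambda>m. m + single x i) ` mons V (l - i)) \<inter> ((\<lambda>m. m + single x j) ` mons V (l - j)) \<noteq> {}"
    then obtain m m' where "m + single x i = m' + single x j" "keys m \<subseteq> V" "keys m' \<subseteq> V"
      by (auto simp: mons_def)
    moreover from this have "lookup m x = 0" "lookup m' x = 0"
      using insert by (auto simp: in_keys_iff)
    ultimately have "i = j"
      by (metis add_0 lookup_add lookup_single_eq)
    with \<open>i \<noteq> j\<close> show False
      by simp
  qed
  have fin: "\<forall>j\<in>{..l}. finite ((\<lambda>m. m + single x j) ` mons V (l - j))"
    using insert by simp
  have "card (mons (insert x V) l) = (\<Sum>j\<le>l. card ((\<lambda>m. m + single x j) ` mons V (l - j)))"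
    unfolding mons_insert[OF insert.hyps(2)] by (rule card_UN_disjoint[OF _ fin disj]) simp
  also have "\<dots> = (\<Sum>j\<le>l. (card V + (l - j)) choose (l - j))"
    using insert by (intro sum.cong refl) (simp add: card_image inj_on_def)
  also have "\<dots> = (\<Sum>j\<le>l. (card V + j) choose j)"
    using sum.nat_diff_reindex[of "\<lambda>j. (card V + j) choose j" "Suc l"]
    by (simp add: lessThan_Suc_atMost)
  also have "\<dots> = Suc (card V + l) choose l"
    by (rule sum_choose_lower)
  finally show ?case
    using insert fin by (simp add: mons_insert)
qed

lemmas finite_mons = mons_finite_card[THEN conjunct1]
  and card_mons = mons_finite_card[THEN conjunct2]

text \<open>The growth factor per degree decreases with \<open>l\<close>. Hence over several steps a
  factor taken at the start bounds the growth from above, and the factor of the last step bounds it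
  from below.\<close>

lemma card_mons_Suc:
  assumes "finite V"
  shows "real (card (mons V (Suc l))) = real (card (mons V l)) * (1 + real (card V) / real (Suc l))"
proof -
  have "Suc (card V + l) * ((card V + l) choose l) = (Suc (card V + l) choose Suc l) * Suc l"
    by (rule Suc_times_binomial_eq)
  then have "real (Suc (card V + l) * ((card V + l) choose l)) = real ((Suc (card V + l) choose Suc l) * Suc l)"
    by (rule arg_cong)
  then have "real (Suc (card V + l)) * real (card (mons V l)) = real (card (mons V (Suc l))) * real (Suc l)"
    using assms by (simp only: card_mons of_nat_mult add_Suc_right)
  then show ?thesis
    by (simp add: field_simps)
qed

lemma card_mons_add_le:
  assumes "finite V" "0 < l"
  shows "real (card (mons V (l + h))) \<le> real (card (mons V l)) * (1 + real (card V) / real l) ^ h"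
proof (induction h)
  case (Suc h)
  have "real (card (mons V (l + Suc h)))
      = real (card (mons V (l + h))) * (1 + real (card V) / real (Suc (l + h)))"
    using card_mons_Suc[OF assms(1), of "l + h"] by simp
  also have "\<dots> \<le> (real (card (mons V l)) * (1 + real (card V) / real l) ^ h) * (1 + real (card V) / real l)"
    using assms by (intro mult_mono Suc) (auto intro!: divide_left_mono)
  finally show ?case
    by (simp add: algebra_simps)
qed simp

lemma card_mons_add_ge:
  assumes "finite V"
  shows "real (card (mons V l)) * (1 + real (card V) / real (l + h)) ^ h \<le> real (card (mons V (l + h)))"
proof -
  have "real (card (mons V l)) * (1 + real (card V) / real (l + h)) ^ i \<le> real (card (mons V (l + i)))"
    if "i \<le> h" for i
    using that
  proof (induction i)
    case (Suc i)
    have "real (card (mons V l)) * (1 + real (card V) / real (l + h)) ^ Suc i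
        \<le> real (card (mons V (l + i))) * (1 + real (card V) / real (l + h))"
      unfolding power_Suc2 mult.assoc[symmetric] using Suc by (intro mult_right_mono) auto
    also have "\<dots> \<le> real (card (mons V (l + i))) * (1 + real (card V) / real (Suc (l + i)))"
      using Suc by (intro mult_left_mono add_left_mono divide_left_mono) auto
    also have "\<dots> = real (card (mons V (l + Suc i)))"
      using card_mons_Suc[OF assms, of "l + i"] by simp
    finally show ?case .
  qed simp
  then show ?thesis
    by simp
qed

section \<open>Dimension bounds for shifted partial derivatives\<close>

lemma card_shifted_products:
  assumes "finite V" "finite \<G>"
  shows "finite (shifted_products V \<G> m h)"
    and "card (shifted_products V \<G> m h) \<le> card \<G> * 2 ^ m * card (mons V h)"
proof -
  show "finite (shifted_products V \<G> m h)"
    using assms by (simp add: shifted_products_def finite_mons)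
  have "card (shifted_products V \<G> m h) \<le> card (\<G> \<times> mons V h \<times> Pow {..<m})"
    unfolding shifted_products_def using assms by (intro card_image_le) (simp add: finite_mons)
  then show "card (shifted_products V \<G> m h) \<le> card \<G> * 2 ^ m * card (mons V h)"
    by (simp add: card_cartesian_product card_Pow mult_ac)
qed

text \<open>Upper half of the dimension comparison: the shifted derivatives are monomials, so
  distinct ones are independent, and all lie in the span of the products counted on the
  right.\<close>

lemma card_shifted_derivatives_le:
  fixes p :: "('v, 'a::field) mpoly"
  assumes V: "finite V" and \<G>: "finite \<G>" "\<forall>G\<in>\<G>. \<forall>j. G j \<in> polys V g"
    and p: "p \<in> mv.span (shifted_products V \<G> m h)"
    and F: "\<And>f. f \<in> F \<Longrightarrow> pderivs_mp (vs f) p = single (\<mu> f) 1" "\<And>f. f \<in> F \<Longrightarrow> length (vs f) = k"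
  shows "card (\<Union>f\<in>F. (\<lambda>c. c + \<mu> f) ` mons V l) \<le> card \<G> * 2 ^ m * card (mons V (l + (h + k * g)))"
proof -
  let ?B = "shifted_products V \<G> m (l + (h + k * g))"
  have "(\<lambda>m. single m 1) ` (\<Union>f\<in>F. (\<lambda>c. c + \<mu> f) ` mons V l) \<subseteq> mv.span ?B"
  proof clarify
    fix f c assume f: "f \<in> F" and c: "c \<in> mons V l"
    have "single c 1 * pderivs_mp (vs f) p \<in> mv.span ?B"
      using pderivs_mp_span_shifted_products[OF \<G>(2) p, of "vs f"] F f c
      by (intro shift_span_shifted_products) auto
    then show "single (c + \<mu> f) 1 \<in> mv.span ?B"
      using F f by (simp add: mult_single)
  qed
  from card_monomials_le_spanning(2)[OF card_shifted_products(1)[OF V \<G>(1)] this]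
    card_shifted_products(2)[OF V \<G>(1), of m "l + (h + k * g)"]
  show ?thesis
    by linarith
qed

text \<open>Deleting from each set its overlaps with the others leaves disjoint sets that have lost
  at most \<open>card F * c\<close> elements each. The additive form avoids truncated
  subtraction.\<close>

lemma card_UN_ge_bonferroni:
  fixes A :: "'i \<Rightarrow> 'b set"
  assumes F: "finite F" and fin: "\<And>f. f \<in> F \<Longrightarrow> finite (A f)"
    and a: "\<And>f. f \<in> F \<Longrightarrow> a \<le> card (A f)"
    and c: "\<And>f g. f \<in> F \<Longrightarrow> g \<in> F \<Longrightarrow> f \<noteq> g \<Longrightarrow> card (A f \<inter> A g) \<le> c"
  shows "card F * a \<le> card (\<Union>f\<in>F. A f) + card F * (card F * c)"
proof -
  define B where "B f = A f - (\<Union>g\<in>F - {f}. A g)" for f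
  have "a \<le> card (B f) + card F * c" if f: "f \<in> F" for f
  proof -
    have "a \<le> card (A f)"
      using a f .
    also have "\<dots> \<le> card (B f \<union> (\<Union>g\<in>F - {f}. A f \<inter> A g))"
      using f F fin by (intro card_mono) (auto simp: B_def)
    also have "\<dots> \<le> card (B f) + card (\<Union>g\<in>F - {f}. A f \<inter> A g)"
      by (rule card_Un_le)
    also have "card (\<Union>g\<in>F - {f}. A f \<inter> A g) \<le> (\<Sum>g\<in>F - {f}. card (A f \<inter> A g))"
      using F by (intro card_UN_le) simp
    also have "\<dots> \<le> (\<Sum>g\<in>F - {f}. c)"
      using f c by (intro sum_mono) auto
    also have "\<dots> \<le> card F * c"
      using F by (simp add: card_Diff_subset_Int card_mono)
    finally show ?thesis
      by simp
  qed
  then have "(\<Sum>f\<in>F. a) \<le> (\<Sum>f\<in>F. card (B f) + card F * c)"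
    by (rule sum_mono)
  also have "\<dots> = card (\<Union>f\<in>F. B f) + card F * (card F * c)"
    using F fin by (subst card_UN_disjoint) (auto simp: B_def sum.distrib)
  also have "card (\<Union>f\<in>F. B f) \<le> card (\<Union>f\<in>F. A f)"
    using F fin by (intro card_mono) (auto simp: B_def)
  finally show ?thesis
    by simp
qed

text \<open>If \<open>c + a = c' + b\<close>, then \<open>c\<close> contains the excess of
  \<open>b\<close> over \<open>a\<close>, which is the truncated difference \<open>b - a\<close>.
  What is left of \<open>c\<close> has degree at most \<open>l - d\<close> and determines the common
  monomial.\<close>

lemma card_shifts_inter_le:
  fixes a b :: "'v monomial"
  assumes V: "finite V" and d: "d \<le> monomial_degree (b - a)"
  shows "card (((\<lambda>c. c + a) ` mons V l) \<inter> ((\<lambda>c. c + b) ` mons V l)) \<le> card (mons V (l - d))"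
proof -
  have "((\<lambda>c. c + a) ` mons V l) \<inter> ((\<lambda>c. c + b) ` mons V l) \<subseteq> (\<lambda>c. c + (b - a) + a) ` mons V (l - d)"
  proof
    fix x assume "x \<in> ((\<lambda>c. c + a) ` mons V l) \<inter> ((\<lambda>c. c + b) ` mons V l)"
    then obtain c c' where x: "x = c + a" and eq: "c + a = c' + b" and c: "c \<in> mons V l"
      by auto
    have le: "lookup (b - a) v \<le> lookup c v" for v
    proof -
      have "lookup (c + a) v = lookup (c' + b) v"
        using eq by simp
      then show ?thesis
        by (simp add: lookup_add lookup_minus)
    qed
    have c_eq: "c = (c - (b - a)) + (b - a)"
      using monomial_diff_add[OF le] by (simp add: add.commute)
    then have "monomial_degree c = monomial_degree (c - (b - a)) + monomial_degree (b - a)"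
      by (metis monomial_degree_add)
    moreover have "keys (c - (b - a)) \<subseteq> keys c"
      by (auto simp: in_keys_iff lookup_minus)
    ultimately have "c - (b - a) \<in> mons V (l - d)"
      using c d by (auto simp: mons_def)
    then show "x \<in> (\<lambda>c. c + (b - a) + a) ` mons V (l - d)"
      using c_eq x by (intro image_eqI[of _ _ "c - (b - a)"]) simp_all
  qed
  then have "card (((\<lambda>c. c + a) ` mons V l) \<inter> ((\<lambda>c. c + b) ` mons V l))
      \<le> card ((\<lambda>c. c + (b - a) + a) ` mons V (l - d))"
    using V by (intro card_mono) (auto simp: finite_mons)
  also have "\<dots> \<le> card (mons V (l - d))"
    using V by (intro card_image_le) (simp add: finite_mons)
  finally show ?thesis .
qed


section \<open>Regrouping and expanding the factors of a product gate\<close>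

text \<open>
  The common outcome of regrouping: all factors in \<open>gs\<close> but not \<open>h\<close> use up \<open>b\<close> of the total
  degree \<open>D\<close>, which bounds their number by \<open>D div b\<close>.
\<close>

definition chunked :: "'v set \<Rightarrow> nat \<Rightarrow> nat \<Rightarrow> ('v, 'a::field) mpoly \<Rightarrow> bool"
  where "chunked V b D p \<longleftrightarrow> (\<exists>h d gs. p = h * prod_list gs \<and> h \<in> polys V d \<and> d < b \<and>
    set gs \<subseteq> polys V (2 * b) \<and> b * length gs + d \<le> D)"

lemma chunked_mono: "D \<le> E \<Longrightarrow> chunked V b D p \<Longrightarrow> chunked V b E p"
  unfolding chunked_def using order_trans[of _ D E] by blast

text \<open>The leftover factor must stay strictly below degree \<open>b\<close>, so a factor with
  \<open>d = b\<close> becomes a chunk of its own.\<close>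

lemma chunked_small:
  assumes "q \<in> polys V d" "d \<le> b" "0 < b"
  shows "chunked V b d q"
proof (cases "d < b")
  case True
  then show ?thesis
    unfolding chunked_def using assms by (intro exI[of _ q] exI[of _ d] exI[of _ "[]"]) simp
next
  case False
  then show ?thesis
    unfolding chunked_def using assms polys_mono[of d "2 * b" q]
    by (intro exI[of _ 1] exI[of _ 0] exI[of _ "[q]"]) simp
qed

lemma chunked_one: "0 < b \<Longrightarrow> chunked V b 0 1"
  by (rule chunked_small) simp_all

text \<open>Greedy grouping: the two leftovers are merged. If their degrees reach \<open>b\<close>
  together, the product is promoted to a chunk; it has used up \<open>b\<close> of the budget and
  its degree is still below \<open>2 * b\<close>.\<close>

lemma chunked_mult:
  assumes "chunked V b D p" "chunked V b E q"
  shows "chunked V b (D + E) (p * q)"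
proof -
  from assms obtain h d gs h' d' gs' where
    p: "p = h * prod_list gs" "h \<in> polys V d" "d < b" "set gs \<subseteq> polys V (2 * b)" "b * length gs + d \<le> D" and
    q: "q = h' * prod_list gs'" "h' \<in> polys V d'" "d' < b" "set gs' \<subseteq> polys V (2 * b)" "b * length gs' + d' \<le> E"
    unfolding chunked_def by blast
  have hh: "h * h' \<in> polys V (d + d')"
    using p q by (intro polys_mult)
  show ?thesis
  proof (cases "d + d' < b")
    case True
    then show ?thesis
      unfolding chunked_def using p q hh
      by (intro exI[of _ "h * h'"] exI[of _ "d + d'"] exI[of _ "gs @ gs'"]) (simp add: algebra_simps)
  next
    case False
    then show ?thesis
      unfolding chunked_def using p q hh polys_mono[of "d + d'" "2 * b" "h * h'" V]
      by (intro exI[of _ 1] exI[of _ 0] exI[of _ "(h * h') # gs @ gs'"]) (simp add: algebra_simps)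
  qed
qed

lemma chunked_power: "0 < b \<Longrightarrow> chunked V b D p \<Longrightarrow> chunked V b (k * D) (p ^ k)"
  by (induction k) (auto intro: chunked_one chunked_mult)

lemma chunked_prod:
  assumes "0 < b" "\<And>a. a \<in> A \<Longrightarrow> chunked V b (d a) (f a)"
  shows "chunked V b (sum d A) (prod f A)"
  using assms by (induction A rule: infinite_finite_induct) (auto intro: chunked_one chunked_mult)

text \<open>A monomial of any degree splits into pieces of degree at most 1, which can be regrouped.
  This is what expanding a factor of high degree into monomials achieves.\<close>

lemma chunked_subst_monomial:
  assumes "\<And>v. \<sigma> v \<in> polys V 1" "0 < b"
  shows "chunked V b (monomial_degree m) (subst_monomial \<sigma> m)"
  unfolding subst_monomial_def monomial_degree_def
proof (rule chunked_prod[OF assms(2)])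
  fix v
  have "chunked V b (lookup m v * 1) (\<sigma> v ^ lookup m v)"
    using assms by (intro chunked_power chunked_small) auto
  then show "chunked V b (lookup m v) (\<sigma> v ^ lookup m v)"
    by simp
qed

text \<open>\<open>s ^ L\<close> counts the choices of one monomial from each of \<open>L\<close>
  expanded factors. \<open>M\<close> collects the factors on the light scale, which are kept whole
  and will be absorbed by the shift.\<close>

definition expandable ::
    "'v set \<Rightarrow> nat \<Rightarrow> nat \<Rightarrow> nat \<Rightarrow> nat \<Rightarrow> nat \<Rightarrow> ('v, 'a::field) mpoly \<Rightarrow> bool"
  where "expandable V b s L e D p \<longleftrightarrow>
    (\<exists>ts. p = (\<Sum>(M, c)\<leftarrow>ts. M * c) \<and> length ts \<le> s ^ L \<and>
       (\<forall>(M, c)\<in>set ts. M \<in> polys V e \<and> chunked V b D c))"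

lemma expandable_mono: "D \<le> E \<Longrightarrow> expandable V b s L e D p \<Longrightarrow> expandable V b s L e E p"
  unfolding expandable_def using chunked_mono[of D E V b] by fastforce

lemma sum_list_mult_product:
  fixes f g :: "_ \<Rightarrow> 'a::comm_semiring_0"
  shows "(\<Sum>x\<leftarrow>xs. f x) * (\<Sum>y\<leftarrow>ys. g y) = (\<Sum>(x, y)\<leftarrow>List.product xs ys. f x * g y)"
  by (induction xs) (simp_all add: distrib_right sum_list_const_mult comp_def)

lemma expandable_mult:
  assumes "expandable V b s L e D p" "expandable V b s L' e' D' q"
  shows "expandable V b s (L + L') (e + e') (D + D') (p * q)"
proof -
  from assms obtain ts ts' where
    p: "p = (\<Sum>(M, c)\<leftarrow>ts. M * c)" "length ts \<le> s ^ L" "\<forall>(M, c)\<in>set ts. M \<in> polys V e \<and> chunked V b D c" and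
    q: "q = (\<Sum>(M, c)\<leftarrow>ts'. M * c)" "length ts' \<le> s ^ L'" "\<forall>(M, c)\<in>set ts'. M \<in> polys V e' \<and> chunked V b D' c"
    unfolding expandable_def by blast
  let ?ts = "map (\<lambda>((M, c), (M', c')). (M * M', c * c')) (List.product ts ts')"
  show ?thesis
    unfolding expandable_def
  proof (intro exI[of _ ?ts] conjI)
    show "p * q = (\<Sum>(M, c)\<leftarrow>?ts. M * c)"
      unfolding p q sum_list_mult_product
      by (simp add: comp_def split_def mult_ac)
    show "length ?ts \<le> s ^ (L + L')"
      using p q by (simp add: power_add mult_mono)
    show "\<forall>(M, c)\<in>set ?ts. M \<in> polys V (e + e') \<and> chunked V b (D + D') c"
      using p(3) q(3) by (fastforce intro: polys_mult chunked_mult)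
  qed
qed

lemma expandable_term:
  assumes "M \<in> polys V e" "chunked V b D c"
  shows "expandable V b s 0 e D (M * c)"
  unfolding expandable_def using assms by (intro exI[of _ "[(M, c)]"]) auto

lemma expandable_subst_large:
  assumes \<sigma>: "\<And>v. \<sigma> v \<in> polys V 1" and b: "0 < b" and q: "card (keys q) \<le> s"
  shows "expandable V b s 1 0 (total_degree q) (subst \<sigma> q)"
proof -
  obtain ms where ms: "set ms = keys q" "distinct ms"
    using finite_distinct_list[OF finite_keys[of q]] by blast
  let ?ts = "map (\<lambda>m. (Const (lookup q m), subst_monomial \<sigma> m)) ms"
  show ?thesis
    unfolding expandable_def
  proof (intro exI[of _ ?ts] conjI)
    show "subst \<sigma> q = (\<Sum>(M, c)\<leftarrow>?ts. M * c)"
      unfolding subst_def subst_monomial_def[symmetric] ms(1)[symmetric]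
      using ms(2) by (simp add: comp_def sum_list_distinct_conv_sum_set)
    show "length ?ts \<le> s ^ 1"
      using q ms distinct_card[of ms] by simp
    have "chunked V b (total_degree q) (subst_monomial \<sigma> m)" if "m \<in> keys q" for m
      using that by (intro chunked_mono[OF _ chunked_subst_monomial[of \<sigma> V b m]] \<sigma> b)
        (auto simp: total_degree_def)
    then show "\<forall>(M, c)\<in>set ?ts. M \<in> polys V 0 \<and> chunked V b (total_degree q) c"
      using ms by auto
  qed
qed

text \<open>Factors are sorted by their degree before the substitution, since this is the degree
  that the star condition controls; replacing variables by polynomials of degree at most 1 cannot
  raise it.\<close>

lemma expandable_subst_prod_list:
  fixes \<sigma> :: "'v \<Rightarrow> ('w, 'a::field) mpoly"
  assumes \<sigma>: "\<And>v. \<sigma> v \<in> polys V 1" and b: "0 < b" "b \<le> b'"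
    and "\<And>q. q \<in> set qs \<Longrightarrow> card (keys q) \<le> s"
  defines "degs \<equiv> image_mset total_degree (mset qs)"
  shows "expandable V b s (size (filter_mset (\<lambda>d. b' < d) degs))
    (sum_mset (filter_mset (\<lambda>d. b < d \<and> d \<le> b') degs)) (sum_mset degs) (subst \<sigma> (prod_list qs))"
  using assms(4) unfolding degs_def
proof (induction qs)
  case Nil
  show ?case
  proof -
    have "expandable V b s 0 0 0 (1 * 1 :: ('w, 'a) mpoly)"
      by (intro expandable_term polys_one chunked_one b)
    then show ?thesis
      by simp
  qed
next
  case (Cons q qs)
  define D where "D = image_mset total_degree (mset qs)"
  have IH: "expandable V b s (size (filter_mset (\<lambda>d. b' < d) D))
    (sum_mset (filter_mset (\<lambda>d. b < d \<and> d \<le> b') D)) (sum_mset D) (subst \<sigma> (prod_list qs))"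
    unfolding D_def using Cons by simp
  have q: "subst \<sigma> q \<in> polys V (total_degree q)"
    using \<sigma> by (rule subst_in_polys)
  let ?d = "total_degree q"
  consider "?d \<le> b" | "b < ?d" "?d \<le> b'" | "b' < ?d"
    by linarith
  then show ?case
  proof cases
    case 1
    have "expandable V b s 0 0 ?d (1 * subst \<sigma> q)"
      using q 1 b by (intro expandable_term chunked_small) auto
    from expandable_mult[OF this IH] show ?thesis
      using 1 b by (simp add: subst_mult D_def)
  next
    case 2
    have "expandable V b s 0 ?d 0 (subst \<sigma> q * 1)"
      using q b by (intro expandable_term chunked_one) auto
    \<comment> \<open>A factor on the middle scale uses nothing of the chunk budget; the budget is
      raised to \<open>?d\<close> only to let all budgets add up to
      \<open>sum_mset degs\<close>.\<close>
    then have "expandable V b s 0 ?d ?d (subst \<sigma> q * 1)"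
      by (rule expandable_mono[rotated]) simp
    from expandable_mult[OF this IH] show ?thesis
      using 2 b by (simp add: subst_mult D_def)
  next
    case 3
    have "expandable V b s 1 0 ?d (subst \<sigma> q)"
      using Cons.prems \<sigma> b by (intro expandable_subst_large) auto
    from expandable_mult[OF this IH] show ?thesis
      using 3 b by (simp add: subst_mult D_def)
  qed
qed

lemma mv_span_mono: "A \<subseteq> B \<Longrightarrow> p \<in> mv.span A \<Longrightarrow> p \<in> mv.span B"
  using mv.span_mono by blast

lemma shifted_products_mono: "\<G> \<subseteq> \<H> \<Longrightarrow> shifted_products V \<G> m h \<subseteq> shifted_products V \<H> m h"
  unfolding shifted_products_def by (intro image_mono) auto

text \<open>Each of the at most \<open>s ^ L\<close> terms supplies one sequence of factors, with
  the light part as its multiplier.\<close>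

lemma expandable_imp_span:
  fixes p :: "('v, 'a::field) mpoly"
  assumes p: "expandable V b s L e D p" and b: "0 < b"
  shows "\<exists>\<G>. finite \<G> \<and> card \<G> \<le> s ^ L \<and> (\<forall>G\<in>\<G>. \<forall>j. G j \<in> polys V (2 * b)) \<and>
    p \<in> mv.span (shifted_products V \<G> (D div b + 1) e)"
proof -
  from p obtain ts where
    ts: "p = (\<Sum>(M, c)\<leftarrow>ts. M * c)" "length ts \<le> s ^ L" "\<forall>(M, c)\<in>set ts. M \<in> polys V e \<and> chunked V b D c"
    unfolding expandable_def by blast
  have "\<exists>G. (\<forall>j. G j \<in> polys V (2 * b)) \<and> M * c \<in> mv.span (shifted_products V {G} (D div b + 1) e)"
    if Mc: "(M, c) \<in> set ts" for M c
  proof -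
    have "chunked V b D c"
      using ts(3) Mc by blast
    then obtain h d gs where c: "c = h * prod_list gs" "h \<in> polys V d" "d < b" "set gs \<subseteq> polys V (2 * b)"
      "b * length gs + d \<le> D"
      unfolding chunked_def by blast
    \<comment> \<open>Padding with 1 gives all terms the same index range; position 0 holds the
      leftover factor, which explains the \<open>+ 1\<close> in \<open>D div b + 1\<close>.\<close>
    define G where "G j = (if j \<le> length gs then (h # gs) ! j else 1)" for j
    have "(h # gs) ! j \<in> polys V (2 * b)" if "j \<le> length gs" for j
    proof -
      have "(h # gs) ! j \<in> set (h # gs)"
        using that by (intro nth_mem) simp
      then show ?thesis
        using c polys_mono[of d "2 * b" h V] by auto
    qed
    then have G: "\<forall>j. G j \<in> polys V (2 * b)"
      by (simp add: G_def)
    have "c = prod_list (h # gs)"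
      by (simp add: c)
    also have "\<dots> = prod G {..<Suc (length gs)}"
      by (subst prod.list_conv_set_nth) (simp add: G_def atLeast0LessThan)
    finally have c_eq: "c = prod G {..<Suc (length gs)}" .
    have "length gs \<le> D div b"
      using c(5) b by (simp add: less_eq_div_iff_mult_less_eq mult.commute)
    then have "M * c \<in> mv.span (shifted_products V {G} (D div b + 1) e)"
      unfolding c_eq using ts(3) Mc by (intro span_shifted_products_memI) auto
    with G show ?thesis
      by blast
  qed
  then have "\<forall>x\<in>set ts. \<exists>G. (\<forall>j. G j \<in> polys V (2 * b)) \<and>
      fst x * snd x \<in> mv.span (shifted_products V {G} (D div b + 1) e)"
    by (metis prod.collapse)
  from bchoice[OF this] obtain G where G': "\<forall>x\<in>set ts. (\<forall>j. G x j \<in> polys V (2 * b)) \<and>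
      fst x * snd x \<in> mv.span (shifted_products V {G x} (D div b + 1) e)"
    by (elim exE)
  have G: "(\<forall>j. G (M, c) j \<in> polys V (2 * b)) \<and>
      M * c \<in> mv.span (shifted_products V {G (M, c)} (D div b + 1) e)" if "(M, c) \<in> set ts" for M c
    using bspec[OF G' that] by simp
  let ?\<G> = "G ` set ts"
  have "p \<in> mv.span (shifted_products V ?\<G> (D div b + 1) e)"
  proof -
    have "M * c \<in> mv.span (shifted_products V ?\<G> (D div b + 1) e)" if "(M, c) \<in> set ts" for M c
    proof (rule mv_span_mono[OF shifted_products_mono])
      show "{G (M, c)} \<subseteq> ?\<G>"
        using that by blast
    qed (rule G[OF that, THEN conjunct2])
    then have "(\<Sum>(M, c)\<leftarrow>us. M * c) \<in> mv.span (shifted_products V ?\<G> (D div b + 1) e)"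
      if "set us \<subseteq> set ts" for us
      using that by (induction us) (auto intro!: mv.span_add mv.span_zero)
    then show ?thesis
      unfolding ts(1) by blast
  qed
  moreover have "card ?\<G> \<le> s ^ L"
    using card_image_le[of "set ts" G] card_length[of ts] ts(2) by simp
  ultimately show ?thesis
    using G' by (intro exI[of _ ?\<G>]) simp
qed

section \<open>Depth 4 circuits\<close>

lemma gate_polys_Nil [simp]: "gate_polys [] = []"
  by (simp add: gate_polys_def)

lemma gate_polys_snoc: "gate_polys (C @ [g]) = gate_polys C @ [gate_poly (gate_polys C) g]"
  by (simp add: gate_polys_def)

lemma length_gate_polys [simp]: "length (gate_polys C) = length C"
  by (induction C rule: rev_induct) (simp_all add: gate_polys_snoc)

lemma gate_poly_cong:
  assumes "\<And>k. k \<in> set (gate_children g) \<Longrightarrow> ps ! k = qs ! k"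
  shows "gate_poly ps g = gate_poly qs g"
  using assms by (cases g) (auto intro!: arg_cong[of _ _ sum_list] arg_cong[of _ _ prod_list])

text \<open>Evaluation sees only the prefix before a gate; as children come earlier, the prefix can
  be replaced by the complete list of values.\<close>

lemma gate_polys_nth:
  assumes "\<forall>i<length C. \<forall>k\<in>set (gate_children (C ! i)). k < i" "i < length C"
  shows "gate_polys C ! i = gate_poly (gate_polys C) (C ! i)"
  using assms
proof (induction C rule: rev_induct)
  case (snoc g C)
  have wf: "\<forall>i<length C. \<forall>k\<in>set (gate_children (C ! i)). k < i"
  proof (intro allI impI ballI)
    fix i k assume "i < length C" "k \<in> set (gate_children (C ! i))"
    then show "k < i"
      using snoc.prems(1)[rule_format, of i k] by (simp add: nth_append)
  qed
  show ?case
  proof (cases "i < length C")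
    case True
    have "gate_polys (C @ [g]) ! i = gate_poly (gate_polys C) (C ! i)"
      using True snoc.IH[OF wf True] by (simp add: gate_polys_snoc nth_append)
    also have "\<dots> = gate_poly (gate_polys (C @ [g])) (C ! i)"
    proof (rule gate_poly_cong)
      fix k assume "k \<in> set (gate_children (C ! i))"
      then have "k < length C"
        using wf True by force
      then show "gate_polys C ! k = gate_polys (C @ [g]) ! k"
        by (simp add: gate_polys_snoc nth_append)
    qed
    finally show ?thesis
      using True by (simp add: nth_append)
  next
    case False
    then have i: "i = length C"
      using snoc.prems by simp
    have "gate_poly (gate_polys C) g = gate_poly (gate_polys (C @ [g])) g"
    proof (rule gate_poly_cong)
      fix k assume "k \<in> set (gate_children g)"
      then have "k < length C"
        using snoc.prems(1)[rule_format, of "length C" k] by simp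
      then show "gate_polys C ! k = gate_polys (C @ [g]) ! k"
        by (simp add: gate_polys_snoc nth_append)
    qed
    then show ?thesis
      by (simp add: i gate_polys_snoc nth_append)
  qed
qed simp

lemma keys_sum_list: "keys (sum_list ps) \<subseteq> (\<Union>p\<in>set ps. keys p)"
proof (induction ps)
  case (Cons p ps)
  then show ?case
    using Poly_Mapping.keys_add[of p "sum_list ps"] by auto
qed simp

lemma homogeneous_degree:
  assumes "homogeneous p" "m \<in> keys p"
  shows "monomial_degree m = total_degree p"
proof -
  from assms obtain d where d: "\<forall>m\<in>keys p. monomial_degree m = d"
    by (auto simp: homogeneous_def)
  then have "monomial_degree ` keys p = {d}"
    using assms(2) by auto
  then show ?thesis
    using d assms by (simp add: total_degree_def)
qed

lemma homogeneous_prod_list_degree: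
  assumes "\<And>q. q \<in> set qs \<Longrightarrow> homogeneous q" "m \<in> keys (prod_list qs)"
  shows "monomial_degree m = sum_mset (image_mset total_degree (mset qs))"
  using assms
proof (induction qs arbitrary: m)
  case (Cons q qs)
  obtain a b where ab: "m = a + b" "a \<in> keys q" "b \<in> keys (prod_list qs)"
    using Cons.prems(2) Poly_Mapping.keys_mult[of q "prod_list qs"] by auto
  then show ?case
    using Cons.IH[of b] Cons.prems(1) homogeneous_degree[of q a]
    by (simp add: monomial_degree_add)
qed (simp split: if_splits)

text \<open>Extracts from the circuit what the lower bound works with. \<open>gs\<close> may list a
  gate repeatedly; only distinct gates are counted, because repetition does not enlarge a
  span.\<close>

lemma homogeneous_SPSP_starE:
  fixes C :: "('v, 'a::field) circuit"
  assumes C: "homogeneous_SPSP_star C" "computes C p"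
    and p: "p \<noteq> 0" "\<And>m. m \<in> keys p \<Longrightarrow> monomial_degree m = d"
  obtains D and gs :: "nat list" and qs :: "nat \<Rightarrow> ('v, 'a) mpoly list"
  where "p = (\<Sum>i\<leftarrow>gs. prod_list (qs i))" "card (set gs) \<le> circuit_size C" "sum_mset D = d"
    "\<And>i. i \<in> set gs \<Longrightarrow> image_mset total_degree (mset (qs i)) = D"
    "\<And>i q. i \<in> set gs \<Longrightarrow> q \<in> set (qs i) \<Longrightarrow> card (keys q) \<le> circuit_size C"
proof -
  define P where "P = gate_polys C"
  have wf: "C \<noteq> []" "\<forall>i<length C. \<forall>k\<in>set (gate_children (C ! i)). k < i"
    and last: "last P = p"
    using C by (auto simp: computes_def wf_circuit_def P_def)
  obtain gs where gs: "last C = SumGate gs" "\<forall>i\<in>set gs. is_PSP_gate C i"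
    using C by (auto simp: homogeneous_SPSP_star_def is_SPSP_circuit_def)
  obtain D where D: "\<And>i. i \<in> set gs \<Longrightarrow>
      image_mset (\<lambda>j. total_degree (P ! j)) (mset (gate_children (C ! i))) = D"
    using C gs(1) by (auto simp: homogeneous_SPSP_star_def P_def)
  have hom: "homogeneous q" if "q \<in> set P" for q
    using C that by (auto simp: homogeneous_SPSP_star_def homogeneous_circuit_def P_def)
  have nth: "P ! i = gate_poly P (C ! i)" if "i < length C" for i
    unfolding P_def using gate_polys_nth[OF wf(2) that] .
  define N where "N = length C - 1"
  have N: "N < length C" "C ! N = SumGate gs" "P ! N = p"
  proof -
    have "P \<noteq> []"
      using wf(1) length_gate_polys[of C] by (metis P_def length_0_conv)
    then show "N < length C" "C ! N = SumGate gs" "P ! N = p"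
      using wf(1) gs(1) last by (simp_all add: N_def last_conv_nth P_def)
  qed
  have gs_lt: "i < length C" if "i \<in> set gs" for i
    using wf(2)[rule_format, of N i] N that by auto
  define qs where "qs i = map ((!) P) (gate_children (C ! i))" for i
  have child_lt: "j < length C" if "i < length C" "j \<in> set (gate_children (C ! i))" for i j
    using wf(2) that by force
  have Pi: "P ! i = prod_list (qs i)" if i: "i \<in> set gs" for i
  proof -
    obtain js where "C ! i = ProdGate js"
      using gs(2)[rule_format, OF i] unfolding is_PSP_gate_def by blast
    then show ?thesis
      using nth[OF gs_lt[OF i]] by (simp add: qs_def)
  qed
  have p_eq: "p = (\<Sum>i\<leftarrow>gs. prod_list (qs i))"
    using nth[OF N(1)] N Pi by (auto intro!: arg_cong[of _ _ sum_list])
  have q_hom: "homogeneous q" if "i \<in> set gs" "q \<in> set (qs i)" for i q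
    using that child_lt[OF gs_lt] by (intro hom) (auto simp: qs_def P_def)
  have q_card: "card (keys q) \<le> circuit_size C" if i: "i \<in> set gs" and q: "q \<in> set (qs i)" for i q
  proof -
    obtain j where j: "j \<in> set (gate_children (C ! i))" "q = P ! j"
      using q by (auto simp: qs_def)
    have "j < length C"
      using child_lt[OF gs_lt[OF i]] j by blast
    have "is_SP_gate C j"
      using gs(2)[rule_format, OF i] j(1) unfolding is_PSP_gate_def by auto
    then obtain ks where ks: "C ! j = SumGate ks" "\<And>k. k \<in> set ks \<Longrightarrow> is_monomial_gate C k"
      unfolding is_SP_gate_def by blast
    have ks_lt: "k < length C" if "k \<in> set ks" for k
      using child_lt[OF \<open>j < length C\<close>, of k] ks(1) that by simp
    \<comment> \<open>A product of inputs is a single term, so a sum of such gates has at most one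
      monomial per distinct child.\<close>
    have mono: "card (keys (P ! k)) \<le> 1" if k: "k \<in> set ks" for k
    proof -
      obtain ls where ls: "C ! k = ProdGate ls" "\<And>l. l \<in> set ls \<Longrightarrow> is_input (C ! l)"
        using ks(2)[OF k] unfolding is_monomial_gate_def by blast
      have "\<exists>m c. P ! l = single m c" if "l \<in> set ls" for l
      proof -
        have "l < length C"
          using child_lt[OF ks_lt[OF k], of l] ls(1) that by simp
        then show ?thesis
          using nth[of l] ls(2)[OF that] by (cases "C ! l") (auto simp: Var_def Const_def)
      qed
      then have "\<exists>m c. (\<Prod>l\<leftarrow>ls. P ! l) = single m c"
      proof (induction ls)
        case Nil
        show ?case
          by (metis list.simps(8) prod_list.Nil single_one)
      next
        case (Cons l ls)
        then obtain m c m' c' where "P ! l = single m c" "(\<Prod>l\<leftarrow>ls. P ! l) = single m' c'"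
          by (metis list.set_intros(1) list.set_intros(2))
        then show ?case
          by (auto simp: mult_single)
      qed
      then obtain m c where "P ! k = single m c"
        using nth[OF ks_lt[OF k]] ls(1) by auto
      then show ?thesis
        by simp
    qed
    have "keys q \<subseteq> (\<Union>k\<in>set ks. keys (P ! k))"
      using keys_sum_list[of "map ((!) P) ks"] nth[OF \<open>j < length C\<close>] j(2) ks(1) by simp
    then have "card (keys q) \<le> card (\<Union>k\<in>set ks. keys (P ! k))"
      by (intro card_mono) auto
    also have "\<dots> \<le> (\<Sum>k\<in>set ks. card (keys (P ! k)))"
      by (intro card_UN_le) simp
    also have "\<dots> \<le> card (set ks)"
      using mono by (subst card_eq_sum) (rule sum_mono, simp)
    also have "\<dots> \<le> card {..<length C}"
      using ks_lt by (intro card_mono) auto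
    finally show ?thesis
      by (simp add: circuit_size_def)
  qed
  have degs: "image_mset total_degree (mset (qs i)) = D" if "i \<in> set gs" for i
    using D[OF that] by (simp add: qs_def image_mset.compositionality comp_def)
  have "card (set gs) \<le> card {..<length C}"
    using gs_lt by (intro card_mono) auto
  then have gs_card: "card (set gs) \<le> circuit_size C"
    by (simp add: circuit_size_def)
  \<comment> \<open>Some gate contributes a monomial of \<open>p\<close>, and there the degrees of
    the homogeneous factors add up to \<open>d\<close>. The star condition carries this over to all
    gates, even those that compute 0.\<close>
  have "sum_mset D = d"
  proof -
    obtain m where m: "m \<in> keys p"
      using p(1) by (metis keys_eq_empty equals0I)
    then obtain i where i: "i \<in> set gs" "m \<in> keys (prod_list (qs i))"
      using keys_sum_list[of "map (\<lambda>i. prod_list (qs i)) gs"] p_eq by auto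
    show ?thesis
      using homogeneous_prod_list_degree[OF q_hom[OF i(1)] i(2)] degs[OF i(1)] p(2)[OF m] by simp
  qed
  then show thesis
    using that p_eq gs_card degs q_card by blast
qed


section \<open>Polynomials of low degree over a finite field\<close>

lemma field_on_field: "field_on n K \<Longrightarrow> field K"
  and field_on_carrier: "field_on n K \<Longrightarrow> carrier K = {1..n}"
  by (simp_all add: field_on_def)

text \<open>\<open>degree f\<close> is \<open>length f - 1\<close>, so the degree bound and the
  separate case \<open>[]\<close> merge into one bound on the length.\<close>

lemma low_degree_polys_iff:
  "f \<in> low_degree_polys K d \<longleftrightarrow> polynomial\<^bsub>K\<^esub> (carrier K) f \<and> length f \<le> d"
  by (cases f) (auto simp: low_degree_polys_def polynomial_def)

text \<open>Coefficient lists of fixed length may have leading zeros, which \<open>normalize\<close>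
  strips; the fixed length allows them to be restored. This reduces counting polynomials to counting
  lists.\<close>

lemma bij_betw_normalize_low_degree:
  assumes "field K"
  shows "bij_betw (ring.normalize K) {xs. set xs \<subseteq> carrier K \<and> length xs = d} (low_degree_polys K d)"
proof -
  interpret field K by fact
  show ?thesis
    unfolding bij_betw_def
  proof (intro conjI inj_onI equalityI subsetI)
    fix xs ys
    assume "xs \<in> {xs. set xs \<subseteq> carrier K \<and> length xs = d}" "ys \<in> {xs. set xs \<subseteq> carrier K \<and> length xs = d}"
      and eq: "normalize xs = normalize ys"
    then have len: "length xs = d" "length ys = d"
      by auto
    show "xs = ys"
      using normalize_def'[of xs] normalize_def'[of ys] len eq by metis
  next
    fix f assume "f \<in> normalize ` {xs. set xs \<subseteq> carrier K \<and> length xs = d}"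
    then show "f \<in> low_degree_polys K d"
      by (auto simp: low_degree_polys_iff intro: normalize_gives_polynomial normalize_length_le)
  next
    fix f assume f: "f \<in> low_degree_polys K d"
    let ?xs = "replicate (d - length f) \<zero>\<^bsub>K\<^esub> @ f"
    have "normalize ?xs = f"
      using f normalize_polynomial[of "carrier K" f] by (simp add: normalize_replicate_zero low_degree_polys_iff)
    moreover have "?xs \<in> {xs. set xs \<subseteq> carrier K \<and> length xs = d}"
      using f polynomial_incl by (auto simp: low_degree_polys_iff)
    ultimately show "f \<in> normalize ` {xs. set xs \<subseteq> carrier K \<and> length xs = d}"
      by (metis imageI)
  qed
qed

lemma low_degree_polys_finite_card:
  assumes "field_on n K"
  shows "finite (low_degree_polys K d)" "card (low_degree_polys K d) = n ^ d"
proof -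
  have *: "finite (carrier K)" "card (carrier K) = n"
    using field_on_carrier[OF assms] by auto
  note bij = bij_betw_normalize_low_degree[OF field_on_field[OF assms], of d]
  show "finite (low_degree_polys K d)"
    using bij_betw_finite[OF bij] finite_lists_length_eq[OF *(1), of d] by simp
  show "card (low_degree_polys K d) = n ^ d"
    using bij_betw_same_card[OF bij] card_lists_length_eq[OF *(1), of d] * by simp
qed

text \<open>The points of agreement are roots of the nonzero difference, whose degree is below
  \<open>d\<close>.\<close>

lemma low_degree_polys_agree:
  assumes K: "field K" and f: "f \<in> low_degree_polys K d" and g: "g \<in> low_degree_polys K d" and "f \<noteq> g"
  shows "card {x \<in> carrier K. ring.eval K f x = ring.eval K g x} < d"
proof -
  interpret field K by fact
  interpret UP: domain "poly_ring K"
    using univ_poly_is_domain[OF carrier_is_subring] .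
  have fg: "f \<in> carrier (poly_ring K)" "g \<in> carrier (poly_ring K)"
    using f g by (auto simp: low_degree_polys_iff univ_poly_carrier)
  define p where "p = f \<ominus>\<^bsub>poly_ring K\<^esub> g"
  have p: "p \<in> carrier (poly_ring K)" "p \<noteq> []"
    using fg \<open>f \<noteq> g\<close> UP.r_right_minus_eq[of f g] unfolding p_def
    by (auto simp: univ_poly_zero)
  have sub: "carrier K \<subseteq> carrier K" "set f \<subseteq> carrier K" "set g \<subseteq> carrier K"
    using f g polynomial_incl by (auto simp: low_degree_polys_iff)
  have len_neg: "length (\<ominus>\<^bsub>poly_ring K\<^esub> g) = length g"
    using univ_poly_a_inv_length[OF carrier_is_subring fg(2)] .
  have "length p \<le> max (length f) (length (\<ominus>\<^bsub>poly_ring K\<^esub> g))"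
    unfolding p_def a_minus_def univ_poly_add by (rule poly_add_length_le)
  then have len: "length p \<le> d"
    using f g len_neg by (auto simp: low_degree_polys_iff)
  have "{x \<in> carrier K. eval f x = eval g x} \<subseteq> set_mset (roots p)"
  proof clarify
    fix x assume x: "x \<in> carrier K" and eq: "eval f x = eval g x"
    interpret ev: ring_hom_ring "poly_ring K" K "\<lambda>q. eval q x"
      using eval_ring_hom[OF carrier_is_subring x] .
    have "eval p x = eval f x \<ominus>\<^bsub>K\<^esub> eval g x"
      unfolding p_def a_minus_def using fg by simp
    also have "\<dots> = \<zero>\<^bsub>K\<^esub>"
      using eq eval_in_carrier[OF sub(3) x] by simp
    finally show "x \<in># roots p"
      using x p by (simp add: roots_mem_iff_is_root is_root_def)
  qed
  then have "card {x \<in> carrier K. eval f x = eval g x} \<le> card (set_mset (roots p))"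
    by (intro card_mono) auto
  also have "\<dots> \<le> size (roots p)"
    by (subst size_multiset_overloaded_eq, subst card_eq_sum) (rule sum_mono, simp)
  also have "\<dots> \<le> degree p"
    using size_roots_le_degree[OF p(1)] .
  also have "\<dots> < d"
    using len p(2) by (cases p) auto
  finally show ?thesis .
qed

lemma low_degree_eval_carrier:
  assumes K: "field K" and "f \<in> low_degree_polys K d" "x \<in> carrier K"
  shows "ring.eval K f x \<in> carrier K"
proof -
  interpret field K by fact
  show ?thesis
    using assms polynomial_incl by (intro eval_in_carrier) (auto simp: low_degree_polys_iff)
qed

section \<open>The monomials of the Nisan--Wigderson polynomials\<close>

text \<open>The exponents are 0 or 1, so no derivative brings in a factor that could vanish in
  positive characteristic.\<close>

definition graph_monomial :: "nat set \<Rightarrow> (nat \<Rightarrow> nat) \<Rightarrow> nw_var monomial"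
  where "graph_monomial I \<phi> = (\<Sum>i\<in>I. single (XVar i (\<phi> i)) 1)"

lemma lookup_graph_monomial:
  assumes "finite I"
  shows "lookup (graph_monomial I \<phi>) (XVar i a) = of_bool (i \<in> I \<and> \<phi> i = a)"
    and "lookup (graph_monomial I \<phi>) (YVar i) = 0"
proof -
  have "lookup (graph_monomial I \<phi>) (XVar i a) = (\<Sum>j\<in>I. if j = i then of_bool (\<phi> i = a) else 0)"
    unfolding graph_monomial_def lookup_sum
    by (intro sum.cong) (auto simp: lookup_single when_def)
  then show "lookup (graph_monomial I \<phi>) (XVar i a) = of_bool (i \<in> I \<and> \<phi> i = a)"
    using assms by simp
  show "lookup (graph_monomial I \<phi>) (YVar i) = 0"
    unfolding graph_monomial_def lookup_sum by (simp add: lookup_single when_def)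
qed

lemma monomial_degree_graph [simp]: "monomial_degree (graph_monomial I \<phi>) = card I"
  by (simp add: graph_monomial_def monomial_degree_sum)

lemma nw_monomial_eqI:
  assumes "\<And>i a. lookup m (XVar i a) = lookup m' (XVar i a)" "\<And>i. lookup m (YVar i) = lookup m' (YVar i)"
  shows "m = (m' :: nw_var monomial)"
proof (rule poly_mapping_eqI)
  fix v show "lookup m v = lookup m' v"
    using assms by (cases v) auto
qed

text \<open>The degree of the truncated difference is thus the Hamming distance of the two functions
  on \<open>I\<close>, the distance that \<open>card_shifts_inter_le\<close> asks for.\<close>

lemma graph_monomial_diff:
  assumes "finite I"
  shows "graph_monomial I \<phi> - graph_monomial I \<psi> = graph_monomial {i \<in> I. \<phi> i \<noteq> \<psi> i} \<phi>"
  using assms by (intro nw_monomial_eqI) (auto simp: lookup_minus lookup_graph_monomial)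

lemma keys_graph_monomial:
  assumes "finite I"
  shows "keys (graph_monomial I \<phi>) = (\<lambda>i. XVar i (\<phi> i)) ` I"
proof (intro equalityI subsetI)
  fix v assume "v \<in> keys (graph_monomial I \<phi>)"
  then show "v \<in> (\<lambda>i. XVar i (\<phi> i)) ` I"
    using assms by (cases v) (auto simp: in_keys_iff lookup_graph_monomial)
qed (use assms in \<open>auto simp: in_keys_iff lookup_graph_monomial\<close>)

lemma pderiv_mp_graph_monomial:
  assumes "finite I" "j \<in> I"
  shows "pderiv_mp (XVar j a) (single (graph_monomial I \<phi>) 1) =
    (if \<phi> j = a then single (graph_monomial (I - {j}) \<phi>) 1 else (0 :: (nw_var, 'a::field) mpoly))"
proof -
  have "graph_monomial I \<phi> - single (XVar j a) 1 = graph_monomial (I - {j}) \<phi>" if "\<phi> j = a"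
    using assms that
    by (intro nw_monomial_eqI) (auto simp: lookup_minus lookup_graph_monomial lookup_single when_def)
  then show ?thesis
    using assms by (simp add: pderiv_mp_single lookup_graph_monomial)
qed

lemma pderivs_mp_graph_monomial:
  assumes "finite I" "set js \<subseteq> I" "distinct js"
  shows "pderivs_mp (map (\<lambda>j. XVar j (\<psi> j)) js) (single (graph_monomial I \<phi>) 1) =
    (if \<forall>j\<in>set js. \<phi> j = \<psi> j then single (graph_monomial (I - set js) \<phi>) 1
     else (0 :: (nw_var, 'a::field) mpoly))"
  using assms
proof (induction js)
  case (Cons j js)
  have "I - set js - {j} = I - set (j # js)"
    by auto
  then show ?case
    using Cons pderiv_mp_graph_monomial[of "I - set js" j "\<psi> j" \<phi>] by auto
qed simp

lemma NW_t_eq: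
  "NW_t K t n = (\<Sum>f\<in>low_degree_polys K (n div (2 * t)).
     single (graph_monomial {1..n} (ring.eval K f)) (1 :: 'a::field))"
  unfolding NW_t_def graph_monomial_def Var_def prod_single ..

definition x_vars :: "nat \<Rightarrow> nw_var set"
  where "x_vars n = (\<lambda>(i, j). XVar i j) ` ({1..n} \<times> {1..n})"

lemma finite_x_vars [simp]: "finite (x_vars n)"
  by (simp add: x_vars_def)

lemma card_x_vars: "card (x_vars n) = n\<^sup>2"
  unfolding x_vars_def by (subst card_image) (auto simp: inj_on_def power2_eq_square)

text \<open>Differentiating by the variables of the graph of \<open>f\<close> over
  \<open>1..k\<close> kills every other graph, because \<open>k\<close> values determine a
  polynomial of degree below \<open>k\<close>. The rest of the graph of \<open>f\<close> survives as
  the monomial \<open>\<mu> f\<close>. The upper bound on the span then meets the Bonferroni bound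
  for the \<open>n ^ k\<close> sets of multiples of these monomials.\<close>

lemma NW_t_complexity:
  fixes \<G> :: "(nat \<Rightarrow> (nw_var, 'a::field) mpoly) set"
  assumes K: "field_on n K" and k: "n div (2 * t) = k" "2 * k \<le> n"
    and \<G>: "finite \<G>" "\<forall>G\<in>\<G>. \<forall>j. G j \<in> polys (x_vars n) g"
    and p: "NW_t K t n \<in> mv.span (shifted_products (x_vars n) \<G> m h)"
  shows "n ^ k * card (mons (x_vars n) l) \<le>
    card \<G> * 2 ^ m * card (mons (x_vars n) (l + (h + k * g))) +
    n ^ k * (n ^ k * card (mons (x_vars n) (l - (n - 2 * k))))"
proof -
  define F where "F = low_degree_polys K k"
  define \<mu> where "\<mu> f = graph_monomial {Suc k..n} (ring.eval K f)" for f
  define vs where "vs f = map (\<lambda>i. XVar i (ring.eval K f i)) [1..<Suc k]" for f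
  have F: "finite F" "card F = n ^ k"
    using low_degree_polys_finite_card[OF K] by (auto simp: F_def)
  have agree: "card {i \<in> {1..n}. ring.eval K f i = ring.eval K g i} < k"
    if "f \<in> F" "g \<in> F" "f \<noteq> g" for f g
    using low_degree_polys_agree[OF field_on_field[OF K]] that field_on_carrier[OF K]
    by (simp add: F_def)
  have deriv: "pderivs_mp (vs f) (NW_t K t n) = single (\<mu> f) (1 :: 'a)" if f: "f \<in> F" for f
  proof -
    have "pderivs_mp (vs f) (single (graph_monomial {1..n} (ring.eval K f')) (1 :: 'a)) =
        (if f' = f then single (\<mu> f) 1 else 0)" if f': "f' \<in> F" for f'
    proof -
      have "\<exists>j\<in>set [1..<Suc k]. ring.eval K f' j \<noteq> ring.eval K f j" if "f' \<noteq> f"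
      proof (rule ccontr)
        assume "\<not> ?thesis"
        then have "{1..k} \<subseteq> {i \<in> {1..n}. ring.eval K f' i = ring.eval K f i}"
          using k by auto
        then have "card {1..k} \<le> card {i \<in> {1..n}. ring.eval K f' i = ring.eval K f i}"
          by (intro card_mono) auto
        with agree[OF f' f that] show False
          by simp
      qed
      moreover have "{1..n} - set [1..<Suc k] = {Suc k..n}"
        by auto
      moreover have "pderivs_mp (vs f) (single (graph_monomial {1..n} (ring.eval K f')) (1 :: 'a)) =
          (if \<forall>j\<in>set [1..<Suc k]. ring.eval K f' j = ring.eval K f j
           then single (graph_monomial ({1..n} - set [1..<Suc k]) (ring.eval K f')) 1 else 0)"
        unfolding vs_def using k by (intro pderivs_mp_graph_monomial) auto
      ultimately show ?thesis
        by (cases "f' = f") (simp_all only: \<mu>_def if_True if_False bex_simps ball_simps HOL.simp_thms, metis+)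
    qed
    then show ?thesis
      using f F(1) by (simp add: NW_t_eq k(1) pderivs_mp_sum flip: F_def)
  qed
  have upper: "card (\<Union>f\<in>F. (\<lambda>c. c + \<mu> f) ` mons (x_vars n) l) \<le>
      card \<G> * 2 ^ m * card (mons (x_vars n) (l + (h + k * g)))"
    by (rule card_shifted_derivatives_le[OF _ \<G> p, of F vs]) (simp_all add: deriv, simp add: vs_def)
  have "card F * card (mons (x_vars n) l) \<le> card (\<Union>f\<in>F. (\<lambda>c. c + \<mu> f) ` mons (x_vars n) l)
      + card F * (card F * card (mons (x_vars n) (l - (n - 2 * k))))"
  proof (rule card_UN_ge_bonferroni[OF F(1)])
    fix f g assume fg: "f \<in> F" "g \<in> F" "f \<noteq> g"
    \<comment> \<open>Of the \<open>n - k\<close> remaining points, fewer than \<open>k\<close> are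
      points of agreement.\<close>
    have "n - 2 * k \<le> card {i \<in> {Suc k..n}. ring.eval K g i \<noteq> ring.eval K f i}"
    proof -
      have "{Suc k..n} \<subseteq> {i \<in> {Suc k..n}. ring.eval K g i \<noteq> ring.eval K f i} \<union>
          {i \<in> {1..n}. ring.eval K g i = ring.eval K f i}"
        by auto
      then have "card {Suc k..n} \<le> card ({i \<in> {Suc k..n}. ring.eval K g i \<noteq> ring.eval K f i} \<union>
          {i \<in> {1..n}. ring.eval K g i = ring.eval K f i})"
        by (intro card_mono) auto
      also have "\<dots> \<le> card {i \<in> {Suc k..n}. ring.eval K g i \<noteq> ring.eval K f i} + k"
        using agree[of g f] fg by (intro order_trans[OF card_Un_le]) auto
      finally show ?thesis
        by simp
    qed
    then show "card ((\<lambda>c. c + \<mu> f) ` mons (x_vars n) l \<inter> (\<lambda>c. c + \<mu> g) ` mons (x_vars n) l)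
        \<le> card (mons (x_vars n) (l - (n - 2 * k)))"
      by (intro card_shifts_inter_le) (simp_all add: \<mu>_def graph_monomial_diff)
  qed (simp_all add: finite_mons card_image)
  from order_trans[OF this add_right_mono[OF upper]] show ?thesis
    unfolding F(2) .
qed

section \<open>Support, degree and variables of the full polynomial\<close>

lemma NW_eq:
  "NW K n = (\<Sum>(i, f)\<in>(SIGMA i:{1..n}. low_degree_polys K (n div (2 * i))).
     single (single (YVar i) 1 + graph_monomial {1..n} (ring.eval K f)) (1 :: 'a::field))"
  if "field_on n K"
  unfolding NW_def NW_t_eq Var_def
  using low_degree_polys_finite_card(1)[OF that]
  by (subst sum.Sigma[symmetric]) (auto simp: sum_distrib_left mult_single)

lemma keys_sum_monomials:
  assumes "finite A" "inj_on g A"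
  shows "keys (\<Sum>a\<in>A. single (g a) (1 :: 'a::field)) = g ` A"
proof -
  have "(\<Sum>a\<in>A. single (g a) (1 :: 'a)) = (\<Sum>m\<in>g ` A. single m 1)"
    using assms by (simp add: sum.reindex)
  moreover have "lookup (\<Sum>m\<in>g ` A. single m (1 :: 'a)) x = of_bool (x \<in> g ` A)" for x
    using assms(1) by (simp add: lookup_sum lookup_single when_def)
  ultimately show ?thesis
    by (auto simp: in_keys_iff)
qed

text \<open>\<open>YVar i\<close> reveals \<open>i\<close>, and the values at all \<open>n\<close>
  points determine \<open>f\<close>. Hence no two terms coincide, and no coefficient can cancel in
  any characteristic.\<close>

lemma inj_on_NW_monomials:
  assumes K: "field_on n K"
  shows "inj_on (\<lambda>(i, f). single (YVar i) 1 + graph_monomial {1..n} (ring.eval K f))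
    (SIGMA i:{1..n}. low_degree_polys K (n div (2 * i)))"
proof (rule inj_onI, clarify)
  fix i f j g
  assume i: "i \<in> {1..n}" "j \<in> {1..n}"
    and f: "f \<in> low_degree_polys K (n div (2 * i))" and g: "g \<in> low_degree_polys K (n div (2 * j))"
    and eq: "single (YVar i) 1 + graph_monomial {1..n} (ring.eval K f) =
      single (YVar j) 1 + graph_monomial {1..n} (ring.eval K g)"
  have "lookup (single (YVar i) 1 + graph_monomial {1..n} (ring.eval K f)) (YVar i) =
      lookup (single (YVar j) 1 + graph_monomial {1..n} (ring.eval K g)) (YVar i)"
    using eq by (rule arg_cong)
  then have "(1 :: nat) = (1 when YVar j = YVar i)"
    by (simp only: lookup_add lookup_graph_monomial(2)[OF finite_atLeastAtMost] lookup_single) simp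
  then have ij: "i = j"
    by (cases "i = j") simp_all
  then have gm: "graph_monomial {1..n} (ring.eval K f) = graph_monomial {1..n} (ring.eval K g)"
    using eq by (simp only: add_left_cancel)
  have "ring.eval K f x = ring.eval K g x" if "x \<in> carrier K" for x
  proof -
    have x: "x \<in> {1..n}"
      using that field_on_carrier[OF K] by simp
    show ?thesis
      using arg_cong[OF gm, of "\<lambda>m. lookup m (XVar x (ring.eval K f x))"]
      unfolding lookup_graph_monomial(1)[OF finite_atLeastAtMost] of_bool_eq_iff using x by metis
  qed
  then have all: "{x \<in> carrier K. ring.eval K f x = ring.eval K g x} = {1..n}"
    using field_on_carrier[OF K] by auto
  have "f = g"
  proof (rule ccontr)
    assume "f \<noteq> g"
    from low_degree_polys_agree[OF field_on_field[OF K] f g[folded ij] this]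
    have "n < n div (2 * i)"
      unfolding all by simp
    then show False
      using div_le_dividend[of n "2 * i"] by linarith
  qed
  with ij show "i = j \<and> f = g"
    by simp
qed

lemma keys_NW:
  assumes K: "field_on n K"
  shows "keys (NW K n :: (nw_var, 'a::field) mpoly) =
    (\<lambda>(i, f). single (YVar i) 1 + graph_monomial {1..n} (ring.eval K f)) `
      (SIGMA i:{1..n}. low_degree_polys K (n div (2 * i)))"
proof -
  have "finite (SIGMA i:{1..n}. low_degree_polys K (n div (2 * i)))"
    using low_degree_polys_finite_card(1)[OF K] by auto
  then show ?thesis
    unfolding NW_eq[OF K] using keys_sum_monomials[OF _ inj_on_NW_monomials[OF K]]
    by (simp add: split_def)
qed

lemma monomial_degree_NW:
  assumes "field_on n K" "m \<in> keys (NW K n :: (nw_var, 'a::field) mpoly)"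
  shows "monomial_degree m = n + 1"
  using assms by (auto simp: keys_NW monomial_degree_add)

text \<open>Constants will witness that every \<open>XVar i j\<close> occurs.
  \<open>normalize\<close> takes care of the zero of \<open>K\<close>, whose coefficient list is
  \<open>[]\<close>.\<close>

lemma const_low_degree:
  assumes K: "field K" and d: "0 < d" and c: "c \<in> carrier K"
  shows "\<exists>f\<in>low_degree_polys K d. \<forall>x\<in>carrier K. ring.eval K f x = c"
proof -
  interpret field K by fact
  show ?thesis
  proof (intro bexI[of _ "normalize [c]"] ballI)
    show "normalize [c] \<in> low_degree_polys K d"
      using c d by (auto simp: low_degree_polys_iff polynomial_def)
    show "eval (normalize [c]) x = c" if "x \<in> carrier K" for x
      using c that by (subst eval_normalize) auto
  qed
qed

lemma total_degree_NW:
  assumes K: "field_on n K" and n: "0 < n"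
  shows "NW K n \<noteq> (0 :: (nw_var, 'a::field) mpoly)"
    and "total_degree (NW K n :: (nw_var, 'a) mpoly) = n + 1"
proof -
  \<comment> \<open>The zero polynomial satisfies every degree bound, even for \<open>n = 1\<close>,
    where the bound is 0.\<close>
  have "[] \<in> low_degree_polys K (n div (2 * 1))"
    by (simp add: low_degree_polys_iff polynomial_def)
  then have ne: "keys (NW K n :: (nw_var, 'a) mpoly) \<noteq> {}"
    unfolding keys_NW[OF K] using n by force
  then show "NW K n \<noteq> (0 :: (nw_var, 'a) mpoly)"
    by auto
  have "monomial_degree ` keys (NW K n :: (nw_var, 'a) mpoly) = {n + 1}"
  proof -
    obtain m where "m \<in> keys (NW K n :: (nw_var, 'a) mpoly)"
      using ne by blast
    with monomial_degree_NW[OF K, where 'a = 'a] show ?thesis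
      by (auto simp: image_iff)
  qed
  then show "total_degree (NW K n :: (nw_var, 'a) mpoly) = n + 1"
    by (simp add: total_degree_def)
qed

text \<open>For \<open>n\<close> at least 2 the bound \<open>n div 2\<close> is positive, so the
  summand with index 1 already contains the constant polynomials and with them every
  \<open>XVar i j\<close>.\<close>

lemma vars_NW:
  assumes K: "field_on n K"
  shows "vars (NW K n :: (nw_var, 'a::field) mpoly) \<subseteq> x_vars n \<union> YVar ` {1..n}"
    and "2 \<le> n \<Longrightarrow> x_vars n \<subseteq> vars (NW K n :: (nw_var, 'a) mpoly)"
proof -
  show "vars (NW K n :: (nw_var, 'a) mpoly) \<subseteq> x_vars n \<union> YVar ` {1..n}"
  proof
    fix v assume "v \<in> vars (NW K n :: (nw_var, 'a) mpoly)"
    then obtain i f where i: "i \<in> {1..n}" and f: "f \<in> low_degree_polys K (n div (2 * i))"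
      and v: "v \<in> keys (single (YVar i) 1 + graph_monomial {1..n} (ring.eval K f))"
      by (auto simp: vars_def keys_NW[OF K])
    have "ring.eval K f x \<in> {1..n}" if "x \<in> {1..n}" for x
      using low_degree_eval_carrier[OF field_on_field[OF K] f] field_on_carrier[OF K] that by blast
    then show "v \<in> x_vars n \<union> YVar ` {1..n}"
      using v i unfolding keys_add_monomial keys_graph_monomial[OF finite_atLeastAtMost] x_vars_def
      by fastforce
  qed
  assume n: "2 \<le> n"
  show "x_vars n \<subseteq> vars (NW K n :: (nw_var, 'a) mpoly)"
  proof
    fix v assume "v \<in> x_vars n"
    then obtain i j where v: "v = XVar i j" and ij: "i \<in> {1..n}" "j \<in> {1..n}"
      by (auto simp: x_vars_def)
    have "0 < n div (2 * 1)"
      using n by (simp add: div_greater_zero_iff)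
    then obtain f where f: "f \<in> low_degree_polys K (n div (2 * 1))" "\<forall>x\<in>carrier K. ring.eval K f x = j"
      using const_low_degree[OF field_on_field[OF K], of _ j] field_on_carrier[OF K] ij by blast
    let ?m = "single (YVar 1) 1 + graph_monomial {1..n} (ring.eval K f)"
    have "(1, f) \<in> (SIGMA i:{1..n}. low_degree_polys K (n div (2 * i)))"
      using f(1) n by auto
    then have "?m \<in> keys (NW K n :: (nw_var, 'a) mpoly)"
      unfolding keys_NW[OF K] by (rule image_eqI[rotated]) simp
    moreover have "v \<in> keys ?m"
      unfolding keys_add_monomial keys_graph_monomial[OF finite_atLeastAtMost]
      using v ij f(2) field_on_carrier[OF K] by auto
    ultimately show "v \<in> vars (NW K n :: (nw_var, 'a) mpoly)"
      unfolding vars_def by blast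
  qed
qed

lemma card_vars_NW:
  assumes K: "field_on n K" and n: "2 \<le> n"
  shows "n\<^sup>2 \<le> card (vars (NW K n :: (nw_var, 'a::field) mpoly))"
    and "card (vars (NW K n :: (nw_var, 'a::field) mpoly)) \<le> n\<^sup>2 + n"
proof -
  have fin: "finite (x_vars n \<union> YVar ` {1..n})"
    by simp
  have "card (x_vars n) \<le> card (vars (NW K n :: (nw_var, 'a) mpoly))"
    using vars_NW[OF K, where 'a = 'a] n finite_subset[OF _ fin] by (intro card_mono) auto
  then show "n\<^sup>2 \<le> card (vars (NW K n :: (nw_var, 'a) mpoly))"
    by (simp add: card_x_vars)
  have "card (vars (NW K n :: (nw_var, 'a) mpoly)) \<le> card (x_vars n \<union> YVar ` {1..n})"
    using vars_NW(1)[OF K] fin by (intro card_mono)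
  also have "\<dots> \<le> card (x_vars n) + card (YVar ` {1..n})"
    by (rule card_Un_le)
  also have "\<dots> \<le> n\<^sup>2 + n"
    using card_image_le[of "{1..n}" YVar] by (simp add: card_x_vars)
  finally show "card (vars (NW K n :: (nw_var, 'a) mpoly)) \<le> n\<^sup>2 + n" .
qed

text \<open>Variables outside the grid go to 0, so that the image of every variable of the infinite
  type lies in \<open>polys (x_vars n) 1\<close>.\<close>

definition select :: "nat \<Rightarrow> nat \<Rightarrow> nw_var \<Rightarrow> (nw_var, 'a::field) mpoly"
  where "select n t v = (if v = YVar t then 1 else if v \<in> x_vars n then Var v else 0)"

lemma select_in_polys: "select n t v \<in> polys (x_vars n) 1"
  using polys_Var[of v "x_vars n"] by (auto simp: select_def)

lemma subst_select_NW:
  assumes K: "field_on n K" and t: "t \<in> {1..n}"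
  shows "subst (select n t) (NW K n) = (NW_t K t n :: (nw_var, 'a::field) mpoly)"
proof -
  have NW_t: "subst (select n t) (NW_t K i n) = (NW_t K i n :: (nw_var, 'a) mpoly)" for i
  proof -
    have "select n t (XVar j (ring.eval K f j)) = (Var (XVar j (ring.eval K f j)) :: (nw_var, 'a) mpoly)"
      if "f \<in> low_degree_polys K (n div (2 * i))" "j \<in> {1..n}" for f j
      using low_degree_eval_carrier[OF field_on_field[OF K] that(1)] that(2) field_on_carrier[OF K]
      by (auto simp: select_def x_vars_def)
    then show ?thesis
      unfolding NW_t_def subst_sum subst_prod subst_Var by (intro sum.cong prod.cong refl) auto
  qed
  have Y: "select n t (YVar i) = (if i = t then 1 else (0 :: (nw_var, 'a) mpoly))" for i
    by (auto simp: select_def x_vars_def)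
  have "subst (select n t) (NW K n) = (\<Sum>i\<in>{1..n}. if i = t then NW_t K i n else (0 :: (nw_var, 'a) mpoly))"
    unfolding NW_def subst_sum subst_mult subst_Var NW_t Y by (intro sum.cong) auto
  then show ?thesis
    using t by simp
qed


section \<open>The lower bound\<close>

text \<open>The order of quantifiers matters: \<open>D\<close> depends only on the circuit, and
  \<open>b\<close>, \<open>b'\<close>, \<open>t\<close> may be chosen after it, according to where
  \<open>D\<close> is light.\<close>

lemma NW_circuit_inequality:
  fixes C :: "(nw_var, 'a::field) circuit"
  assumes K: "field_on n K" and n: "0 < n"
    and C: "homogeneous_SPSP_star C" "computes C (NW K n)"
  obtains D where "sum_mset D = n + 1"
    "\<And>b b' t k l. 0 < b \<Longrightarrow> b \<le> b' \<Longrightarrow> t \<in> {1..n} \<Longrightarrow> k = n div (2 * t) \<Longrightarrow>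
      n ^ k * card (mons (x_vars n) l) \<le>
      circuit_size C ^ (size (filter_mset (\<lambda>d. b' < d) D) + 1) * 2 ^ ((n + 1) div b + 1) *
        card (mons (x_vars n) (l + (sum_mset (filter_mset (\<lambda>d. b < d \<and> d \<le> b') D) + k * (2 * b)))) +
      n ^ k * (n ^ k * card (mons (x_vars n) (l - (n - 2 * k))))"
proof -
  obtain D gs and qs :: "nat \<Rightarrow> (nw_var, 'a) mpoly list" where
    NW: "NW K n = (\<Sum>i\<leftarrow>gs. prod_list (qs i))" and gs: "card (set gs) \<le> circuit_size C"
    and D: "sum_mset D = n + 1"
    and degs: "\<And>i. i \<in> set gs \<Longrightarrow> image_mset total_degree (mset (qs i)) = D"
    and keys: "\<And>i q. i \<in> set gs \<Longrightarrow> q \<in> set (qs i) \<Longrightarrow> card (keys q) \<le> circuit_size C"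
    by (rule homogeneous_SPSP_starE[OF C total_degree_NW(1)[OF K n] monomial_degree_NW[OF K]]) blast+
  have "n ^ k * card (mons (x_vars n) l) \<le>
      circuit_size C ^ (size (filter_mset (\<lambda>d. b' < d) D) + 1) * 2 ^ ((n + 1) div b + 1) *
        card (mons (x_vars n) (l + (sum_mset (filter_mset (\<lambda>d. b < d \<and> d \<le> b') D) + k * (2 * b)))) +
      n ^ k * (n ^ k * card (mons (x_vars n) (l - (n - 2 * k))))"
    if b: "0 < b" "b \<le> b'" and t: "t \<in> {1..n}" and k: "k = n div (2 * t)" for b b' t k l
  proof -
    define L where "L = size (filter_mset (\<lambda>d. b' < d) D)"
    define e where "e = sum_mset (filter_mset (\<lambda>d. b < d \<and> d \<le> b') D)"
    let ?S = "\<lambda>\<G>. shifted_products (x_vars n) \<G> ((n + 1) div b + 1) e"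
    let ?s = "circuit_size C"
    have "\<forall>i\<in>set gs. \<exists>\<G>. finite \<G> \<and> card \<G> \<le> ?s ^ L \<and> (\<forall>G\<in>\<G>. \<forall>j. G j \<in> polys (x_vars n) (2 * b)) \<and>
        subst (select n t) (prod_list (qs i)) \<in> mv.span (?S \<G>)"
    proof
      fix i assume i: "i \<in> set gs"
      let ?D = "image_mset total_degree (mset (qs i))"
      have "expandable (x_vars n) b ?s (size (filter_mset (\<lambda>d. b' < d) ?D))
          (sum_mset (filter_mset (\<lambda>d. b < d \<and> d \<le> b') ?D)) (sum_mset ?D)
          (subst (select n t) (prod_list (qs i)))"
        by (intro expandable_subst_prod_list select_in_polys b keys[OF i])
      then have "expandable (x_vars n) b ?s L e (n + 1) (subst (select n t) (prod_list (qs i)))"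
        unfolding degs[OF i] L_def e_def D .
      from expandable_imp_span[OF this b(1)]
      show "\<exists>\<G>. finite \<G> \<and> card \<G> \<le> ?s ^ L \<and> (\<forall>G\<in>\<G>. \<forall>j. G j \<in> polys (x_vars n) (2 * b)) \<and>
        subst (select n t) (prod_list (qs i)) \<in> mv.span (?S \<G>)" .
    qed
    from bchoice[OF this] obtain \<G> where \<G>: "\<forall>i\<in>set gs. finite (\<G> i) \<and> card (\<G> i) \<le> ?s ^ L \<and>
        (\<forall>G\<in>\<G> i. \<forall>j. G j \<in> polys (x_vars n) (2 * b)) \<and>
        subst (select n t) (prod_list (qs i)) \<in> mv.span (?S (\<G> i))"
      by (elim exE)
    define \<H> where "\<H> = (\<Union>i\<in>set gs. \<G> i)"
    have fin: "finite \<H>" and poly: "\<forall>G\<in>\<H>. \<forall>j. G j \<in> polys (x_vars n) (2 * b)"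
      using \<G> by (auto simp: \<H>_def)
    have "card \<H> \<le> (\<Sum>i\<in>set gs. card (\<G> i))"
      unfolding \<H>_def by (rule card_UN_le) simp
    also have "\<dots> \<le> (\<Sum>i\<in>set gs. ?s ^ L)"
      using \<G> by (intro sum_mono) blast
    \<comment> \<open>The additional factor \<open>?s\<close> accounts for the number of product
      gates.\<close>
    also have "\<dots> \<le> ?s ^ (L + 1)"
      using gs by simp
    finally have card_\<H>: "card \<H> \<le> ?s ^ (L + 1)" .
    have in_span: "subst (select n t) (prod_list (qs i)) \<in> mv.span (?S \<H>)" if i: "i \<in> set gs" for i
    proof (rule mv_span_mono[OF shifted_products_mono])
      show "\<G> i \<subseteq> \<H>"
        using i by (auto simp: \<H>_def)
      show "subst (select n t) (prod_list (qs i)) \<in> mv.span (?S (\<G> i))"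
        using \<G> i by blast
    qed
    have "(\<Sum>i\<leftarrow>us. subst (select n t) (prod_list (qs i))) \<in> mv.span (?S \<H>)" if "set us \<subseteq> set gs" for us
      using that
    proof (induction us)
      case (Cons i us)
      have "subst (select n t) (prod_list (qs i)) + (\<Sum>i\<leftarrow>us. subst (select n t) (prod_list (qs i))) \<in> mv.span (?S \<H>)"
        by (intro mv.span_add in_span Cons.IH) (use Cons.prems in auto)
      then show ?case
        by simp
    qed (simp add: mv.span_zero)
    moreover have "NW_t K t n = (\<Sum>i\<leftarrow>gs. subst (select n t) (prod_list (qs i)))"
      unfolding subst_select_NW[OF K t, symmetric] NW subst_sum_list by (simp add: comp_def)
    ultimately have "(NW_t K t n :: (nw_var, 'a) mpoly) \<in> mv.span (?S \<H>)"
      by simp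
    moreover have "2 * k \<le> n"
    proof -
      have "k \<le> n div 2"
        unfolding k using t by (intro div_le_mono2) auto
      then show ?thesis
        by simp
    qed
    ultimately have "n ^ k * card (mons (x_vars n) l) \<le>
        card \<H> * 2 ^ ((n + 1) div b + 1) * card (mons (x_vars n) (l + (e + k * (2 * b)))) +
        n ^ k * (n ^ k * card (mons (x_vars n) (l - (n - 2 * k))))"
      using NW_t_complexity[OF K k[symmetric] _ fin poly] by blast
    also have "\<dots> \<le> ?s ^ (L + 1) * 2 ^ ((n + 1) div b + 1) * card (mons (x_vars n) (l + (e + k * (2 * b)))) +
        n ^ k * (n ^ k * card (mons (x_vars n) (l - (n - 2 * k))))"
      using card_\<H> by (intro add_right_mono mult_right_mono) auto
    finally show ?thesis
      unfolding L_def e_def .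
  qed
  with D that show thesis
    by blast
qed

section \<open>The light scale and the choice of parameters\<close>

lemma size_filter_mset_mult_le: "size (filter_mset (\<lambda>d. b < d) D) * b \<le> sum_mset (D :: nat multiset)"
  by (induction D) auto

text \<open>The half-open scales are disjoint, so each degree is counted at most once.\<close>

lemma sum_filter_scales_le:
  fixes D :: "nat multiset"
  assumes B: "2 \<le> B"
  shows "(\<Sum>i\<in>I. sum_mset (filter_mset (\<lambda>d. B ^ i < d \<and> d \<le> B ^ (i + 1)) D)) \<le> sum_mset D"
proof (cases "finite I")
  case fin: True
  show ?thesis
  proof (induction D)
    case (add x D)
    have "(\<Sum>i\<in>I. if B ^ i < x \<and> x \<le> B ^ (i + 1) then x else 0) \<le> x"
    proof (cases "\<exists>i\<in>I. B ^ i < x \<and> x \<le> B ^ (i + 1)")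
      case True
      then obtain i where i: "i \<in> I" "B ^ i < x" "x \<le> B ^ (i + 1)"
        by blast
      have "j = i" if "B ^ j < x" "x \<le> B ^ (j + 1)" for j
      proof -
        have "B ^ i < B ^ (j + 1)" "B ^ j < B ^ (i + 1)"
          using i that by linarith+
        then have "i < j + 1" "j < i + 1"
          using B power_less_imp_less_exp[of B i "j + 1"] power_less_imp_less_exp[of B j "i + 1"]
          by linarith+
        then show ?thesis
          by simp
      qed
      then have "(B ^ j < x \<and> x \<le> B ^ (j + 1)) = (j = i)" for j
        using i(2,3) by blast
      then have "(\<Sum>j\<in>I. if B ^ j < x \<and> x \<le> B ^ (j + 1) then x else 0) = (\<Sum>j\<in>I. if j = i then x else 0)"
        by presburger
      then show ?thesis
        using i fin by simp
    next
      case False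
      then have "(\<Sum>i\<in>I. if B ^ i < x \<and> x \<le> B ^ (i + 1) then x else 0) = 0"
        by (intro sum.neutral) auto
      then show ?thesis
        by linarith
    qed
    moreover have "(\<Sum>i\<in>I. sum_mset (filter_mset (\<lambda>d. B ^ i < d \<and> d \<le> B ^ (i + 1)) (add_mset x D)))
        = (\<Sum>i\<in>I. if B ^ i < x \<and> x \<le> B ^ (i + 1) then x else 0)
          + (\<Sum>i\<in>I. sum_mset (filter_mset (\<lambda>d. B ^ i < d \<and> d \<le> B ^ (i + 1)) D))"
      unfolding sum.distrib[symmetric] by (intro sum.cong) auto
    ultimately show ?case
      using add by simp
  qed simp
qed simp

lemma obtain_light_scale:
  fixes D :: "nat multiset"
  assumes B: "2 \<le> B"
  obtains i where "i \<in> {1..17}"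
    "17 * sum_mset (filter_mset (\<lambda>d. B ^ i < d \<and> d \<le> B ^ (i + 1)) D) \<le> sum_mset D"
proof -
  let ?e = "\<lambda>i. sum_mset (filter_mset (\<lambda>d. B ^ i < d \<and> d \<le> B ^ (i + 1)) D)"
  have "\<exists>i\<in>{1..17}. 17 * ?e i \<le> sum_mset D"
  proof (rule ccontr)
    assume "\<not> ?thesis"
    then have "sum_mset D < 17 * ?e i" if "i \<in> {1..17}" for i
      using that not_le by blast
    then have "(\<Sum>i\<in>{1..17::nat}. sum_mset D) < (\<Sum>i\<in>{1..17}. 17 * ?e i)"
      by (intro sum_strict_mono) auto
    also have "\<dots> \<le> 17 * sum_mset D"
      unfolding sum_distrib_left[symmetric] by (intro mult_left_mono sum_filter_scales_le B) simp
    finally show False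
      by simp
  qed
  then show thesis
    using that by blast
qed

text \<open>
  With \<open>n\<^sup>2\<close> variables and shifts of degree up to \<open>l \<approx> n\<^sup>3 / (4 k ln n)\<close>, increasing the degree by
  one multiplies the number of monomials by about \<open>exp (4 k ln n / n)\<close>.
\<close>

lemma shift_degree_exists:
  assumes V: "finite V" "card V = n\<^sup>2"
    and n: "3 \<le> n" and k: "1 \<le> k" "32 * k \<le> n" "16 * real k * ln (real n) \<le> real n" and h: "8 * h \<le> n"
  obtains l where
    "real (card (mons V (l + h))) \<le> real (card (mons V l)) * exp (real k * ln (real n) / 2)"
    "2 * real n ^ k * real (card (mons V (l - (n - 2 * k)))) \<le> real (card (mons V l))"
    "0 < card (mons V l)"
proof -
  define y where "y = 4 * real k * ln (real n)"
  have ln_n: "1 \<le> ln (real n)"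
  proof -
    have "exp 1 \<le> (3 :: real)"
      using exp_le .
    also have "3 \<le> real n"
      using n by simp
    finally show ?thesis
      using n by (subst ln_ge_iff) auto
  qed
  have y: "0 < y" "4 * y \<le> real n"
    using k ln_n by (auto simp: y_def)
  define c where "c = real n ^ 3"
  \<comment> \<open>Chosen to make \<open>x\<close>, the growth rate \<open>n\<^sup>2 / l\<close>
    per degree, about \<open>y / n\<close>.\<close>
  define l where "l = nat \<lceil>c / y\<rceil>"
  have "0 \<le> c / y"
    using y by (simp add: c_def)
  then have l: "c / y \<le> real l" "real l \<le> c / y + 1"
    unfolding l_def by linarith+
  have c: "c = real n * (real n * real n)"
    by (simp add: c_def power3_eq_cube)
  have n_sq: "real n \<le> real n * real n"
    using n by simp
  have n_c: "real n \<le> c"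
    unfolding c using n mult_left_mono[of 1 "real n * real n" "real n"] mult_mono[of 1 "real n" 1 "real n"]
    by simp
  have "4 * (real n * real n) \<le> c / y"
    using y n mult_left_mono[of "4 * y" "real n" "real n * real n"] by (simp add: c field_simps)
  then have "real n \<le> real l"
    using l(1) n_sq zero_le_square[of "real n"] by linarith
  then have "n \<le> l"
    by simp
  then have l0: "0 < l"
    using n by simp
  define x where "x = real (n\<^sup>2) / real l"
  have x_n: "x * real n = c / real l"
    by (simp add: x_def c power2_eq_square)
  have x_le: "x \<le> y / real n"
  proof -
    have "c \<le> real l * y"
      using l(1) y by (simp add: field_simps)
    then have "x * real n \<le> y"
      unfolding x_n using l0 by (simp add: field_simps)
    then show ?thesis
      using n by (simp add: field_simps)
  qed
  \<comment> \<open>The factor 3 / 4 absorbs the rounding in \<open>l\<close>, since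
    \<open>4 * y\<close> is at most \<open>n\<close> and hence at most \<open>c\<close>.\<close>
  have x_ge: "3 / 4 * y \<le> x * real n"
  proof -
    have "real l * y \<le> c + y"
      using l(2) y by (simp add: field_simps)
    then have "3 / 4 * y * real l \<le> c"
      using y n_c by (simp add: field_simps)
    then show ?thesis
      unfolding x_n using l0 by (simp add: field_simps)
  qed
  have x0: "0 \<le> x" "x \<le> 1 / 4"
  proof -
    show "0 \<le> x"
      by (simp add: x_def)
    have "y / real n \<le> 1 / 4"
      using y n by (simp add: field_simps)
    with x_le show "x \<le> 1 / 4"
      by linarith
  qed
  have exp_n: "exp (real k * ln (real n)) = real n ^ k"
    using n by (simp add: exp_of_nat_mult)
  have "real (card (mons V (l + h))) \<le> real (card (mons V l)) * (1 + x) ^ h"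
    unfolding x_def using card_mons_add_le[OF V(1) l0, of h] V by simp
  also have "(1 + x) ^ h \<le> exp x ^ h"
    using x0 exp_ge_add_one_self[of x] by (intro power_mono) auto
  also have "\<dots> = exp (real h * x)"
    by (simp add: exp_of_nat_mult)
  \<comment> \<open>A shift by at most \<open>n / 8\<close> degrees costs only
    \<open>exp (y / 8)\<close>, the square root of \<open>n ^ k\<close>.\<close>
  also have "real h * x \<le> (real n / 8) * (y / real n)"
    using h x_le x0 by (intro mult_mono) auto
  also have "\<dots> = real k * ln (real n) / 2"
    using n by (simp add: y_def)
  finally have 1: "real (card (mons V (l + h))) \<le> real (card (mons V l)) * exp (real k * ln (real n) / 2)"
    by (simp add: mult_left_mono)
  have "real k * ln (real n) + ln 2 \<le> real (n - 2 * k) * ln (1 + x)"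
  proof -
    have "x * (3 / 4) \<le> x - x\<^sup>2"
      using x0 mult_left_mono[of x "1/4" x] by (simp add: power2_eq_square)
    also have "\<dots> \<le> ln (1 + x)"
      using x0 by (intro ln_one_plus_pos_lower_bound) auto
    finally have ln_x: "x * (3 / 4) \<le> ln (1 + x)" .
    have "ln 2 \<le> (1 :: real)"
      using ln_2_less_1 by simp
    also have "1 \<le> real k * ln (real n)"
      using k ln_n mult_mono[of 1 "real k" 1 "ln (real n)"] by simp
    finally have "real k * ln (real n) + ln 2 \<le> y / 2"
      by (simp add: y_def)
    \<comment> \<open>Three losses are allowed for: 15 / 16 from \<open>n - 2 * k\<close> with
      \<open>32 * k \<le> n\<close>, one 3 / 4 from the logarithm and the other from rounding
      \<open>l\<close>. Their product, 135 / 256, still exceeds 1 / 2.\<close>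
    also have "\<dots> \<le> (15 / 16) * (3 / 4) * (3 / 4 * y)"
      using y by simp
    also have "\<dots> \<le> (15 / 16) * (3 / 4) * (x * real n)"
      using x_ge by (intro mult_left_mono) auto
    also have "\<dots> = (15 / 16 * real n) * (x * (3 / 4))"
      by simp
    also have "\<dots> \<le> real (n - 2 * k) * ln (1 + x)"
      using k x0 ln_x by (intro mult_mono) (auto simp: of_nat_diff)
    finally show ?thesis .
  qed
  then have "exp (real k * ln (real n) + ln 2) \<le> exp (real (n - 2 * k) * ln (1 + x))"
    by simp
  then have pow: "2 * real n ^ k \<le> (1 + x) ^ (n - 2 * k)"
  proof -
    have "exp (real (n - 2 * k) * ln (1 + x)) = (1 + x) ^ (n - 2 * k)"
      using x0 by (simp add: exp_of_nat_mult)
    moreover have "exp (real k * ln (real n) + ln 2) = 2 * real n ^ k"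
      by (simp only: exp_add exp_n) simp
    ultimately show ?thesis
      using \<open>exp (real k * ln (real n) + ln 2) \<le> _\<close> by simp
  qed
  have "real (card (mons V (l - (n - 2 * k)))) * (2 * real n ^ k)
      \<le> real (card (mons V (l - (n - 2 * k)))) * (1 + x) ^ (n - 2 * k)"
    using pow by (intro mult_left_mono) auto
  also have "\<dots> \<le> real (card (mons V l))"
    using card_mons_add_ge[OF V(1), of "l - (n - 2 * k)" "n - 2 * k"] \<open>n \<le> l\<close> V
    by (simp add: x_def)
  finally have 2: "2 * real n ^ k * real (card (mons V (l - (n - 2 * k)))) \<le> real (card (mons V l))"
    by (simp add: mult_ac)
  have "0 < card (mons V l)"
    using V by (simp add: card_mons)
  with 1 2 show thesis
    by (rule that)
qed

text \<open>\<open>k * b\<close> lies between \<open>n / 64\<close> and \<open>n / 32\<close>,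
  whereas \<open>L\<close> is at most \<open>(n + 1) / b'\<close> with \<open>b' = B * b\<close>. So
  the gain \<open>k * ln n\<close> and the cost \<open>(L + 1) * ln s\<close> differ in scale by the
  factor \<open>B\<close>.\<close>

lemma NW_circuit_size_ge:
  fixes C :: "(nw_var, 'a::field) circuit"
  assumes K: "field_on n K" and C: "homogeneous_SPSP_star C" "computes C (NW K n)"
    and B: "B ^ 20 \<le> n" "ln (real n) \<le> 2 * real B" and n: "768 \<le> ln (real n)"
  shows "exp (real B) \<le> real (circuit_size C)"
proof -
  have B384: "384 \<le> B"
    using B n by linarith
  then have B1: "1 \<le> B" "2 \<le> B"
    by auto
  have n_pow: "B ^ j \<le> n" if "j \<le> 20" for j
    using B(1) power_increasing[OF that B1(1)] by linarith
  have n384: "384 \<le> n"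
    using n_pow[of 1] B384 by simp
  then have n0: "0 < n"
    by simp
  obtain D where D: "sum_mset D = n + 1" and ineq:
    "\<And>b b' t k l. 0 < b \<Longrightarrow> b \<le> b' \<Longrightarrow> t \<in> {1..n} \<Longrightarrow> k = n div (2 * t) \<Longrightarrow>
      n ^ k * card (mons (x_vars n) l) \<le>
      circuit_size C ^ (size (filter_mset (\<lambda>d. b' < d) D) + 1) * 2 ^ ((n + 1) div b + 1) *
        card (mons (x_vars n) (l + (sum_mset (filter_mset (\<lambda>d. b < d \<and> d \<le> b') D) + k * (2 * b)))) +
      n ^ k * (n ^ k * card (mons (x_vars n) (l - (n - 2 * k))))"
    using NW_circuit_inequality[OF K n0 C] by blast
  obtain i where i: "i \<in> {1..17}"
    and light: "17 * sum_mset (filter_mset (\<lambda>d. B ^ i < d \<and> d \<le> B ^ (i + 1)) D) \<le> sum_mset D"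
    using obtain_light_scale[OF B1(2)] by blast
  define b where "b = B ^ i"
  define b' where "b' = B ^ (i + 1)"
  \<comment> \<open>Here \<open>t = 16 * b\<close>, which makes \<open>2 * k * b\<close> at most
    \<open>n / 16\<close>.\<close>
  define k where "k = n div (2 * (16 * b))"
  define e where "e = sum_mset (filter_mset (\<lambda>d. b < d \<and> d \<le> b') D)"
  define L where "L = size (filter_mset (\<lambda>d. b' < d) D)"
  define s where "s = circuit_size C"
  have e: "17 * e \<le> n + 1"
    using light D by (simp add: e_def b_def b'_def)
  have L: "L * b' \<le> n + 1"
    using size_filter_mset_mult_le[of b' D] D by (simp add: L_def)
  have b'_eq: "b' = B * b"
    by (simp add: b_def b'_def)
  have b0: "0 < b"
    using B1 by (simp add: b_def)
  have bB: "B \<le> b"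
    using power_increasing[of 1 i B] i B1 by (simp add: b_def)
  have b'n: "b' \<le> n"
    unfolding b'_def using i by (intro n_pow) auto
  have bb': "b \<le> b'"
    using B1 by (simp add: b'_eq)
  have "32 * b \<le> B * b"
    using B384 by (intro mult_right_mono) auto
  then have b32: "32 * b \<le> n"
    using b'n b'_eq by linarith
  have k_le: "32 * (k * b) \<le> n"
    using div_times_less_eq_dividend[of n "2 * (16 * b)"] by (simp add: k_def mult_ac)
  have k1: "1 \<le> k"
    using b32 b0 by (simp add: k_def Suc_le_eq div_greater_zero_iff)
  have n_lt: "n < 64 * (k * b)"
  proof -
    have "n < (k + 1) * (2 * (16 * b))"
      unfolding k_def using b0 dividend_less_div_times[of "2 * (16 * b)" n] by simp
    also have "\<dots> = 32 * (k * b) + 32 * b"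
      by (simp add: algebra_simps)
    also have "\<dots> \<le> 64 * (k * b)"
      using k1 by simp
    finally show ?thesis .
  qed
  have k32: "32 * k \<le> n"
    using k_le b0 by (metis One_nat_def Suc_leI le_trans mult.commute mult_le_mono2 mult.right_neutral)
  \<comment> \<open>This is where the scales have to start at exponent 1: \<open>b\<close> must be
    at least \<open>B\<close>, and so at least half of \<open>ln n\<close>.\<close>
  have k_ln: "16 * real k * ln (real n) \<le> real n"
  proof -
    have "16 * real k * ln (real n) \<le> 16 * real k * (2 * real b)"
      using B(2) bB by (intro mult_left_mono) auto
    also have "\<dots> = real (32 * (k * b))"
      by simp
    also have "\<dots> \<le> real n"
      using k_le by (simp only: of_nat_le_iff)
    finally show ?thesis .
  qed
  \<comment> \<open>8 / 17 of \<open>n + 1\<close> for the light factors plus half of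
    \<open>n\<close> for the derivatives; choosing 17 instead of 16 scales absorbs the
    \<open>+ 1\<close>.\<close>
  have h8: "8 * (e + k * (2 * b)) \<le> n"
    using e k_le n384 by (simp add: algebra_simps)
  obtain l where l:
    "real (card (mons (x_vars n) (l + (e + k * (2 * b))))) \<le> real (card (mons (x_vars n) l)) * exp (real k * ln (real n) / 2)"
    "2 * real n ^ k * real (card (mons (x_vars n) (l - (n - 2 * k)))) \<le> real (card (mons (x_vars n) l))"
    "0 < card (mons (x_vars n) l)"
    using shift_degree_exists[OF finite_x_vars card_x_vars _ k1 k32 k_ln h8] n384 by auto
  define M where "M = real (card (mons (x_vars n) l))"
  define E where "E = exp (real k * ln (real n) / 2)"
  define A where "A = real s ^ (L + 1) * 2 ^ ((n + 1) div b + 1)"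
  have E: "real n ^ k = E * E"
    using n0 by (simp add: E_def exp_of_nat_mult flip: exp_add)
  have E0: "0 < E"
    by (simp add: E_def)
  have s0: "0 < s"
    using C by (simp add: s_def circuit_size_def computes_def wf_circuit_def)
  have t: "16 * b \<in> {1..n}"
    using b0 b32 by simp
  have "n ^ k * card (mons (x_vars n) l) \<le>
      s ^ (L + 1) * 2 ^ ((n + 1) div b + 1) * card (mons (x_vars n) (l + (e + k * (2 * b)))) +
      n ^ k * (n ^ k * card (mons (x_vars n) (l - (n - 2 * k))))"
    unfolding s_def L_def e_def by (rule ineq[OF b0 bb' t k_def])
  then have "real (n ^ k * card (mons (x_vars n) l)) \<le>
      real (s ^ (L + 1) * 2 ^ ((n + 1) div b + 1) * card (mons (x_vars n) (l + (e + k * (2 * b)))) +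
      n ^ k * (n ^ k * card (mons (x_vars n) (l - (n - 2 * k)))))"
    by (simp only: of_nat_le_iff)
  also have "\<dots> = A * real (card (mons (x_vars n) (l + (e + k * (2 * b))))) +
      real n ^ k / 2 * (2 * real n ^ k * real (card (mons (x_vars n) (l - (n - 2 * k)))))"
    by (simp add: A_def)
  \<comment> \<open>The overlaps take away at most half of the \<open>n ^ k\<close> sets of size
    \<open>M\<close>; the other half must be covered by the term with \<open>A\<close>.\<close>
  also have "\<dots> \<le> A * (M * E) + real n ^ k / 2 * M"
    unfolding M_def E_def using l by (intro add_mono mult_left_mono) (auto simp: A_def)
  finally have "E * E * M \<le> (A * E + E * E / 2) * M"
    by (simp add: E M_def algebra_simps)
  then have "E * E \<le> A * E + E * E / 2"
    using l(3) by (simp add: M_def)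
  then have "E * E \<le> (2 * A) * E"
    by simp
  then have "E \<le> 2 * A"
    using E0 by simp
  then have "ln E \<le> ln (2 * A)"
    using E0 by (simp add: ln_mono)
  also have "\<dots> = real (L + 1) * ln (real s) + real ((n + 1) div b + 2) * ln 2"
    using s0 ln_realpow[of 2 2] by (simp add: A_def ln_mult ln_realpow algebra_simps)
  also have "\<dots> \<le> real (L + 1) * ln (real s) + real (66 * k) * 1"
  proof -
    have "(n + 1) div b \<le> (64 * (k * b)) div b"
      using n_lt by (intro div_le_mono) simp
    then have "(n + 1) div b + 2 \<le> 66 * k"
      using b0 k1 by simp
    then show ?thesis
      using ln_2_less_1 by (intro add_left_mono mult_mono) auto
  qed
  \<comment> \<open>The cost \<open>2 ^ O(k)\<close> is dominated once \<open>ln n\<close> is at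
    least 264, four times 66.\<close>
  also have "real (66 * k) * 1 \<le> real k * ln (real n) / 4"
    using n mult_left_mono[of 264 "ln (real n)" "real k"] by simp
  finally have main: "real k * ln (real n) / 4 \<le> real (L + 1) * ln (real s)"
    by (simp add: E_def)
  have ln_s: "0 \<le> ln (real s)"
    using s0 by simp
  \<comment> \<open>256 is 64 (from \<open>n_lt\<close>) times 4 (from \<open>main\<close>), and 3
    comes from the bound \<open>3 * n\<close> at the end of the chain; this is the origin of
    768.\<close>
  have "real n * (real B * 3) \<le> real n * (real B * (ln (real n) / 256))"
    using n by (intro mult_left_mono) auto
  also have "\<dots> = (real n / 64) * (real B * (ln (real n) / 4))"
    by simp
  also have "\<dots> \<le> real (k * b) * (real B * (ln (real n) / 4))"
  proof (rule mult_right_mono)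
    have "real n \<le> real (64 * (k * b))"
      using n_lt by (simp only: of_nat_le_iff less_imp_le)
    then show "real n / 64 \<le> real (k * b)"
      by simp
  qed (use n in simp)
  also have "\<dots> = (real k * ln (real n) / 4) * real b'"
    by (simp add: b'_eq)
  also have "\<dots> \<le> (real (L + 1) * ln (real s)) * real b'"
    using main by (intro mult_right_mono) auto
  also have "\<dots> = real (L * b' + b') * ln (real s)"
    by (simp add: algebra_simps)
  \<comment> \<open>\<open>L * b'\<close> is at most \<open>n + 1\<close> and \<open>b'\<close> at
    most \<open>n\<close>, so \<open>2 * n + 1\<close> would do.\<close>
  also have "\<dots> \<le> real (3 * n) * ln (real s)"
    using L b'n n0 ln_s by (intro mult_right_mono) (auto simp: of_nat_le_iff simp del: of_nat_add of_nat_mult)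
  finally have "real B \<le> ln (real s)"
    using n0 by simp
  then have "exp (real B) \<le> exp (ln (real s))"
    by simp
  also have "\<dots> = real s"
    using s0 by simp
  finally show ?thesis
    by (simp add: s_def)
qed

text \<open>\<open>B\<close> is the integer part of \<open>n powr (1 / 20)\<close>; halving the
  exponent absorbs the rounding. The scales reach up to \<open>B ^ 18\<close>, for which
  \<open>B ^ 20 \<le> n\<close> leaves room.\<close>

lemma NW_lower_bound:
  "\<exists>\<epsilon>>0. \<exists>n0 :: nat. \<forall>n\<ge>n0. primepow n \<longrightarrow>
    (\<forall>K. field_on n K \<longrightarrow>
      (\<forall>C :: (nw_var, 'a::field) circuit.
         homogeneous_SPSP_star C \<and> computes C (NW K n) \<longrightarrow>
         real (circuit_size C) \<ge> exp (real n powr \<epsilon>)))"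
proof -
  have "eventually (\<lambda>n :: nat. real n powr (1 / 40) \<le> real n powr (1 / 20) - 1) at_top"
    "eventually (\<lambda>n :: nat. ln (real n) \<le> 2 * (real n powr (1 / 20) - 1)) at_top"
    "eventually (\<lambda>n :: nat. 768 \<le> ln (real n)) at_top"
    by real_asymp+
  then have "eventually (\<lambda>n :: nat. real n powr (1 / 40) \<le> real n powr (1 / 20) - 1 \<and>
      ln (real n) \<le> 2 * (real n powr (1 / 20) - 1) \<and> 768 \<le> ln (real n)) at_top"
    by eventually_elim simp
  then obtain n0 where n0: "\<And>n. n \<ge> n0 \<Longrightarrow> real n powr (1 / 40) \<le> real n powr (1 / 20) - 1 \<and>
      ln (real n) \<le> 2 * (real n powr (1 / 20) - 1) \<and> 768 \<le> ln (real n)"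
    unfolding eventually_at_top_linorder by blast
  have "exp (real n powr (1 / 40)) \<le> real (circuit_size C)"
    if n: "n \<ge> n0" and K: "field_on n K" and C: "homogeneous_SPSP_star C" "computes C (NW K n)"
    for n K and C :: "(nw_var, 'a) circuit"
  proof -
    define B where "B = nat \<lfloor>real n powr (1 / 20)\<rfloor>"
    have "0 \<le> real n powr (1 / 20)"
      by simp
    then have B: "real B \<le> real n powr (1 / 20)" "real n powr (1 / 20) - 1 \<le> real B"
      unfolding B_def by linarith+
    have npos: "0 < real n"
      using n0[OF n] by (cases "n = 0") auto
    have "real (B ^ 20) \<le> (real n powr (1 / 20)) ^ 20"
      using B(1) power_mono[of "real B" _ 20] by simp
    also have "\<dots> = real n"
      using npos by (simp add: powr_powr flip: powr_realpow)
    finally have "B ^ 20 \<le> n"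
      by (simp only: of_nat_le_iff)
    then have "exp (real B) \<le> real (circuit_size C)"
      using n0[OF n] B(2) by (intro NW_circuit_size_ge[OF K C]) auto
    moreover have "exp (real n powr (1 / 40)) \<le> exp (real B)"
      using n0[OF n] B(2) by simp
    ultimately show ?thesis
      by linarith
  qed
  then show ?thesis
    by (intro exI[of _ "1 / 40"] conjI exI[of _ n0]) auto
qed


section \<open>Building circuits\<close>

primrec shift_gate :: "nat \<Rightarrow> ('v, 'a) gate \<Rightarrow> ('v, 'a) gate" where
  "shift_gate k (InVar v) = InVar v"
| "shift_gate k (InConst c) = InConst c"
| "shift_gate k (SumGate ks) = SumGate (map ((+) k) ks)"
| "shift_gate k (ProdGate ks) = ProdGate (map ((+) k) ks)"

text \<open>Well-formedness without nonemptiness: the empty circuit is the starting point of the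
  inductions.\<close>

definition acyclic_gates :: "('v, 'a) circuit \<Rightarrow> bool"
  where "acyclic_gates C \<longleftrightarrow> (\<forall>i<length C. \<forall>k\<in>set (gate_children (C ! i)). k < i)"

lemma gate_children_shift: "gate_children (shift_gate k g) = map ((+) k) (gate_children g)"
  by (cases g) simp_all

lemma gate_poly_shift:
  assumes "\<And>k. k \<in> set (gate_children g) \<Longrightarrow> k < length qs"
  shows "gate_poly (ps @ qs) (shift_gate (length ps) g) = gate_poly qs g"
  using assms by (cases g) (auto simp: nth_append intro!: arg_cong[of _ _ sum_list] arg_cong[of _ _ prod_list])

lemma acyclic_gates_snocD:
  assumes "acyclic_gates (C @ [g])"
  shows "acyclic_gates C" "\<And>k. k \<in> set (gate_children g) \<Longrightarrow> k < length C"
proof -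
  show "acyclic_gates C"
    unfolding acyclic_gates_def
  proof (intro allI impI ballI)
    fix i k assume "i < length C" "k \<in> set (gate_children (C ! i))"
    then show "k < i"
      using assms[unfolded acyclic_gates_def, rule_format, of i k] by (simp add: nth_append)
  qed
  show "k < length C" if "k \<in> set (gate_children g)" for k
    using assms[unfolded acyclic_gates_def, rule_format, of "length C" k] that by simp
qed

lemma acyclic_gates_append_shift:
  assumes "acyclic_gates C" "acyclic_gates C'"
  shows "acyclic_gates (C @ map (shift_gate (length C)) C')"
  unfolding acyclic_gates_def
proof (intro allI impI ballI)
  fix i k
  assume i: "i < length (C @ map (shift_gate (length C)) C')"
    and k: "k \<in> set (gate_children ((C @ map (shift_gate (length C)) C') ! i))"
  show "k < i"
  proof (cases "i < length C")
    case True
    then show ?thesis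
      using assms(1)[unfolded acyclic_gates_def, rule_format, of i k] k by (simp add: nth_append)
  next
    case False
    then have "i - length C < length C'"
      using i by simp
    moreover from this obtain k' where "k = length C + k'" "k' \<in> set (gate_children (C' ! (i - length C)))"
      using k False by (auto simp: nth_append gate_children_shift)
    ultimately show ?thesis
      using assms(2)[unfolded acyclic_gates_def, rule_format, of "i - length C" k'] by simp
  qed
qed

text \<open>Shifted gates point only into their own copy, so placing circuits side by side does not
  disturb their values.\<close>

lemma gate_polys_append_shift:
  assumes "acyclic_gates C'"
  shows "gate_polys (C @ map (shift_gate (length C)) C') = gate_polys C @ gate_polys C'"
  using assms
proof (induction C' rule: rev_induct)
  case (snoc g C')
  have "gate_poly (gate_polys C @ gate_polys C') (shift_gate (length (gate_polys C)) g) =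
      gate_poly (gate_polys C') g"
    using acyclic_gates_snocD(2)[OF snoc.prems] by (intro gate_poly_shift) simp
  moreover have "gate_polys (C @ map (shift_gate (length C)) C') = gate_polys C @ gate_polys C'"
    using snoc acyclic_gates_snocD(1) by blast
  ultimately show ?case
    using gate_polys_snoc[of "C @ map (shift_gate (length C)) C'"] by (simp add: gate_polys_snoc)
qed simp

text \<open>The bound \<open>s\<close> on the circuit size also bounds the degree, because the circuits built
  below are formulas: subcircuits are not shared.\<close>

definition computable :: "'v set \<Rightarrow> ('v, 'a::field) mpoly \<Rightarrow> nat \<Rightarrow> bool"
  where "computable V p s \<longleftrightarrow> p \<in> polys V s \<and> (\<exists>C. computes C p \<and> circuit_size C \<le> s)"

lemma computable_mono: "computable V p s \<Longrightarrow> s \<le> t \<Longrightarrow> computable V p t"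
  unfolding computable_def using polys_mono order_trans by blast

lemma computes_iff:
  "computes C p \<longleftrightarrow> C \<noteq> [] \<and> acyclic_gates C \<and> gate_polys C ! (length C - 1) = p"
  unfolding computes_def wf_circuit_def acyclic_gates_def
  by (metis gate_polys_Nil last_conv_nth length_0_conv length_gate_polys)

lemma computable_Var: "v \<in> V \<Longrightarrow> computable V (Var v) 1"
  unfolding computable_def computes_iff acyclic_gates_def circuit_size_def
  by (intro conjI polys_Var exI[of _ "[InVar v]"]) (simp_all add: gate_polys_def)

lemma computable_Const: "computable V (Const c) 1"
  unfolding computable_def computes_iff acyclic_gates_def circuit_size_def
  by (intro conjI polys_Const exI[of _ "[InConst c]"]) (simp_all add: gate_polys_def)

text \<open>Builds a forest: circuits for all list elements stand side by side, and
  \<open>ks\<close> records their output gates.\<close>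

lemma computes_list:
  assumes "\<And>x. x \<in> set xs \<Longrightarrow> \<exists>C. computes C (f x) \<and> circuit_size C \<le> s x"
  shows "\<exists>C ks. acyclic_gates C \<and> length C \<le> (\<Sum>x\<leftarrow>xs. s x) \<and> (\<forall>k\<in>set ks. k < length C) \<and>
    map ((!) (gate_polys C)) ks = map f xs"
  using assms
proof (induction xs)
  case Nil
  show ?case
    by (intro exI[of _ "[]"]) (simp add: acyclic_gates_def)
next
  case (Cons x xs)
  obtain C where C: "computes C (f x)" "circuit_size C \<le> s x"
    using Cons.prems[of x] by auto
  obtain C' ks where C': "acyclic_gates C'" "length C' \<le> (\<Sum>x\<leftarrow>xs. s x)" "\<forall>k\<in>set ks. k < length C'"
    "map ((!) (gate_polys C')) ks = map f xs"
    using Cons.IH Cons.prems by auto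
  let ?C = "C @ map (shift_gate (length C)) C'"
  have polys: "gate_polys ?C = gate_polys C @ gate_polys C'"
    using C'(1) by (rule gate_polys_append_shift)
  have "C \<noteq> []"
    using C(1) by (simp add: computes_iff)
  have "map ((!) (gate_polys ?C)) (map ((+) (length C)) ks) = map ((!) (gate_polys C')) ks"
    unfolding polys by (simp add: nth_append comp_def)
  then have "map ((!) (gate_polys ?C)) ((length C - 1) # map ((+) (length C)) ks) = map f (x # xs)"
    using C(1) C'(4) \<open>C \<noteq> []\<close> by (simp add: polys nth_append computes_iff)
  moreover have "\<forall>k\<in>set ((length C - 1) # map ((+) (length C)) ks). k < length ?C"
    using C'(3) \<open>C \<noteq> []\<close> by (auto simp: trans_less_add1)
  moreover have "acyclic_gates ?C"
    using C C' by (intro acyclic_gates_append_shift) (auto simp: computes_iff)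
  moreover have "length ?C \<le> (\<Sum>x\<leftarrow>x # xs. s x)"
    using C C' by (simp add: circuit_size_def)
  ultimately show ?case
    by blast
qed

lemma computes_gate_list:
  assumes "\<And>x. x \<in> set xs \<Longrightarrow> \<exists>C. computes C (f x) \<and> circuit_size C \<le> s x"
  shows "\<exists>C. computes C (\<Sum>x\<leftarrow>xs. f x) \<and> circuit_size C \<le> Suc (\<Sum>x\<leftarrow>xs. s x)"
    and "\<exists>C. computes C (\<Prod>x\<leftarrow>xs. f x) \<and> circuit_size C \<le> Suc (\<Sum>x\<leftarrow>xs. s x)"
proof -
  obtain C ks where C: "acyclic_gates C" "length C \<le> (\<Sum>x\<leftarrow>xs. s x)" "\<forall>k\<in>set ks. k < length C"
    "map ((!) (gate_polys C)) ks = map f xs"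
    using computes_list[of xs f s, OF assms] by blast
  have *: "computes (C @ [g]) (gate_poly (gate_polys C) g)" if "gate_children g = ks" for g
    using C(1,3) that
    by (auto simp: computes_iff gate_polys_snoc nth_append acyclic_gates_def less_Suc_eq)
  have "computes (C @ [SumGate ks]) (\<Sum>x\<leftarrow>xs. f x)" "computes (C @ [ProdGate ks]) (\<Prod>x\<leftarrow>xs. f x)"
    using *[of "SumGate ks"] *[of "ProdGate ks"] C(4) by simp_all
  then show "\<exists>C. computes C (\<Sum>x\<leftarrow>xs. f x) \<and> circuit_size C \<le> Suc (\<Sum>x\<leftarrow>xs. s x)"
    "\<exists>C. computes C (\<Prod>x\<leftarrow>xs. f x) \<and> circuit_size C \<le> Suc (\<Sum>x\<leftarrow>xs. s x)"
    using C(2) unfolding circuit_size_def by (metis Suc_le_mono length_append_singleton)+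
qed

lemma computable_sum:
  assumes "finite A" "card A \<le> k" "\<And>a. a \<in> A \<Longrightarrow> computable V (f a) s"
  shows "computable V (sum f A) (Suc (k * s))"
    and "computable V (prod f A) (Suc (k * s))"
proof -
  obtain xs where xs: "set xs = A" "distinct xs"
    using finite_distinct_list[OF assms(1)] by blast
  have size: "(\<Sum>x\<leftarrow>xs. s) \<le> k * s"
    using assms(2) xs distinct_card[of xs] by (simp add: sum_list_triv)
  have C: "\<exists>C. computes C (f a) \<and> circuit_size C \<le> s" if "a \<in> set xs" for a
    using assms(3) that xs by (auto simp: computable_def)
  have sums: "sum f A = (\<Sum>x\<leftarrow>xs. f x)" "prod f A = (\<Prod>x\<leftarrow>xs. f x)"
    using xs by (simp_all add: sum.distinct_set_conv_list prod.distinct_set_conv_list flip: xs(1))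
  have deg: "f a \<in> polys V s" if "a \<in> A" for a
    using assms(3)[OF that] by (simp add: computable_def)
  have "sum f A \<in> polys V (Suc (k * s))"
  proof (cases "A = {}")
    case False
    \<comment> \<open>A sum does not raise the degree \<open>s\<close>, but \<open>s\<close> fits
      below \<open>Suc (k * s)\<close> only for positive \<open>k\<close>.\<close>
    then have "1 \<le> k"
      using assms(1,2) by (metis One_nat_def Suc_leI card_gt_0_iff order_trans)
    then have "s \<le> Suc (k * s)"
      by (simp add: le_SucI)
    then show ?thesis
      using deg polys_mono[of s "Suc (k * s)"] by (intro polys_sum) auto
  qed simp
  moreover have "prod f A \<in> polys V (Suc (k * s))"
  proof (rule polys_mono)
    show "prod f A \<in> polys V (\<Sum>a\<in>A. s)"
      using deg by (intro polys_prod)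
    show "(\<Sum>a\<in>A. s) \<le> Suc (k * s)"
      using assms(2) by (simp add: le_SucI)
  qed
  ultimately show "computable V (sum f A) (Suc (k * s))" "computable V (prod f A) (Suc (k * s))"
    using computes_gate_list[of xs f "\<lambda>_. s", OF C] size
    unfolding computable_def sums by (meson Suc_le_mono order_trans)+
qed

lemma computable_add: "computable V p s \<Longrightarrow> computable V q t \<Longrightarrow> computable V (p + q) (s + t + 1)"
  and computable_mult: "computable V p s \<Longrightarrow> computable V q t \<Longrightarrow> computable V (p * q) (s + t + 1)"
proof -
  assume pq: "computable V p s" "computable V q t"
  have C: "\<exists>C. computes C (fst x) \<and> circuit_size C \<le> snd x" if "x \<in> set [(p, s), (q, t)]" for x
    using that pq by (auto simp: computable_def)
  have "\<exists>C. computes C (p + q) \<and> circuit_size C \<le> s + t + 1"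
    "\<exists>C. computes C (p * q) \<and> circuit_size C \<le> s + t + 1"
    using computes_gate_list[of "[(p, s), (q, t)]" fst snd, OF C] by simp_all
  moreover have "p + q \<in> polys V (s + t + 1)"
    using pq by (intro polys_add) (auto simp: computable_def intro: polys_mono[rotated])
  moreover have "p * q \<in> polys V (s + t + 1)"
    using pq polys_mono[of "s + t" "s + t + 1"] by (auto simp: computable_def intro: polys_mult)
  ultimately show "computable V (p + q) (s + t + 1)" "computable V (p * q) (s + t + 1)"
    by (simp_all add: computable_def)
qed

section \<open>Summing over one-hot encodings\<close>

text \<open>
  A function \<open>\<phi>\<close> from \<open>P\<close> to \<open>S\<close> is encoded by the 0/1 variables \<open>Inr (h (q, c))\<close>, of which
  exactly those with \<open>\<phi> q = c\<close> are 1; \<open>one_hot\<close> rejects the other 0/1 vectors.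
\<close>

definition set_bits :: "nat set \<Rightarrow> 'v + nat \<Rightarrow> ('v, 'a::field) mpoly"
  where "set_bits e = case_sum Var (\<lambda>k. if k \<in> e then 1 else 0)"

lemma set_bits_simps [simp]:
  "set_bits e (Inl v) = Var v" "set_bits e (Inr k) = of_bool (k \<in> e)"
  by (simp_all add: set_bits_def)

abbreviation bit_var :: "('q \<times> nat \<Rightarrow> nat) \<Rightarrow> 'q \<Rightarrow> nat \<Rightarrow> ('v + nat, 'a::field) mpoly"
  where "bit_var h q c \<equiv> Var (Inr (h (q, c)))"

definition one_hot :: "('q \<times> nat \<Rightarrow> nat) \<Rightarrow> nat set \<Rightarrow> 'q \<Rightarrow> ('v + nat, 'a::field) mpoly"
  where "one_hot h S q =
    (\<Sum>c\<in>S. bit_var h q c * (\<Prod>c'\<in>S - {c}. Const 1 + Const (- 1) * bit_var h q c'))"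

definition encoding :: "('q \<times> nat \<Rightarrow> nat) \<Rightarrow> 'q set \<Rightarrow> ('q \<Rightarrow> nat) \<Rightarrow> nat set"
  where "encoding h P \<phi> = (\<lambda>q. h (q, \<phi> q)) ` P"

lemma prod_of_bool:
  "finite A \<Longrightarrow> (\<Prod>a\<in>A. of_bool (Q a)) = (of_bool (\<forall>a\<in>A. Q a) :: 'a::comm_semiring_1)"
  by (induction A rule: finite_induct) auto

text \<open>The summands of \<open>one_hot\<close> are indicators of mutually exclusive events, so
  their sum is 0 or 1 in every characteristic.\<close>

lemma subst_one_hot:
  assumes "finite S"
  shows "subst (set_bits e) (one_hot h S q :: ('v + nat, 'a::field) mpoly) =
    of_bool (\<exists>c. {c \<in> S. h (q, c) \<in> e} = {c})"
proof -
  have minus_one: "Const (- 1) = (- 1 :: ('v, 'a) mpoly)"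
    by (simp add: Const_def single_uminus)
  have "subst (set_bits e) (one_hot h S q :: ('v + nat, 'a) mpoly) =
      (\<Sum>c\<in>S. of_bool (h (q, c) \<in> e) * (\<Prod>c'\<in>S - {c}. of_bool (h (q, c') \<notin> e)))"
    unfolding one_hot_def subst_sum subst_mult subst_prod subst_add subst_Const subst_Var
    by (intro sum.cong prod.cong arg_cong2[where f = "(*)"]) (auto simp: minus_one)
  also have "\<dots> = (\<Sum>c\<in>S. of_bool ({c \<in> S. h (q, c) \<in> e} = {c}))"
  proof (rule sum.cong)
    fix c assume c: "c \<in> S"
    have "(\<Prod>c'\<in>S - {c}. of_bool (h (q, c') \<notin> e)) = (of_bool (\<forall>c'\<in>S - {c}. h (q, c') \<notin> e) :: ('v, 'a) mpoly)"
      using assms by (intro prod_of_bool) simp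
    then show "of_bool (h (q, c) \<in> e) * (\<Prod>c'\<in>S - {c}. of_bool (h (q, c') \<notin> e)) =
        (of_bool ({c \<in> S. h (q, c) \<in> e} = {c}) :: ('v, 'a) mpoly)"
      using c by auto
  qed simp
  also have "\<dots> = of_bool (\<exists>c. {c \<in> S. h (q, c) \<in> e} = {c})"
  proof (cases "\<exists>c. {c \<in> S. h (q, c) \<in> e} = {c}")
    case True
    then obtain c where c: "{c \<in> S. h (q, c) \<in> e} = {c}"
      by blast
    then have "(\<Sum>c\<in>S. of_bool ({c \<in> S. h (q, c) \<in> e} = {c})) = (\<Sum>c'\<in>S. if c' = c then 1 else (0 :: ('v, 'a) mpoly))"
      by (intro sum.cong) auto
    then show ?thesis
      using True c assms by auto
  qed auto
  finally show ?thesis .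
qed

text \<open>The one-hot factors vanish exactly on the vectors that encode no function. As
  \<open>h\<close> maps onto \<open>{..<m}\<close>, no bit is free, and every function is counted
  once.\<close>

lemma sum_one_hot_encodings:
  assumes P: "finite P" and S: "finite S" and h: "bij_betw h (P \<times> S) {..<m}"
  shows "(\<Sum>e\<in>Pow {..<m}. subst (set_bits e) ((\<Prod>q\<in>P. one_hot h S q) * G)) =
    (\<Sum>\<phi>\<in>P \<rightarrow>\<^sub>E S. subst (set_bits (encoding h P \<phi>)) (G :: ('v + nat, 'a::field) mpoly))"
proof -
  define valid where "valid e \<longleftrightarrow> (\<forall>q\<in>P. \<exists>c. {c \<in> S. h (q, c) \<in> e} = {c})" for e
  have inj: "h (q, c) = h (q', c') \<longleftrightarrow> q = q' \<and> c = c'" if "q \<in> P" "q' \<in> P" "c \<in> S" "c' \<in> S" for q q' c c'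
    using h that by (auto simp: bij_betw_def inj_on_def)
  have mem: "h (q, c) \<in> encoding h P \<phi> \<longleftrightarrow> \<phi> q = c" if "\<phi> \<in> P \<rightarrow>\<^sub>E S" "q \<in> P" "c \<in> S" for \<phi> q c
    using that inj by (auto simp: encoding_def PiE_def Pi_def)
  have "(\<Sum>e\<in>Pow {..<m}. subst (set_bits e) ((\<Prod>q\<in>P. one_hot h S q) * G)) =
      (\<Sum>e\<in>Pow {..<m}. if valid e then subst (set_bits e) G else 0)"
    using P by (intro sum.cong refl)
      (auto simp: subst_mult subst_prod subst_one_hot[OF S] prod_of_bool valid_def)
  also have "\<dots> = (\<Sum>e\<in>{e \<in> Pow {..<m}. valid e}. subst (set_bits e) G)"
    by (rule sum.inter_filter[symmetric]) simp
  also have "\<dots> = (\<Sum>\<phi>\<in>P \<rightarrow>\<^sub>E S. subst (set_bits (encoding h P \<phi>)) G)"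
  proof (rule sum.reindex_bij_betw[symmetric])
    show "bij_betw (encoding h P) (P \<rightarrow>\<^sub>E S) {e \<in> Pow {..<m}. valid e}"
      unfolding bij_betw_def
    proof (intro conjI inj_onI equalityI subsetI)
      fix \<phi> \<psi> assume *: "\<phi> \<in> P \<rightarrow>\<^sub>E S" "\<psi> \<in> P \<rightarrow>\<^sub>E S" "encoding h P \<phi> = encoding h P \<psi>"
      have "\<phi> q = \<psi> q" if "q \<in> P" for q
        using mem[OF *(1) that, of "\<phi> q"] mem[OF *(2) that, of "\<phi> q"] *(3) PiE_mem[OF *(1) that] by simp
      then show "\<phi> = \<psi>"
        using * by (intro PiE_ext)
    next
      fix e assume "e \<in> encoding h P ` (P \<rightarrow>\<^sub>E S)"
      then obtain \<phi> where \<phi>: "\<phi> \<in> P \<rightarrow>\<^sub>E S" "e = encoding h P \<phi>"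
        by blast
      have "e \<subseteq> {..<m}"
        using \<phi> h by (auto simp: encoding_def bij_betw_def PiE_def Pi_def)
      moreover have "{c \<in> S. h (q, c) \<in> e} = {\<phi> q}" if "q \<in> P" for q
        using mem[OF \<phi>(1) that] PiE_mem[OF \<phi>(1) that] \<phi>(2) by auto
      ultimately show "e \<in> {e \<in> Pow {..<m}. valid e}"
        unfolding valid_def by blast
    next
      fix e assume "e \<in> {e \<in> Pow {..<m}. valid e}"
      then have e: "e \<subseteq> {..<m}" "\<forall>q\<in>P. \<exists>c. {c \<in> S. h (q, c) \<in> e} = {c}"
        by (auto simp: valid_def)
      from bchoice[OF e(2)] obtain \<psi> where \<psi>: "\<forall>q\<in>P. {c \<in> S. h (q, c) \<in> e} = {\<psi> q}"
        by (elim exE)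
      have "e = encoding h P (restrict \<psi> P)"
      proof (intro equalityI subsetI)
        fix k assume k: "k \<in> e"
        then have "k \<in> h ` (P \<times> S)"
          using e(1) bij_betw_imp_surj_on[OF h] by auto
        then obtain q c where qc: "k = h (q, c)" "q \<in> P" "c \<in> S"
          by auto
        have "c \<in> {c \<in> S. h (q, c) \<in> e}"
          using qc k by simp
        then have "c \<in> {\<psi> q}"
          unfolding bspec[OF \<psi> qc(2)] .
        then show "k \<in> encoding h P (restrict \<psi> P)"
          using qc by (auto simp: encoding_def)
      next
        fix k assume "k \<in> encoding h P (restrict \<psi> P)"
        then obtain q where q: "q \<in> P" "k = h (q, \<psi> q)"
          by (auto simp: encoding_def)
        have "\<psi> q \<in> {c \<in> S. h (q, c) \<in> e}"
          unfolding bspec[OF \<psi> q(1)] by simp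
        then show "k \<in> e"
          using q(2) by simp
      qed
      moreover have "restrict \<psi> P \<in> P \<rightarrow>\<^sub>E S"
      proof (rule restrict_PiE_iff[THEN iffD2], rule ballI)
        fix q assume "q \<in> P"
        have "\<psi> q \<in> {c \<in> S. h (q, c) \<in> e}"
          unfolding bspec[OF \<psi> \<open>q \<in> P\<close>] by simp
        then show "\<psi> q \<in> S"
          by simp
      qed
      ultimately show "e \<in> encoding h P ` (P \<rightarrow>\<^sub>E S)"
        by blast
    qed
  qed
  finally show ?thesis .
qed

lemma subst_bit_var_encoding:
  assumes "bij_betw h (P \<times> S) {..<m}" "\<phi> \<in> P \<rightarrow>\<^sub>E S" "q \<in> P" "c \<in> S"
  shows "subst (set_bits (encoding h P \<phi>)) (bit_var h q c) = (of_bool (\<phi> q = c) :: ('v, 'a::field) mpoly)"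
proof -
  have "h (q, c) = h (q', \<phi> q') \<longleftrightarrow> (q, c) = (q', \<phi> q')" if "q' \<in> P" for q'
    using assms that PiE_mem[OF assms(2) that] by (intro inj_on_eq_iff[of h "P \<times> S"]) (auto simp: bij_betw_def)
  then have "h (q, c) \<in> encoding h P \<phi> \<longleftrightarrow> \<phi> q = c"
    using assms(3) by (auto simp: encoding_def)
  then show ?thesis
    by simp
qed


section \<open>Membership in VNP\<close>

text \<open>
  The 0/1 vectors guess the index \<open>t\<close> (at \<open>TPos\<close>), the coefficient list of a polynomial, padded to
  length \<open>n\<close> (at \<open>APos j\<close>), and all intermediate values of Horner's scheme at every point \<open>i\<close>
  (at \<open>HPos i j\<close>); the guesses are then checked locally.
\<close>

datatype nw_pos = TPos | APos nat | HPos nat nat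

definition nw_positions :: "nat \<Rightarrow> nw_pos set"
  where "nw_positions n = insert TPos (APos ` {..<n} \<union> (\<lambda>(i, j). HPos i j) ` ({1..n} \<times> {..<n}))"

definition horner_start :: "(nw_pos \<times> nat \<Rightarrow> nat) \<Rightarrow> nat \<Rightarrow> nat \<Rightarrow> (nw_var + nat, 'a::field) mpoly"
  where "horner_start h n i = (\<Sum>c\<in>{1..n}. bit_var h (APos 0) c * bit_var h (HPos i 0) c)"

text \<open>The arithmetic of \<open>K\<close> is unrelated to the coefficient field, so it enters
  as a table, in the index of the third bit. On a one-hot vector at most one summand is
  nonzero.\<close>

definition horner_step ::
    "nat ring \<Rightarrow> (nw_pos \<times> nat \<Rightarrow> nat) \<Rightarrow> nat \<Rightarrow> nat \<Rightarrow> nat \<Rightarrow> (nw_var + nat, 'a::field) mpoly"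
  where "horner_step K h n i j = (\<Sum>(a, c)\<in>{1..n} \<times> {1..n}.
    bit_var h (HPos i j) a * bit_var h (APos (Suc j)) c *
    bit_var h (HPos i (Suc j)) ((a \<otimes>\<^bsub>K\<^esub> i) \<oplus>\<^bsub>K\<^esub> c))"

text \<open>\<open>APos 0\<close> holds the leading coefficient, so the degree bound says that the
  first \<open>n - n div (2 * t)\<close> entries are the zero of \<open>K\<close>.\<close>

definition selector :: "nat ring \<Rightarrow> (nw_pos \<times> nat \<Rightarrow> nat) \<Rightarrow> nat \<Rightarrow> (nw_var + nat, 'a::field) mpoly"
  where "selector K h n = (\<Sum>t\<in>{1..n}. Var (Inl (YVar t)) *
    (bit_var h TPos t * (\<Prod>j\<in>{..<n - n div (2 * t)}. bit_var h (APos j) \<zero>\<^bsub>K\<^esub>)))"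

definition row_output :: "(nw_pos \<times> nat \<Rightarrow> nat) \<Rightarrow> nat \<Rightarrow> nat \<Rightarrow> (nw_var + nat, 'a::field) mpoly"
  where "row_output h n i = (\<Sum>c\<in>{1..n}. bit_var h (HPos i (n - 1)) c * Var (Inl (XVar i c)))"

definition nw_body :: "nat ring \<Rightarrow> (nw_pos \<times> nat \<Rightarrow> nat) \<Rightarrow> nat \<Rightarrow> (nw_var + nat, 'a::field) mpoly"
  where "nw_body K h n = (\<Prod>i\<in>{1..n}. horner_start h n i) *
    (\<Prod>(i, j)\<in>{1..n} \<times> {..<n - 1}. horner_step K h n i j) *
    (selector K h n * (\<Prod>i\<in>{1..n}. row_output h n i))"

definition nw_guess :: "nat ring \<Rightarrow> (nw_pos \<times> nat \<Rightarrow> nat) \<Rightarrow> nat \<Rightarrow> (nw_var + nat, 'a::field) mpoly"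
  where "nw_guess K h n = (\<Prod>q\<in>nw_positions n. one_hot h {1..n} q) * nw_body K h n"

definition horner_consistent :: "nat ring \<Rightarrow> nat \<Rightarrow> (nw_pos \<Rightarrow> nat) \<Rightarrow> bool"
  where "horner_consistent K n \<phi> \<longleftrightarrow> (\<forall>i\<in>{1..n}. \<phi> (HPos i 0) = \<phi> (APos 0) \<and>
    (\<forall>j<n - 1. \<phi> (HPos i (Suc j)) = (\<phi> (HPos i j) \<otimes>\<^bsub>K\<^esub> i) \<oplus>\<^bsub>K\<^esub> \<phi> (APos (Suc j))))"

section \<open>Correctness of the guess\<close>

lemma finite_nw_positions: "finite (nw_positions n)"
  by (simp add: nw_positions_def)

lemma card_nw_positions_le: "card (nw_positions n) \<le> 1 + n + n\<^sup>2"
proof -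
  have "card (APos ` {..<n} \<union> (\<lambda>(i, j). HPos i j) ` ({1..n} \<times> {..<n})) \<le>
      card (APos ` {..<n}) + card ((\<lambda>(i, j). HPos i j) ` ({1..n} \<times> {..<n}))"
    by (rule card_Un_le)
  also have "\<dots> \<le> card {..<n} + card ({1..n} \<times> {..<n})"
    by (intro add_mono card_image_le) simp_all
  also have "\<dots> = n + n\<^sup>2"
    by (simp add: power2_eq_square)
  finally show ?thesis
    unfolding nw_positions_def by (simp add: card_insert_if)
qed

lemma sum_of_bool_eq_mult:
  assumes "finite A" "a \<in> A"
  shows "(\<Sum>x\<in>A. of_bool (a = x) * f x) = (f a :: 'b::semiring_1)"
proof -
  have "(\<Sum>x\<in>A. of_bool (a = x) * f x) = (\<Sum>x\<in>A. if x = a then f x else 0)"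
    by (intro sum.cong) auto
  then show ?thesis
    using assms by simp
qed

text \<open>On an encoding every local check becomes a truth value: wrong guesses contribute 0, and
  a surviving guess contributes one monomial.\<close>

lemma subst_nw_body:
  assumes K: "field_on n K" and n: "0 < n"
    and h: "bij_betw h (nw_positions n \<times> {1..n}) {..<m}" and \<phi>: "\<phi> \<in> nw_positions n \<rightarrow>\<^sub>E {1..n}"
  shows "subst (set_bits (encoding h (nw_positions n) \<phi>)) (nw_body K h n) =
    (if horner_consistent K n \<phi> then
       Var (YVar (\<phi> TPos)) * (of_bool (\<forall>j<n - n div (2 * \<phi> TPos). \<phi> (APos j) = \<zero>\<^bsub>K\<^esub>) *
         (\<Prod>i\<in>{1..n}. Var (XVar i (\<phi> (HPos i (n - 1))))))
     else (0 :: (nw_var, 'a::field) mpoly))"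
proof -
  interpret field K
    using K by (rule field_on_field)
  note car = field_on_carrier[OF K]
  let ?\<sigma> = "set_bits (encoding h (nw_positions n) \<phi>) :: nw_var + nat \<Rightarrow> (nw_var, 'a) mpoly"
  have pos: "TPos \<in> nw_positions n" "j < n \<Longrightarrow> APos j \<in> nw_positions n"
    "i \<in> {1..n} \<Longrightarrow> j < n \<Longrightarrow> HPos i j \<in> nw_positions n" for i j
    by (auto simp: nw_positions_def)
  have bit: "subst ?\<sigma> (bit_var h q c) = of_bool (\<phi> q = c)" if "q \<in> nw_positions n" "c \<in> {1..n}" for q c
    using subst_bit_var_encoding[OF h \<phi> that] .
  have \<phi>_mem: "\<phi> q \<in> {1..n}" if "q \<in> nw_positions n" for q
    using PiE_mem[OF \<phi> that] .
  have closed: "(a \<otimes>\<^bsub>K\<^esub> b) \<oplus>\<^bsub>K\<^esub> c \<in> {1..n}" if "a \<in> {1..n}" "b \<in> {1..n}" "c \<in> {1..n}" for a b c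
    using that unfolding car[symmetric] by simp
  have zero: "\<zero>\<^bsub>K\<^esub> \<in> {1..n}"
    unfolding car[symmetric] by simp
  have start: "subst ?\<sigma> (horner_start h n i) = of_bool (\<phi> (HPos i 0) = \<phi> (APos 0))" if "i \<in> {1..n}" for i
  proof -
    have "subst ?\<sigma> (horner_start h n i) =
        (\<Sum>c\<in>{1..n}. of_bool (\<phi> (APos 0) = c) * of_bool (\<phi> (HPos i 0) = c))"
      unfolding horner_start_def subst_sum subst_mult using that n pos
      by (intro sum.cong refl arg_cong2[where f = "(*)"] bit) auto
    also have "\<dots> = of_bool (\<phi> (HPos i 0) = \<phi> (APos 0))"
      using \<phi>_mem pos n by (intro sum_of_bool_eq_mult) auto
    finally show ?thesis .
  qed
  have step: "subst ?\<sigma> (horner_step K h n i j) =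
      of_bool (\<phi> (HPos i (Suc j)) = (\<phi> (HPos i j) \<otimes>\<^bsub>K\<^esub> i) \<oplus>\<^bsub>K\<^esub> \<phi> (APos (Suc j)))"
    if i: "i \<in> {1..n}" and j: "j < n - 1" for i j
  proof -
    have p: "HPos i j \<in> nw_positions n" "APos (Suc j) \<in> nw_positions n" "HPos i (Suc j) \<in> nw_positions n"
      using pos i j by auto
    have "subst ?\<sigma> (horner_step K h n i j) =
        (\<Sum>(a, c)\<in>{1..n} \<times> {1..n}. of_bool ((\<phi> (HPos i j), \<phi> (APos (Suc j))) = (a, c)) *
          of_bool (\<phi> (HPos i (Suc j)) = (a \<otimes>\<^bsub>K\<^esub> i) \<oplus>\<^bsub>K\<^esub> c))"
      unfolding horner_step_def subst_sum
    proof (intro sum.cong refl, clarify)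
      fix a c assume "a \<in> {1..n}" "c \<in> {1..n}"
      then show "subst ?\<sigma> (bit_var h (HPos i j) a * bit_var h (APos (Suc j)) c *
          bit_var h (HPos i (Suc j)) ((a \<otimes>\<^bsub>K\<^esub> i) \<oplus>\<^bsub>K\<^esub> c)) =
        of_bool ((\<phi> (HPos i j), \<phi> (APos (Suc j))) = (a, c)) *
          of_bool (\<phi> (HPos i (Suc j)) = (a \<otimes>\<^bsub>K\<^esub> i) \<oplus>\<^bsub>K\<^esub> c)"
        unfolding subst_mult using bit p closed[OF _ i] by simp
    qed
    also have "\<dots> = (\<Sum>x\<in>{1..n} \<times> {1..n}. of_bool ((\<phi> (HPos i j), \<phi> (APos (Suc j))) = x) *
          of_bool (\<phi> (HPos i (Suc j)) = (fst x \<otimes>\<^bsub>K\<^esub> i) \<oplus>\<^bsub>K\<^esub> snd x))"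
      by (simp only: split_def prod.collapse)
    also have "\<dots> = of_bool (\<phi> (HPos i (Suc j)) =
        (fst (\<phi> (HPos i j), \<phi> (APos (Suc j))) \<otimes>\<^bsub>K\<^esub> i) \<oplus>\<^bsub>K\<^esub> snd (\<phi> (HPos i j), \<phi> (APos (Suc j))))"
      by (rule sum_of_bool_eq_mult[where f = "\<lambda>x. of_bool (\<phi> (HPos i (Suc j)) = (fst x \<otimes>\<^bsub>K\<^esub> i) \<oplus>\<^bsub>K\<^esub> snd x) :: (nw_var, 'a) mpoly"])
        (use \<phi>_mem[OF p(1)] \<phi>_mem[OF p(2)] in auto)
    finally show ?thesis
      by simp
  qed
  have sel: "subst ?\<sigma> (selector K h n) =
      Var (YVar (\<phi> TPos)) * of_bool (\<forall>j<n - n div (2 * \<phi> TPos). \<phi> (APos j) = \<zero>\<^bsub>K\<^esub>)"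
  proof -
    have "subst ?\<sigma> (selector K h n) =
        (\<Sum>t\<in>{1..n}. of_bool (\<phi> TPos = t) * (Var (YVar t) *
          of_bool (\<forall>j\<in>{..<n - n div (2 * t)}. \<phi> (APos j) = \<zero>\<^bsub>K\<^esub>)))"
      unfolding selector_def subst_sum
    proof (intro sum.cong refl)
      fix t assume t: "t \<in> {1..n}"
      have "(\<Prod>j\<in>{..<n - n div (2 * t)}. subst ?\<sigma> (bit_var h (APos j) \<zero>\<^bsub>K\<^esub>)) =
          (\<Prod>j\<in>{..<n - n div (2 * t)}. of_bool (\<phi> (APos j) = \<zero>\<^bsub>K\<^esub>))"
        using pos zero by (intro prod.cong refl bit) auto
      then show "subst ?\<sigma> (Var (Inl (YVar t)) * (bit_var h TPos t *
            (\<Prod>j\<in>{..<n - n div (2 * t)}. bit_var h (APos j) \<zero>\<^bsub>K\<^esub>))) =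
          of_bool (\<phi> TPos = t) * (Var (YVar t) * of_bool (\<forall>j\<in>{..<n - n div (2 * t)}. \<phi> (APos j) = \<zero>\<^bsub>K\<^esub>))"
        unfolding subst_mult subst_prod bit[OF pos(1) t] by (simp add: prod_of_bool mult_ac)
    qed
    also have "\<dots> = Var (YVar (\<phi> TPos)) * of_bool (\<forall>j\<in>{..<n - n div (2 * \<phi> TPos)}. \<phi> (APos j) = \<zero>\<^bsub>K\<^esub>)"
      using \<phi>_mem pos by (intro sum_of_bool_eq_mult) auto
    finally show ?thesis
      by (simp add: Ball_def)
  qed
  have out: "subst ?\<sigma> (row_output h n i) = Var (XVar i (\<phi> (HPos i (n - 1))))" if i: "i \<in> {1..n}" for i
  proof -
    have p: "HPos i (n - 1) \<in> nw_positions n"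
      using pos i n by auto
    have "subst ?\<sigma> (row_output h n i) = (\<Sum>c\<in>{1..n}. of_bool (\<phi> (HPos i (n - 1)) = c) * Var (XVar i c))"
      unfolding row_output_def subst_sum subst_mult using bit[OF p] by (intro sum.cong refl) simp
    also have "\<dots> = Var (XVar i (\<phi> (HPos i (n - 1))))"
      using \<phi>_mem[OF p] by (intro sum_of_bool_eq_mult) auto
    finally show ?thesis .
  qed
  have "subst ?\<sigma> (nw_body K h n) =
      of_bool (\<forall>i\<in>{1..n}. \<phi> (HPos i 0) = \<phi> (APos 0)) *
      of_bool (\<forall>x\<in>{1..n} \<times> {..<n - 1}.
        \<phi> (HPos (fst x) (Suc (snd x))) = (\<phi> (HPos (fst x) (snd x)) \<otimes>\<^bsub>K\<^esub> fst x) \<oplus>\<^bsub>K\<^esub> \<phi> (APos (Suc (snd x)))) *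
      (Var (YVar (\<phi> TPos)) * of_bool (\<forall>j<n - n div (2 * \<phi> TPos). \<phi> (APos j) = \<zero>\<^bsub>K\<^esub>) *
        (\<Prod>i\<in>{1..n}. Var (XVar i (\<phi> (HPos i (n - 1))))))"
    unfolding nw_body_def subst_mult subst_prod sel
    by (subst (1 2) prod_of_bool[symmetric], simp, simp)
      (intro arg_cong2[where f = "(*)"] prod.cong refl; auto simp: start step out)
  moreover have "horner_consistent K n \<phi> \<longleftrightarrow> (\<forall>i\<in>{1..n}. \<phi> (HPos i 0) = \<phi> (APos 0)) \<and>
      (\<forall>x\<in>{1..n} \<times> {..<n - 1}.
        \<phi> (HPos (fst x) (Suc (snd x))) = (\<phi> (HPos (fst x) (snd x)) \<otimes>\<^bsub>K\<^esub> fst x) \<oplus>\<^bsub>K\<^esub> \<phi> (APos (Suc (snd x))))"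
    unfolding horner_consistent_def by auto
  ultimately show ?thesis
    by (simp add: mult.assoc)
qed

text \<open>Lists start with the leading coefficient, so appending an entry is one step of Horner's
  scheme; at \<open>j = n - 1\<close> the whole list has been evaluated.\<close>

lemma horner_consistent_eval:
  assumes K: "field_on n K" and n: "0 < n" and \<phi>: "\<phi> \<in> nw_positions n \<rightarrow>\<^sub>E {1..n}"
    and "horner_consistent K n \<phi>" "i \<in> {1..n}" "j < n"
  shows "\<phi> (HPos i j) = ring.eval K (take (Suc j) (map (\<lambda>j. \<phi> (APos j)) [0..<n])) i"
proof -
  interpret field K
    using K by (rule field_on_field)
  note car = field_on_carrier[OF K]
  have A: "\<phi> (APos j) \<in> carrier K" if "j < n" for j
    using PiE_mem[OF \<phi>, of "APos j"] that by (auto simp: car nw_positions_def)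
  have i: "i \<in> carrier K"
    using assms by (simp add: car)
  show ?thesis
    using \<open>j < n\<close>
  proof (induction j)
    case 0
    then show ?case
      using assms(4,5) A[OF n] i by (simp add: horner_consistent_def take_Suc_conv_app_nth)
  next
    case (Suc j)
    have "ring.eval K (take (Suc (Suc j)) (map (\<lambda>j. \<phi> (APos j)) [0..<n])) i =
        ring.eval K (take (Suc j) (map (\<lambda>j. \<phi> (APos j)) [0..<n]) @ [\<phi> (APos (Suc j))]) i"
      using Suc.prems by (simp add: take_Suc_conv_app_nth)
    also have "\<dots> = (\<phi> (HPos i j) \<otimes>\<^bsub>K\<^esub> i) \<oplus>\<^bsub>K\<^esub> \<phi> (APos (Suc j))"
      using Suc A i by (subst eval_append_aux) (auto simp: take_map dest!: in_set_takeD)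
    also have "\<dots> = \<phi> (HPos i (Suc j))"
      using assms(4,5) Suc.prems by (simp add: horner_consistent_def)
    finally show ?case ..
  qed
qed

text \<open>Lists of the one length \<open>n\<close> serve for all degree bounds: the normal form
  has length at most \<open>d\<close> exactly if the first \<open>n - d\<close> entries
  vanish.\<close>

lemma bij_betw_normalize_padded:
  assumes K: "field K" and d: "d \<le> n"
  shows "bij_betw (ring.normalize K)
    {xs. set xs \<subseteq> carrier K \<and> length xs = n \<and> (\<forall>j<n - d. xs ! j = \<zero>\<^bsub>K\<^esub>)} (low_degree_polys K d)"
proof -
  interpret field K by fact
  have len: "length (normalize xs) \<le> d \<longleftrightarrow> (\<forall>j<n - d. xs ! j = \<zero>\<^bsub>K\<^esub>)" if xs: "length xs = n" for xs
  proof
    assume le: "length (normalize xs) \<le> d"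
    have eq: "xs = replicate (n - length (normalize xs)) \<zero>\<^bsub>K\<^esub> @ normalize xs"
      using normalize_def'[of xs] xs by simp
    show "\<forall>j<n - d. xs ! j = \<zero>\<^bsub>K\<^esub>"
    proof (intro allI impI)
      fix j assume "j < n - d"
      then have "j < n - length (normalize xs)"
        using le by linarith
      then show "xs ! j = \<zero>\<^bsub>K\<^esub>"
        by (subst eq) (simp add: nth_append)
    qed
  next
    assume zeros: "\<forall>j<n - d. xs ! j = \<zero>\<^bsub>K\<^esub>"
    have "take (n - d) xs = replicate (n - d) \<zero>\<^bsub>K\<^esub>"
      using zeros xs by (intro nth_equalityI) auto
    then have "xs = replicate (n - d) \<zero>\<^bsub>K\<^esub> @ drop (n - d) xs"
      by (metis append_take_drop_id)
    then have "normalize xs = normalize (drop (n - d) xs)"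
      by (metis normalize_replicate_zero)
    then show "length (normalize xs) \<le> d"
      using normalize_length_le[of "drop (n - d) xs"] xs d by simp
  qed
  note bij = bij_betw_normalize_low_degree[OF K, of n]
  have sub: "low_degree_polys K d = {f \<in> low_degree_polys K n. length f \<le> d}"
    using d by (auto simp: low_degree_polys_iff)
  have "normalize ` {xs. set xs \<subseteq> carrier K \<and> length xs = n \<and> (\<forall>j<n - d. xs ! j = \<zero>\<^bsub>K\<^esub>)} =
      {f \<in> normalize ` {xs. set xs \<subseteq> carrier K \<and> length xs = n}. length f \<le> d}"
    using len by auto
  also have "\<dots> = low_degree_polys K d"
    unfolding sub bij_betw_imp_surj_on[OF bij] ..
  finally show ?thesis
    by (intro bij_betw_subset[OF bij]) auto
qed

text \<open>All \<open>t\<close> range over the same lists, and the degree bound becomes a 0/1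
  factor, in the form that \<open>selector\<close> checks.\<close>

lemma NW_eq_padded_sum:
  assumes K: "field_on n K"
  shows "NW K n = (\<Sum>(t, xs)\<in>{1..n} \<times> {xs. set xs \<subseteq> {1..n} \<and> length xs = n}.
    Var (YVar t) * (of_bool (\<forall>j<n - n div (2 * t). xs ! j = \<zero>\<^bsub>K\<^esub>) *
      (\<Prod>i\<in>{1..n}. Var (XVar i (ring.eval K xs i)))) :: (nw_var, 'a::field) mpoly)"
proof -
  interpret field K
    using K by (rule field_on_field)
  note car = field_on_carrier[OF K]
  let ?L = "{xs. set xs \<subseteq> {1..n} \<and> length xs = n}"
  let ?Z = "\<lambda>t xs. \<forall>j<n - n div (2 * t). xs ! j = \<zero>\<^bsub>K\<^esub>"
  let ?X = "\<lambda>xs. \<Prod>i\<in>{1..n}. Var (XVar i (ring.eval K xs i)) :: (nw_var, 'a) mpoly"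
  have fin: "finite ?L"
    using finite_lists_length_eq[of "{1..n}" n] by simp
  have "NW_t K t n = (\<Sum>xs\<in>?L. of_bool (?Z t xs) * ?X xs)" for t
  proof -
    have bij: "bij_betw normalize {xs \<in> ?L. ?Z t xs} (low_degree_polys K (n div (2 * t)))"
      using bij_betw_normalize_padded[OF field_on_field[OF K] div_le_dividend, of n "2 * t"]
      by (simp add: car conj_assoc)
    have "NW_t K t n = (\<Sum>xs\<in>{xs \<in> ?L. ?Z t xs}. ?X (normalize xs))"
      unfolding NW_t_def by (rule sum.reindex_bij_betw[OF bij, symmetric])
    also have "\<dots> = (\<Sum>xs\<in>{xs \<in> ?L. ?Z t xs}. ?X xs)"
    proof (intro sum.cong prod.cong refl)
      fix xs i assume "xs \<in> {xs \<in> ?L. ?Z t xs}" "i \<in> {1..n}"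
      then show "Var (XVar i (eval (normalize xs) i)) = (Var (XVar i (eval xs i)) :: (nw_var, 'a) mpoly)"
        by (subst eval_normalize) (auto simp: car)
    qed
    also have "\<dots> = (\<Sum>xs\<in>?L. if ?Z t xs then ?X xs else 0)"
      by (rule sum.inter_filter[OF fin])
    also have "\<dots> = (\<Sum>xs\<in>?L. of_bool (?Z t xs) * ?X xs)"
      by (intro sum.cong) auto
    finally show ?thesis .
  qed
  then show ?thesis
    unfolding NW_def by (simp only: sum_distrib_left sum.cartesian_product)
qed

text \<open>The only consistent guess for given \<open>t\<close> and \<open>xs\<close>;
  \<open>restrict\<close> puts it into the extensional function space.\<close>

definition horner_assignment :: "nat ring \<Rightarrow> nat \<Rightarrow> nat \<Rightarrow> nat list \<Rightarrow> nw_pos \<Rightarrow> nat"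
  where "horner_assignment K n t xs = restrict (\<lambda>q. case q of TPos \<Rightarrow> t | APos j \<Rightarrow> xs ! j
    | HPos i j \<Rightarrow> ring.eval K (take (Suc j) xs) i) (nw_positions n)"

lemma horner_assignment_simps:
  "horner_assignment K n t xs TPos = t"
  "j < n \<Longrightarrow> horner_assignment K n t xs (APos j) = xs ! j"
  "i \<in> {1..n} \<Longrightarrow> j < n \<Longrightarrow> horner_assignment K n t xs (HPos i j) = ring.eval K (take (Suc j) xs) i"
  by (auto simp: horner_assignment_def nw_positions_def)

lemma horner_assignment_consistent:
  assumes K: "field_on n K" and n: "0 < n" and t: "t \<in> {1..n}" and xs: "set xs \<subseteq> {1..n}" "length xs = n"
  shows "horner_assignment K n t xs \<in> nw_positions n \<rightarrow>\<^sub>E {1..n}"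
    and "horner_consistent K n (horner_assignment K n t xs)"
proof -
  interpret field K
    using K by (rule field_on_field)
  note car = field_on_carrier[OF K]
  have x: "xs ! j \<in> carrier K" if "j < n" for j
  proof -
    have "xs ! j \<in> set xs"
      using that xs(2) by simp
    then show ?thesis
      using xs(1) unfolding car by blast
  qed
  have take: "set (take j xs) \<subseteq> carrier K" for j
    using xs set_take_subset[of j xs] by (auto simp: car)
  have val: "eval (take j xs) i \<in> {1..n}" if "i \<in> {1..n}" for i j
    using eval_in_carrier[OF take] that by (simp add: car)
  show "horner_assignment K n t xs \<in> nw_positions n \<rightarrow>\<^sub>E {1..n}"
    unfolding horner_assignment_def restrict_PiE_iff
  proof
    fix q assume "q \<in> nw_positions n"
    then show "(case q of TPos \<Rightarrow> t | APos j \<Rightarrow> xs ! j | HPos i j \<Rightarrow> eval (take (Suc j) xs) i) \<in> {1..n}"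
      using t x val by (cases q) (auto simp: nw_positions_def car)
  qed
  show "horner_consistent K n (horner_assignment K n t xs)"
    unfolding horner_consistent_def
  proof (intro ballI conjI allI impI)
    fix i assume i: "i \<in> {1..n}"
    have "take (Suc 0) xs = [xs ! 0]"
      using xs n by (simp add: take_Suc_conv_app_nth)
    then show "horner_assignment K n t xs (HPos i 0) = horner_assignment K n t xs (APos 0)"
      using i n x[OF n] by (simp add: horner_assignment_simps car)
    fix j assume j: "j < n - 1"
    have "take (Suc (Suc j)) xs = take (Suc j) xs @ [xs ! Suc j]"
      using xs j by (intro take_Suc_conv_app_nth) simp
    then have "eval (take (Suc (Suc j)) xs) i = (eval (take (Suc j) xs) i \<otimes>\<^bsub>K\<^esub> i) \<oplus>\<^bsub>K\<^esub> xs ! Suc j"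
      using eval_append_aux[OF take x, of "Suc j" i "Suc j"] i j by (simp add: car)
    then show "horner_assignment K n t xs (HPos i (Suc j)) =
        (horner_assignment K n t xs (HPos i j) \<otimes>\<^bsub>K\<^esub> i) \<oplus>\<^bsub>K\<^esub> horner_assignment K n t xs (APos (Suc j))"
      using i j by (simp add: horner_assignment_simps)
  qed
qed

lemma horner_assignment_eqI:
  assumes K: "field_on n K" and n: "0 < n" and \<phi>: "\<phi> \<in> nw_positions n \<rightarrow>\<^sub>E {1..n}"
    and c: "horner_consistent K n \<phi>"
  shows "horner_assignment K n (\<phi> TPos) (map (\<lambda>j. \<phi> (APos j)) [0..<n]) = \<phi>"
proof
  fix q
  show "horner_assignment K n (\<phi> TPos) (map (\<lambda>j. \<phi> (APos j)) [0..<n]) q = \<phi> q"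
  proof (cases "q \<in> nw_positions n")
    case True
    then consider "q = TPos" | j where "q = APos j" "j < n" | i j where "q = HPos i j" "i \<in> {1..n}" "j < n"
      by (auto simp: nw_positions_def)
    then show ?thesis
      by cases (simp_all add: horner_assignment_simps horner_consistent_eval[OF K n \<phi> c])
  next
    case False
    then show ?thesis
      using PiE_arb[OF \<phi> False] by (simp add: horner_assignment_def)
  qed
qed

text \<open>Since Horner's scheme determines all intermediate values, consistent guesses correspond
  bijectively to pairs \<open>(t, xs)\<close>.\<close>

lemma NW_eq_guess_sum:
  assumes K: "field_on n K" and n: "0 < n" and h: "bij_betw h (nw_positions n \<times> {1..n}) {..<m}"
  shows "(NW K n :: (nw_var, 'a::field) mpoly) = (\<Sum>e\<in>Pow {..<m}. subst (set_bits e) (nw_guess K h n))"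
proof -
  let ?P = "nw_positions n"
  let ?F = "\<lambda>\<phi>. Var (YVar (\<phi> TPos)) * (of_bool (\<forall>j<n - n div (2 * \<phi> TPos). \<phi> (APos j) = \<zero>\<^bsub>K\<^esub>) *
         (\<Prod>i\<in>{1..n}. Var (XVar i (\<phi> (HPos i (n - 1)))))) :: (nw_var, 'a) mpoly"
  let ?T = "{1..n} \<times> {xs. set xs \<subseteq> {1..n} \<and> length xs = n}"
  have fin: "finite (?P \<rightarrow>\<^sub>E {1..n})"
    by (intro finite_PiE finite_nw_positions) simp
  have "(\<Sum>e\<in>Pow {..<m}. subst (set_bits e) (nw_guess K h n)) =
      (\<Sum>\<phi>\<in>?P \<rightarrow>\<^sub>E {1..n}. subst (set_bits (encoding h ?P \<phi>)) (nw_body K h n :: (nw_var + nat, 'a) mpoly))"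
    unfolding nw_guess_def by (rule sum_one_hot_encodings[OF finite_nw_positions _ h]) simp
  also have "\<dots> = (\<Sum>\<phi>\<in>?P \<rightarrow>\<^sub>E {1..n}. if horner_consistent K n \<phi> then ?F \<phi> else 0)"
    by (intro sum.cong refl subst_nw_body[OF K n h])
  also have "\<dots> = (\<Sum>\<phi>\<in>{\<phi> \<in> ?P \<rightarrow>\<^sub>E {1..n}. horner_consistent K n \<phi>}. ?F \<phi>)"
    by (rule sum.inter_filter[OF fin, symmetric])
  also have "\<dots> = (\<Sum>(t, xs)\<in>?T. Var (YVar t) * (of_bool (\<forall>j<n - n div (2 * t). xs ! j = \<zero>\<^bsub>K\<^esub>) *
      (\<Prod>i\<in>{1..n}. Var (XVar i (ring.eval K xs i)))))"
  proof (rule sum.reindex_bij_witness[where i = "\<lambda>(t, xs). horner_assignment K n t xs"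
        and j = "\<lambda>\<phi>. (\<phi> TPos, map (\<lambda>j. \<phi> (APos j)) [0..<n])"])
    fix \<phi> assume "\<phi> \<in> {\<phi> \<in> ?P \<rightarrow>\<^sub>E {1..n}. horner_consistent K n \<phi>}"
    then have \<phi>: "\<phi> \<in> ?P \<rightarrow>\<^sub>E {1..n}" "horner_consistent K n \<phi>"
      by auto
    show "(case (\<phi> TPos, map (\<lambda>j. \<phi> (APos j)) [0..<n]) of (t, xs) \<Rightarrow> horner_assignment K n t xs) = \<phi>"
      using horner_assignment_eqI[OF K n \<phi>] by simp
    have "\<phi> q \<in> {1..n}" if "q \<in> ?P" for q
      using PiE_mem[OF \<phi>(1) that] .
    then show "(\<phi> TPos, map (\<lambda>j. \<phi> (APos j)) [0..<n]) \<in> ?T"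
      by (auto simp: nw_positions_def)
    have "\<phi> (HPos i (n - 1)) = ring.eval K (map (\<lambda>j. \<phi> (APos j)) [0..<n]) i" if "i \<in> {1..n}" for i
      using horner_consistent_eval[OF K n \<phi> that, of "n - 1"] n by simp
    then show "(case (\<phi> TPos, map (\<lambda>j. \<phi> (APos j)) [0..<n]) of (t, xs) \<Rightarrow>
        Var (YVar t) * (of_bool (\<forall>j<n - n div (2 * t). xs ! j = \<zero>\<^bsub>K\<^esub>) *
          (\<Prod>i\<in>{1..n}. Var (XVar i (ring.eval K xs i))))) = ?F \<phi>"
      by (auto intro!: arg_cong2[where f = "(*)"] prod.cong)
  next
    fix x assume "x \<in> ?T"
    then obtain t xs where x: "x = (t, xs)" "t \<in> {1..n}" "set xs \<subseteq> {1..n}" "length xs = n"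
      by blast
    show "(case x of (t, xs) \<Rightarrow> horner_assignment K n t xs) \<in> {\<phi> \<in> ?P \<rightarrow>\<^sub>E {1..n}. horner_consistent K n \<phi>}"
      using horner_assignment_consistent[OF K n x(2-4)] x(1) by simp
    show "((case x of (t, xs) \<Rightarrow> horner_assignment K n t xs) TPos,
        map (\<lambda>j. (case x of (t, xs) \<Rightarrow> horner_assignment K n t xs) (APos j)) [0..<n]) = x"
      using x(4) by (auto simp: x(1) horner_assignment_simps intro!: nth_equalityI)
  qed
  finally show ?thesis
    unfolding NW_eq_padded_sum[OF K] by simp
qed

subsection \<open>The size of the guessing circuit\<close>

definition nw_guess_vars :: "nat \<Rightarrow> nat \<Rightarrow> (nw_var + nat) set"
  where "nw_guess_vars n m = Inl ` (x_vars n \<union> YVar ` {1..n}) \<union> Inr ` {..<m}"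

lemma computable_one_hot:
  assumes "\<And>c. c \<in> {1..n} \<Longrightarrow> computable V (bit_var h q c :: ('v + nat, 'a::field) mpoly) 1"
  shows "computable V (one_hot h {1..n} q :: ('v + nat, 'a) mpoly) (Suc (n * (5 * n + 3)))"
  unfolding one_hot_def
proof (rule computable_sum(1))
  fix c assume c: "c \<in> {1..n}"
  have "computable V (Const 1 + Const (- 1) * bit_var h q c' :: ('v + nat, 'a) mpoly) 5" if "c' \<in> {1..n} - {c}" for c'
  proof -
    have "computable V (Const 1 + Const (- 1) * bit_var h q c' :: ('v + nat, 'a) mpoly) (1 + (1 + 1 + 1) + 1)"
      using that by (intro computable_add computable_mult computable_Const assms) simp
    then show ?thesis
      by (rule computable_mono) simp
  qed
  then have "computable V (\<Prod>c'\<in>{1..n} - {c}. Const 1 + Const (- 1) * bit_var h q c' :: ('v + nat, 'a) mpoly) (Suc (n * 5))"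
    using card_Diff1_le[of "{1..n}" c] by (intro computable_sum(2)) auto
  from computable_mult[OF assms[OF c] this]
  show "computable V (bit_var h q c * (\<Prod>c'\<in>{1..n} - {c}. Const 1 + Const (- 1) * bit_var h q c') :: ('v + nat, 'a) mpoly)
      (5 * n + 3)"
    by (rule computable_mono) simp
qed simp_all

text \<open>Two parts have order \<open>n ^ 4\<close>: the one-hot checks, of quadratic size at
  about \<open>n ^ 2\<close> positions, and the Horner steps, each a sum over \<open>n ^ 2\<close>
  pairs. The coefficients add up to 56; 128 is generous.\<close>

lemma computable_nw_guess:
  assumes K: "field_on n K" and n: "0 < n" and h: "bij_betw h (nw_positions n \<times> {1..n}) {..<m}"
  shows "computable (nw_guess_vars n m) (nw_guess K h n :: (nw_var + nat, 'a::field) mpoly) (128 * n ^ 4)"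
proof -
  interpret field K
    using K by (rule field_on_field)
  note car = field_on_carrier[OF K]
  let ?V = "nw_guess_vars n m"
  have pos: "TPos \<in> nw_positions n" "j < n \<Longrightarrow> APos j \<in> nw_positions n"
    "i \<in> {1..n} \<Longrightarrow> j < n \<Longrightarrow> HPos i j \<in> nw_positions n" for i j
    by (auto simp: nw_positions_def)
  have bit: "computable ?V (bit_var h q c :: (nw_var + nat, 'a) mpoly) 1"
    if "q \<in> nw_positions n" "c \<in> {1..n}" for q c
  proof -
    have "h (q, c) \<in> h ` (nw_positions n \<times> {1..n})"
      using that by blast
    then have "h (q, c) < m"
      using bij_betw_imp_surj_on[OF h] by simp
    then show ?thesis
      by (intro computable_Var) (simp add: nw_guess_vars_def)
  qed
  have closed: "(a \<otimes>\<^bsub>K\<^esub> b) \<oplus>\<^bsub>K\<^esub> c \<in> {1..n}" if "a \<in> {1..n}" "b \<in> {1..n}" "c \<in> {1..n}" for a b c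
    using that unfolding car[symmetric] by simp
  have zero: "\<zero>\<^bsub>K\<^esub> \<in> {1..n}"
    unfolding car[symmetric] by simp
  have x: "computable ?V (Var (Inl (XVar i c)) :: (nw_var + nat, 'a) mpoly) 1"
    if "i \<in> {1..n}" "c \<in> {1..n}" for i c
  proof -
    have "XVar i c \<in> x_vars n"
      using that by (force simp: x_vars_def)
    then show ?thesis
      by (intro computable_Var) (simp add: nw_guess_vars_def)
  qed
  have y: "computable ?V (Var (Inl (YVar i)) :: (nw_var + nat, 'a) mpoly) 1" if "i \<in> {1..n}" for i
    using that by (intro computable_Var) (auto simp: nw_guess_vars_def)
  \<comment> \<open>The sizes stay unevaluated, in the shape \<open>s + t + 1\<close> of
    \<open>computable_mult\<close>, so that the rules apply directly.\<close>
  have start: "computable ?V (horner_start h n i :: (nw_var + nat, 'a) mpoly) (Suc (n * (1 + 1 + 1)))"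
    if "i \<in> {1..n}" for i
    unfolding horner_start_def using that n pos
    by (intro computable_sum(1) computable_mult bit) auto
  have starts: "computable ?V (\<Prod>i\<in>{1..n}. horner_start h n i :: (nw_var + nat, 'a) mpoly)
      (Suc (n * Suc (n * (1 + 1 + 1))))"
    by (intro computable_sum(2) start) auto
  have step: "computable ?V (horner_step K h n i j :: (nw_var + nat, 'a) mpoly)
      (Suc (n * n * (1 + 1 + 1 + 1 + 1)))"
    if "i \<in> {1..n}" "j < n - 1" for i j
    unfolding horner_step_def
  proof (rule computable_sum(1))
    fix x assume "x \<in> {1..n} \<times> {1..n}"
    then obtain a c where x: "x = (a, c)" "a \<in> {1..n}" "c \<in> {1..n}"
      by blast
    have j: "j < n" "Suc j < n"
      using that by auto
    show "computable ?V ((case x of (a, c) \<Rightarrow> bit_var h (HPos i j) a * bit_var h (APos (Suc j)) c *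
        bit_var h (HPos i (Suc j)) ((a \<otimes>\<^bsub>K\<^esub> i) \<oplus>\<^bsub>K\<^esub> c)) :: (nw_var + nat, 'a) mpoly) (1 + 1 + 1 + 1 + 1)"
      unfolding x(1) prod.case
      by (intro computable_mult bit pos closed that x j)
  qed simp_all
  have steps: "computable ?V (\<Prod>(i, j)\<in>{1..n} \<times> {..<n - 1}. horner_step K h n i j :: (nw_var + nat, 'a) mpoly)
      (Suc (n * n * Suc (n * n * (1 + 1 + 1 + 1 + 1))))"
  proof (rule computable_sum(2))
    fix x assume "x \<in> {1..n} \<times> {..<n - 1}"
    then obtain i j where x: "x = (i, j)" "i \<in> {1..n}" "j < n - 1"
      by auto
    show "computable ?V ((case x of (i, j) \<Rightarrow> horner_step K h n i j) :: (nw_var + nat, 'a) mpoly)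
        (Suc (n * n * (1 + 1 + 1 + 1 + 1)))"
      unfolding x(1) prod.case by (rule step[OF x(2,3)])
  qed simp_all
  have sel: "computable ?V (selector K h n :: (nw_var + nat, 'a) mpoly)
      (Suc (n * (1 + (1 + Suc (n * 1) + 1) + 1)))"
    unfolding selector_def using pos zero
    by (intro computable_sum computable_mult bit y) auto
  have out: "computable ?V (row_output h n i :: (nw_var + nat, 'a) mpoly) (Suc (n * (1 + 1 + 1)))"
    if "i \<in> {1..n}" for i
    unfolding row_output_def using that n pos
    by (intro computable_sum(1) computable_mult bit x) auto
  have outs: "computable ?V (\<Prod>i\<in>{1..n}. row_output h n i :: (nw_var + nat, 'a) mpoly)
      (Suc (n * Suc (n * (1 + 1 + 1))))"
    by (intro computable_sum(2) out) auto
  have ones: "computable ?V (\<Prod>q\<in>nw_positions n. one_hot h {1..n} q :: (nw_var + nat, 'a) mpoly)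
      (Suc ((1 + n + n\<^sup>2) * Suc (n * (5 * n + 3))))"
    by (intro computable_sum(2) computable_one_hot finite_nw_positions card_nw_positions_le bit)
  note guess = computable_mult[OF ones computable_mult[OF computable_mult[OF starts steps] computable_mult[OF sel outs]]]
  show ?thesis
    unfolding nw_guess_def nw_body_def
  proof (rule computable_mono[OF guess])
    have pow: "n ^ 0 \<le> n ^ 4" "n ^ 1 \<le> n ^ 4" "n ^ 2 \<le> n ^ 4" "n ^ 3 \<le> n ^ 4"
      using n by - (rule power_increasing, simp, simp)+
    have "Suc ((1 + n + n\<^sup>2) * Suc (n * (5 * n + 3))) +
        (Suc (n * Suc (n * (1 + 1 + 1))) + Suc (n * n * Suc (n * n * (1 + 1 + 1 + 1 + 1))) + 1 +
         (Suc (n * (1 + (1 + Suc (n * 1) + 1) + 1)) + Suc (n * Suc (n * (1 + 1 + 1))) + 1) + 1) + 1 =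
        10 * n ^ 4 + 8 * n ^ 3 + 17 * n ^ 2 + 11 * n ^ 1 + 10 * n ^ 0"
      by (simp add: eval_nat_numeral algebra_simps)
    also have "\<dots> \<le> 128 * n ^ 4"
      using pow by linarith
    finally show "Suc ((1 + n + n\<^sup>2) * Suc (n * (5 * n + 3))) +
        (Suc (n * Suc (n * (1 + 1 + 1))) + Suc (n * n * Suc (n * n * (1 + 1 + 1 + 1 + 1))) + 1 +
         (Suc (n * (1 + (1 + Suc (n * 1) + 1) + 1)) + Suc (n * Suc (n * (1 + 1 + 1))) + 1) + 1) + 1
        \<le> 128 * n ^ 4" .
  qed
qed

lemma NW_VNP_witness:
  assumes K: "field_on n K" and n: "2 \<le> n"
  shows "\<exists>m g C. m \<le> 128 * n ^ 4 \<and> card (vars g) \<le> 128 * n ^ 4 \<and> total_degree g \<le> 128 * n ^ 4 \<and>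
    computes C g \<and> circuit_size C \<le> 128 * n ^ 4 \<and> vars g \<subseteq> range Inl \<union> Inr ` {..<m} \<and>
    (NW K n :: (nw_var, 'a::field) mpoly) =
      (\<Sum>e\<in>Pow {..<m}. subst (case_sum Var (\<lambda>k. if k \<in> e then 1 else 0)) g)"
proof -
  define m where "m = card (nw_positions n \<times> {1..n})"
  obtain h where h: "bij_betw h (nw_positions n \<times> {1..n}) {..<m}"
    using ex_bij_betw_finite_nat[of "nw_positions n \<times> {1..n}"] finite_nw_positions
    by (auto simp: m_def atLeast0LessThan)
  define g where "g = (nw_guess K h n :: (nw_var + nat, 'a) mpoly)"
  have n0: "0 < n"
    using n by simp
  have pow: "n ^ 1 \<le> n ^ 4" "n ^ 2 \<le> n ^ 4" "n ^ 3 \<le> n ^ 4"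
    using n by - (rule power_increasing, simp, simp)+
  have "m \<le> (1 + n + n\<^sup>2) * n"
    unfolding m_def card_cartesian_product by (intro mult_mono card_nw_positions_le) auto
  also have "\<dots> = n ^ 1 + n ^ 2 + n ^ 3"
    by (simp add: power2_eq_square power3_eq_cube algebra_simps)
  finally have m: "m \<le> 3 * n ^ 4"
    using pow by linarith
  obtain C where C: "computes C g" "circuit_size C \<le> 128 * n ^ 4" and g: "g \<in> polys (nw_guess_vars n m) (128 * n ^ 4)"
    using computable_nw_guess[OF K n0 h, where 'a = 'a] by (auto simp: computable_def g_def)
  have vars: "vars g \<subseteq> nw_guess_vars n m"
    using g by (auto simp: vars_def polys_def mons_def)
  have fin: "finite (nw_guess_vars n m)"
    by (simp add: nw_guess_vars_def)
  have "card (vars g) \<le> card (nw_guess_vars n m)"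
    using vars fin by (rule card_mono[rotated])
  also have "\<dots> \<le> card (Inl ` (x_vars n \<union> YVar ` {1..n}) :: (nw_var + nat) set) + card (Inr ` {..<m} :: (nw_var + nat) set)"
    unfolding nw_guess_vars_def by (rule card_Un_le)
  also have "\<dots> \<le> card (x_vars n \<union> YVar ` {1..n}) + card {..<m}"
    by (intro add_mono card_image_le) simp_all
  also have "\<dots> \<le> (card (x_vars n) + card (YVar ` {1..n})) + m"
    using card_Un_le[of "x_vars n" "YVar ` {1..n}"] by simp
  also have "\<dots> \<le> (n ^ 2 + n ^ 1) + m"
    using card_image_le[of "{1..n}" YVar] by (simp add: card_x_vars)
  finally have "card (vars g) \<le> 128 * n ^ 4"
    using pow m by linarith
  moreover have "vars g \<subseteq> range Inl \<union> Inr ` {..<m}"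
    using vars by (auto simp: nw_guess_vars_def)
  moreover have "m \<le> 128 * n ^ 4"
    using m by linarith
  moreover have "(NW K n :: (nw_var, 'a) mpoly) =
      (\<Sum>e\<in>Pow {..<m}. subst (case_sum Var (\<lambda>k. if k \<in> e then 1 else 0)) g)"
    using NW_eq_guess_sum[OF K n0 h, where 'a = 'a] by (simp add: g_def set_bits_def)
  ultimately show ?thesis
    using C total_degree_le[OF g] by blast
qed

text \<open>128 is \<open>2 ^ 7\<close>, hence at most \<open>n ^ 7\<close>; together with
  \<open>n ^ 4\<close> this gives the exponent 11.\<close>

lemma poly_boundedI:
  assumes "\<And>n. n \<in> I \<Longrightarrow> 2 \<le> n" "\<And>n. n \<in> I \<Longrightarrow> f n \<le> 128 * n ^ 4"
  shows "poly_bounded I f"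
  unfolding poly_bounded_def
proof (intro exI[of _ 11] ballI)
  fix n assume n: "n \<in> I"
  have "2 ^ 7 \<le> n ^ 7"
    using assms(1)[OF n] by (rule power_mono) simp
  then have "2 ^ 7 * n ^ 4 \<le> n ^ 7 * n ^ 4"
    by (rule mult_right_mono) simp
  then show "f n \<le> n ^ 11 + 11"
    using assms(2)[OF n] by (simp flip: power_add)
qed

lemma NW_in_VNP:
  assumes K: "\<And>n. primepow n \<Longrightarrow> field_on n (K n)"
  shows "in_VNP {n. primepow n} (\<lambda>n. NW (K n) n :: (nw_var, 'a::field) mpoly)"
proof -
  have ge2: "2 \<le> n" if "n \<in> {n. primepow n}" for n :: nat
    using primepow_gt_Suc_0[of n] that by simp
  define Q where "Q n m g C \<longleftrightarrow> m \<le> 128 * n ^ 4 \<and> card (vars g) \<le> 128 * n ^ 4 \<and> total_degree g \<le> 128 * n ^ 4 \<and>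
    computes C g \<and> circuit_size C \<le> 128 * n ^ 4 \<and> vars g \<subseteq> range Inl \<union> Inr ` {..<m} \<and>
    (NW (K n) n :: (nw_var, 'a) mpoly) =
      (\<Sum>e\<in>Pow {..<m}. subst (case_sum Var (\<lambda>k. if k \<in> e then 1 else 0)) g)"
    for n m g and C :: "(nw_var + nat, 'a) circuit"
  \<comment> \<open>Number of bits, polynomial and circuit are packed into one triple, so that a
    single choice over \<open>n\<close> suffices.\<close>
  have "\<forall>n\<in>{n. primepow n}. \<exists>x. Q n (fst x) (fst (snd x)) (snd (snd x))"
    unfolding Q_def using NW_VNP_witness[OF K ge2, where 'a = 'a] by (simp add: split_paired_Ex)
  from bchoice[OF this] obtain x where
    x: "\<forall>n\<in>{n. primepow n}. Q n (fst (x n)) (fst (snd (x n))) (snd (snd (x n)))"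
    by (elim exE)
  define m g C where "m n = fst (x n)" and "g n = fst (snd (x n))" and "C n = snd (snd (x n))" for n
  have Q: "Q n (m n) (g n) (C n)" if "n \<in> {n. primepow n}" for n
    using bspec[OF x that] by (simp add: m_def g_def C_def)
  have "in_VP {n. primepow n} g"
    unfolding in_VP_def using Q ge2
    by (intro conjI exI[of _ C] ballI poly_boundedI) (auto simp: Q_def)
  moreover have "poly_bounded {n. primepow n} m"
    using Q ge2 by (intro poly_boundedI) (auto simp: Q_def)
  moreover have "\<forall>n\<in>{n. primepow n}. vars (g n) \<subseteq> range Inl \<union> Inr ` {..<m n} \<and>
      (NW (K n) n :: (nw_var, 'a) mpoly) =
        (\<Sum>e\<in>Pow {..<m n}. subst (case_sum Var (\<lambda>k. if k \<in> e then 1 else 0)) (g n))"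
    using Q unfolding Q_def by blast
  ultimately show ?thesis
    unfolding in_VNP_def by blast
qed

section \<open>Growth along the prime powers\<close>

text \<open>The filter restricts the asymptotics to prime powers, so inequalities that hold there
  suffice; 2 covers both \<open>n + 1\<close> against \<open>n\<close> and
  \<open>n\<^sup>2 + n\<close> against \<open>n\<^sup>2\<close>.\<close>

lemma bigtheta_primepow:
  fixes f g :: "nat \<Rightarrow> real"
  assumes "\<And>n. primepow n \<Longrightarrow> 0 \<le> g n \<and> g n \<le> f n \<and> f n \<le> 2 * g n"
  shows "f \<in> \<Theta>[inf sequentially (principal {n. primepow n})](g)"
proof (rule bigthetaI)
  have "norm (f n) \<le> 2 * norm (g n)" "norm (f n) \<ge> 1 * norm (g n)" if "primepow n" for n
    using assms[OF that] by auto
  then have *: "\<forall>\<^sub>F n in inf sequentially (principal {n. primepow n}). norm (f n) \<le> 2 * norm (g n)"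
    "\<forall>\<^sub>F n in inf sequentially (principal {n. primepow n}). norm (f n) \<ge> 1 * norm (g n)"
    by (auto simp: eventually_inf_principal)
  show "f \<in> O[inf sequentially (principal {n. primepow n})](g)"
    by (rule bigoI[OF *(1)])
  show "f \<in> \<Omega>[inf sequentially (principal {n. primepow n})](g)"
    by (rule landau_omega.bigI[OF _ *(2)]) simp
qed

theorem theorem2p2:
  shows
    "(\<forall>K :: nat \<Rightarrow> nat ring. (\<forall>n. primepow n \<longrightarrow> field_on n (K n)) \<longrightarrow>
        in_VNP {n. primepow n} (\<lambda>n. NW (K n) n :: (nw_var, 'a::field) mpoly) \<and>
        (\<lambda>n. real (total_degree (NW (K n) n :: (nw_var, 'a) mpoly)))
          \<in> \<Theta>[inf sequentially (principal {n. primepow n})](\<lambda>n. real n) \<and>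
        (\<lambda>n. real (card (vars (NW (K n) n :: (nw_var, 'a) mpoly))))
          \<in> \<Theta>[inf sequentially (principal {n. primepow n})](\<lambda>n. real n ^ 2)) \<and>
     (\<exists>\<epsilon>>0. \<exists>n0 :: nat. \<forall>n\<ge>n0. primepow n \<longrightarrow>
        (\<forall>K. field_on n K \<longrightarrow>
          (\<forall>C :: (nw_var, 'a) circuit.
             homogeneous_SPSP_star C \<and> computes C (NW K n) \<longrightarrow>
             real (circuit_size C) \<ge> exp (real n powr \<epsilon>))))"
proof (intro conjI allI impI NW_lower_bound)
  fix K :: "nat \<Rightarrow> nat ring"
  assume K: "\<forall>n. primepow n \<longrightarrow> field_on n (K n)"
  show "in_VNP {n. primepow n} (\<lambda>n. NW (K n) n :: (nw_var, 'a) mpoly)"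
    using K by (intro NW_in_VNP) blast
  have ge2: "2 \<le> n" if "primepow n" for n :: nat
    using primepow_gt_Suc_0[of n] that by simp
  show "(\<lambda>n. real (total_degree (NW (K n) n :: (nw_var, 'a) mpoly)))
      \<in> \<Theta>[inf sequentially (principal {n. primepow n})](\<lambda>n. real n)"
  proof (rule bigtheta_primepow)
    fix n :: nat assume n: "primepow n"
    show "0 \<le> real n \<and> real n \<le> real (total_degree (NW (K n) n :: (nw_var, 'a) mpoly)) \<and>
        real (total_degree (NW (K n) n :: (nw_var, 'a) mpoly)) \<le> 2 * real n"
      using K n ge2[OF n] total_degree_NW(2)[of n "K n", where 'a = 'a] by simp
  qed
  show "(\<lambda>n. real (card (vars (NW (K n) n :: (nw_var, 'a) mpoly))))
      \<in> \<Theta>[inf sequentially (principal {n. primepow n})](\<lambda>n. real n ^ 2)"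
  proof (rule bigtheta_primepow)
    fix n :: nat assume n: "primepow n"
    let ?c = "card (vars (NW (K n) n :: (nw_var, 'a) mpoly))"
    have "n\<^sup>2 \<le> ?c" "?c \<le> n\<^sup>2 + n"
      using card_vars_NW[of n "K n", where 'a = 'a] K n ge2[OF n] by blast+
    moreover have "n \<le> n\<^sup>2"
      by (simp add: power2_eq_square)
    ultimately have "n\<^sup>2 \<le> ?c" "?c \<le> 2 * n\<^sup>2"
      by linarith+
    then have "real (n\<^sup>2) \<le> real ?c" "real ?c \<le> real (2 * n\<^sup>2)"
      by (simp_all only: of_nat_le_iff)
    then show "0 \<le> real n ^ 2 \<and> real n ^ 2 \<le> real ?c \<and> real ?c \<le> 2 * real n ^ 2"
      by simp
  qed
qed

end
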